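(* For $j\in\{\tfrac12,1,\tfrac32,\dots\}$ let $|I\rangle$ be a Haar-random unit vector in $\mathcal{H}_{\mathrm{inv}}=\mathrm{Inv}_{SU(2)}(V_j^{\otimes 4})$. Then random $4$-valent invariant tensors are asymptotically perfect as $j\to\infty$: for every partition of the four tensor factors into two pairs $\{A,\overline{A}\}$, the von Neumann entanglement entropy $S(\rho_A)=-\mathrm{Tr}(\rho_A\ln\rho_A)$ of the reduced density matrix $\rho_A=\mathrm{Tr}_{\overline{A}}|I\rangle\langle I|$ satisfies, with probability tending to $1$, $$S(\rho_A)\sim\ln\!\left[(2j+1)^2\right],$$ the maximal possible value; that is, for every $\varepsilon>0$, $$\lim_{j\to\infty}\mathrm{Prob}\left(\frac{S(\rho_A)}{\ln[(2j+1)^2]}\ge 1-\varepsilon\right)=1 .$$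
   Context: $V_j$ is the irreducible spin-$j$ representation of $SU(2)$ of dimension $2j+1$, and $\mathrm{Inv}_{SU(2)}(V_j^{\otimes 4})$ is the subspace of vectors fixed by the diagonal $SU(2)$ action. A Haar-random unit vector in $\mathcal{H}_{\mathrm{inv}}$ is $U|0\rangle$ with $|0\rangle$ a fixed unit vector and $U$ Haar-distributed in the unitary group of $\mathcal{H}_{\mathrm{inv}}$. A state in $V_j^{\otimes 4}$ is perfect if every reduced density matrix on one or two factors is maximally mixed; for two factors this means having entropy $\ln[(2j+1)^2]$. *)

theory Defs
  imports
    "HOL-Probability.Probability"
    "HOL-Computational_Algebra.Polynomial"
begin

section \<open>Finite-dimensional Hilbert spaces with an arbitrary finite index set\<close>

text \<open>
  The dimensions here depend on the spin, which tends to infinity, so they cannot be types.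
  A vector of \<open>\<complex>\<^sup>I\<close> (\<open>I\<close> a finite set) is a function vanishing outside \<open>I\<close>, an operator is its
  matrix, vanishing outside \<open>I \<times> I\<close>.
\<close>

type_synonym 'i vec = "'i \<Rightarrow> complex"
type_synonym 'i op = "'i \<Rightarrow> 'i \<Rightarrow> complex"

definition vecs :: "'i set \<Rightarrow> 'i vec set" where
  "vecs I = {v. \<forall>x. x \<notin> I \<longrightarrow> v x = 0}"

definition ops :: "'i set \<Rightarrow> 'i op set" where
  "ops I = {X. \<forall>x y. x \<notin> I \<or> y \<notin> I \<longrightarrow> X x y = 0}"

definition inner_prod :: "'i set \<Rightarrow> 'i vec \<Rightarrow> 'i vec \<Rightarrow> complex" where
  "inner_prod I v w = (\<Sum>x\<in>I. cnj (v x) * w x)"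

definition op_apply :: "'i set \<Rightarrow> 'i op \<Rightarrow> 'i vec \<Rightarrow> 'i vec" where
  "op_apply I X v = (\<lambda>x. \<Sum>y\<in>I. X x y * v y)"

definition op_mult :: "'i set \<Rightarrow> 'i op \<Rightarrow> 'i op \<Rightarrow> 'i op" where
  "op_mult I X Y = (\<lambda>x y. \<Sum>z\<in>I. X x z * Y z y)"

definition op_trace :: "'i set \<Rightarrow> 'i op \<Rightarrow> complex" where
  "op_trace I X = (\<Sum>x\<in>I. X x x)"

definition ket_bra :: "'i vec \<Rightarrow> 'i op" where
  "ket_bra v = (\<lambda>x y. v x * cnj (v y))"

definition unit_vecs :: "'i set \<Rightarrow> 'i vec set \<Rightarrow> 'i vec set" where
  "unit_vecs I H = {v \<in> H. inner_prod I v v = 1}"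

definition orthonormal_basis :: "'i set \<Rightarrow> ('i \<Rightarrow> 'i vec) \<Rightarrow> bool" where
  "orthonormal_basis I u \<longleftrightarrow>
     (\<forall>k\<in>I. u k \<in> vecs I) \<and>
     (\<forall>k\<in>I. \<forall>l\<in>I. inner_prod I (u k) (u l) = (if k = l then 1 else 0))"

text \<open>\<open>spectral_op I u d = \<Sum>\<^sub>k d\<^sub>k |u\<^sub>k\<rangle>\<langle>u\<^sub>k|\<close>\<close>

definition spectral_op :: "'i set \<Rightarrow> ('i \<Rightarrow> 'i vec) \<Rightarrow> ('i \<Rightarrow> real) \<Rightarrow> 'i op" where
  "spectral_op I u d = (\<lambda>x y. \<Sum>k\<in>I. complex_of_real (d k) * ket_bra (u k) x y)"

text \<open>
  The functional calculus \<open>f(X)\<close> of a Hermitian operator \<open>X\<close>: the result does not depend on the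
  orthonormal eigenbasis chosen.
\<close>

definition op_fun :: "'i set \<Rightarrow> (real \<Rightarrow> real) \<Rightarrow> 'i op \<Rightarrow> 'i op" where
  "op_fun I f X = (THE Y. \<exists>u d. orthonormal_basis I u \<and> X = spectral_op I u d \<and>
                                Y = spectral_op I u (\<lambda>k. f (d k)))"

text \<open>
  Since \<open>ln 0 = 0\<close> in HOL, the null space of \<open>\<rho>\<close> contributes nothing, which is the usual
  convention \<open>0 ln 0 = 0\<close>. The trace is real for Hermitian \<open>\<rho>\<close>.
\<close>

definition von_neumann_entropy :: "'i set \<Rightarrow> 'i op \<Rightarrow> real" where
  "von_neumann_entropy I \<rho> = - Re (op_trace I (op_mult I \<rho> (op_fun I ln \<rho>)))"

text \<open>
  The unitary group of a subspace \<open>H\<close> of \<open>\<complex>\<^sup>I\<close>. A unitary operator of \<open>H\<close> is represented by its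
  extension by \<open>0\<close> to the orthogonal complement of \<open>H\<close>; the group operation is \<open>op_mult I\<close>
  (and the unit is the orthogonal projection onto \<open>H\<close>).
\<close>

definition unitary_group :: "'i set \<Rightarrow> 'i vec set \<Rightarrow> 'i op set" where
  "unitary_group I H = {U \<in> ops I.
     op_apply I U ` H = H \<and>
     (\<forall>v\<in>H. \<forall>w\<in>H. inner_prod I (op_apply I U v) (op_apply I U w) = inner_prod I v w) \<and>
     (\<forall>v\<in>vecs I. (\<forall>w\<in>H. inner_prod I w v = 0) \<longrightarrow> op_apply I U v = (\<lambda>_. 0))}"

text \<open>
  Normalised Haar measure of a compact group whose carrier \<open>G\<close> is a subset of a topological space:
  the left-invariant Borel probability measure on \<open>G\<close>. Below, \<open>'a\<close> is a type of matrices
  \<open>'i op\<close> with countable \<open>'i\<close>; its product topology induces on matrices supported in a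
  finite \<open>I \<times> I\<close> the usual one.
\<close>

definition haar_prob :: "'a::topological_space set \<Rightarrow> ('a \<Rightarrow> 'a \<Rightarrow> 'a) \<Rightarrow> 'a measure \<Rightarrow> bool" where
  "haar_prob G mul M \<longleftrightarrow>
     prob_space M \<and> sets M = sets (restrict_space borel G) \<and>
     (\<forall>V\<in>G. distr M M (mul V) = M)"


section \<open>Four-valent invariant tensors of \<open>SU(2)\<close>\<close>

definition SU2 :: "(complex^2^2) set" where
  "SU2 = {g. g ** (\<chi> i j. cnj (g $ j $ i)) = mat 1 \<and> det g = 1}"

text \<open>
  The spin-\<open>j\<close> representation with \<open>n = 2j\<close>: homogeneous polynomials of degree \<open>n\<close> in \<open>(x, y)\<close>,
  on which \<open>g\<close> acts by \<open>(g \<cdot> f)(x, y) = f((x, y) g)\<close>, with the invariant inner product for which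
  \<open>e\<^sub>k = sqrt (n choose k) x\<^sup>k y\<^sup>n\<^sup>-\<^sup>k\<close> (\<open>k = 0, \<dots>, n\<close>) is an orthonormal basis.
  \<open>spin_rep n g\<close> is the matrix of \<open>g\<close> in this basis, read off from
  \<open>g \<cdot> e\<^sub>l = sqrt (n choose l) (g\<^sub>1\<^sub>1 x + g\<^sub>2\<^sub>1 y)\<^sup>l (g\<^sub>1\<^sub>2 x + g\<^sub>2\<^sub>2 y)\<^sup>n\<^sup>-\<^sup>l\<close> after setting \<open>y = 1\<close>.
\<close>

definition spin_rep :: "nat \<Rightarrow> complex^2^2 \<Rightarrow> nat op" where
  "spin_rep n g = (\<lambda>k l. if k \<le> n \<and> l \<le> n
     then complex_of_real (sqrt (real (n choose l) / real (n choose k))) *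
          coeff ([:g $ 2 $ 1, g $ 1 $ 1:] ^ l * [:g $ 2 $ 2, g $ 1 $ 2:] ^ (n - l)) k
     else 0)"

text \<open>
  The four tensor factors are labelled by the four-element type \<open>4\<close>. The product basis of the
  factors in \<open>A\<close> is labelled by multi-indices \<open>m\<close> with \<open>m f \<in> {0..n}\<close> for \<open>f \<in> A\<close>.
\<close>

type_synonym midx = "4 \<Rightarrow> nat"

definition midxs :: "nat \<Rightarrow> 4 set \<Rightarrow> midx set" where
  "midxs n A = A \<rightarrow>\<^sub>E {..n}"

abbreviation all_midxs :: "nat \<Rightarrow> midx set" where
  "all_midxs n \<equiv> midxs n UNIV"

definition tensor4_rep :: "nat \<Rightarrow> complex^2^2 \<Rightarrow> midx op" where
  "tensor4_rep n g = (\<lambda>m m'. \<Prod>f\<in>UNIV. spin_rep n g (m f) (m' f))"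

definition H_inv :: "nat \<Rightarrow> midx vec set" where
  "H_inv n = {\<psi> \<in> vecs (all_midxs n).
     \<forall>g\<in>SU2. op_apply (all_midxs n) (tensor4_rep n g) \<psi> = \<psi>}"

text \<open>The partial trace over the factors outside \<open>A\<close>\<close>

definition partial_trace :: "nat \<Rightarrow> 4 set \<Rightarrow> midx op \<Rightarrow> midx op" where
  "partial_trace n A X = (\<lambda>m m'. if m \<in> midxs n A \<and> m' \<in> midxs n A
     then \<Sum>k\<in>midxs n (- A). X (merge A (- A) (m, k)) (merge A (- A) (m', k))
     else 0)"

definition reduced_density :: "nat \<Rightarrow> 4 set \<Rightarrow> midx vec \<Rightarrow> midx op" where
  "reduced_density n A \<psi> = partial_trace n A (ket_bra \<psi>)"

definition entanglement_entropy :: "nat \<Rightarrow> 4 set \<Rightarrow> midx vec \<Rightarrow> real" where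
  "entanglement_entropy n A \<psi> = von_neumann_entropy (midxs n A) (reduced_density n A \<psi>)"

end

theory Submission
  imports Defs "HOL-Real_Asymp.Real_Asymp"
begin

text \<open>
  An invariant tensor, read as a matrix from the dual of two factors to the other two, is an
  \<open>SU(2)\<close>-intertwiner of \<open>V\<^sub>j \<otimes> V\<^sub>j\<close>. This representation is the multiplicity-free sum of the
  spins \<open>J = 0, \<dots>, 2j\<close>, so the invariants have an orthonormal basis \<open>|J\<rangle>\<close>, and
  \<open>|I\<rangle> = \<Sum> c\<^sub>J |J\<rangle>\<close> has \<open>\<rho>\<^sub>A\<close> equal to \<open>|c\<^sub>J|\<^sup>2 / (2J+1)\<close> on the spin-\<open>J\<close> component.
  Hence the purity of \<open>\<rho>\<^sub>A\<close> is \<open>\<Sum> |c\<^sub>J|\<^sup>4 / (2J+1)\<close>. Haar invariance gives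
  \<open>E |c\<^sub>J|\<^sup>4 = 2 / (D(D+1))\<close> with \<open>D = 2j+1\<close>, so the expected purity is \<open>O(ln D / D\<^sup>2)\<close>. The entropy
  is at least minus the logarithm of the purity, and Markov's inequality concludes.
\<close>

section \<open>Operators on finite-dimensional Hilbert spaces\<close>

text \<open>A perfect tensor would need |c_J|^2 = (2J+1)/D^2, whereas a random one has all |c_J|^2
  of order 1/D. Its expected purity therefore exceeds the minimum 1/D^2 by a factor of order ln D,
  the sum of the 1/(2J+1). This is harmless because only a ratio of logarithms is claimed: for the
  purity threshold D^(-2(1-\<epsilon>)) the Markov bound is of order ln D / D^(2\<epsilon>).

  Most of the work is to find the invariants. Invariance under the group becomes three conditions:
  total weight zero and annihilation by the total J_+ and J_-. The real rotations supply only the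
  generator J_+ - J_-, but its two parts land in different weights and so vanish separately. The
  conditions then say that the associated matrix commutes with J_z, J_+ and J_-, and lowest weight
  vectors, unique up to scale in each weight, take the place of a general theory of irreducible
  representations.

  Throughout, n = 2j and D = n + 1. The component of spin J carries the label s = n - J, the weight
  of its lowest vector when levels are counted from 0.\<close>

definition orthonormal_family :: "'i set \<Rightarrow> 'k set \<Rightarrow> ('k \<Rightarrow> 'i vec) \<Rightarrow> bool" where
  "orthonormal_family I K u \<longleftrightarrow>
     (\<forall>k\<in>K. u k \<in> vecs I) \<and>
     (\<forall>k\<in>K. \<forall>l\<in>K. inner_prod I (u k) (u l) = (if k = l then 1 else 0))"

lemma orthonormal_basis_iff_family: "orthonormal_basis I u \<longleftrightarrow> orthonormal_family I I u"
  unfolding orthonormal_basis_def orthonormal_family_def ..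

lemma cnj_inner_prod: "cnj (inner_prod I v w) = inner_prod I w v"
  by (simp add: inner_prod_def mult.commute)

lemma inner_prod_self: "inner_prod I v v = complex_of_real (\<Sum>x\<in>I. (cmod (v x))\<^sup>2)"
  unfolding inner_prod_def of_real_sum
  by (intro sum.cong refl) (simp only: complex_norm_square mult.commute)

lemma inner_prod_add_right: "inner_prod I u (\<lambda>x. v x + w x) = inner_prod I u v + inner_prod I u w"
  by (simp add: inner_prod_def algebra_simps sum.distrib)

lemma inner_prod_diff_right: "inner_prod I u (\<lambda>x. v x - w x) = inner_prod I u v - inner_prod I u w"
  by (simp add: inner_prod_def algebra_simps sum_subtractf)

lemma inner_prod_scale_right: "inner_prod I u (\<lambda>x. c * v x) = c * inner_prod I u v"
  by (simp add: inner_prod_def algebra_simps sum_distrib_left)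

lemma inner_prod_sum_right:
  "inner_prod I u (\<lambda>x. \<Sum>k\<in>K. c k * v k x) = (\<Sum>k\<in>K. c k * inner_prod I u (v k))"
  by (simp add: inner_prod_def sum_distrib_left algebra_simps)
     (subst sum.swap, simp)

lemma inner_prod_add_left: "inner_prod I (\<lambda>x. v x + w x) u = inner_prod I v u + inner_prod I w u"
  by (simp add: inner_prod_def algebra_simps sum.distrib)

lemma inner_prod_diff_left: "inner_prod I (\<lambda>x. v x - w x) u = inner_prod I v u - inner_prod I w u"
  by (simp add: inner_prod_def algebra_simps sum_subtractf)

lemma inner_prod_scale_left: "inner_prod I (\<lambda>x. c * v x) u = cnj c * inner_prod I v u"
  by (simp add: inner_prod_def algebra_simps sum_distrib_left)

lemma inner_prod_sum_left:
  "inner_prod I (\<lambda>x. \<Sum>k\<in>K. c k * v k x) u = (\<Sum>k\<in>K. cnj (c k) * inner_prod I (v k) u)"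
  by (simp add: inner_prod_def sum_distrib_left sum_distrib_right algebra_simps)
     (subst sum.swap, simp)

lemma inner_prod_self_eq_0_iff:
  assumes "finite I" "v \<in> vecs I"
  shows "inner_prod I v v = 0 \<longleftrightarrow> v = (\<lambda>_. 0)"
proof
  assume "inner_prod I v v = 0"
  then have "(\<Sum>x\<in>I. (cmod (v x))\<^sup>2) = 0"
    unfolding inner_prod_self of_real_eq_0_iff .
  then have "\<forall>x\<in>I. v x = 0"
    using assms(1) by (subst (asm) sum_nonneg_eq_0_iff) auto
  then show "v = (\<lambda>_. 0)" using assms(2) by (auto simp: vecs_def fun_eq_iff)
qed (simp add: inner_prod_def)

lemma inner_prod_delta_right:
  assumes "finite I" "x \<in> I"
  shows "inner_prod I u (\<lambda>y. if y = x then 1 else 0) = cnj (u x)"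
  using assms by (simp add: inner_prod_def if_distrib cong: if_cong)

lemma inner_prod_delta_left:
  assumes "finite I" "x \<in> I"
  shows "inner_prod I (\<lambda>y. if y = x then 1 else 0) u = u x"
  using assms by (simp add: inner_prod_def if_distrib cong: if_cong)
     (simp add: if_distribR if_distrib[of cnj] cong: if_cong)

section \<open>Residuals of standard basis vectors: Bessel's inequality and completeness by
  counting\<close>

definition residual :: "'k set \<Rightarrow> ('k \<Rightarrow> 'i vec) \<Rightarrow> 'i \<Rightarrow> 'i vec" where
  "residual K u x = (\<lambda>y. (if y = x then 1 else 0) - (\<Sum>k\<in>K. cnj (u k x) * u k y))"

context
  fixes I :: "'i set" and K :: "'k set" and u
  assumes fin: "finite I" "finite K" and on: "orthonormal_family I K u"
begin

lemma orthonormal_familyD: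
  "k \<in> K \<Longrightarrow> u k \<in> vecs I"
  "k \<in> K \<Longrightarrow> l \<in> K \<Longrightarrow> inner_prod I (u k) (u l) = (if k = l then 1 else 0)"
  using on by (auto simp: orthonormal_family_def)

lemma residual_in_vecs: "x \<in> I \<Longrightarrow> residual K u x \<in> vecs I"
  using orthonormal_familyD(1) by (auto simp: residual_def vecs_def)

lemma residual_orthogonal:
  assumes "x \<in> I" "l \<in> K"
  shows "inner_prod I (u l) (residual K u x) = 0"
  unfolding residual_def inner_prod_diff_right inner_prod_sum_right
  using assms fin by (simp add: inner_prod_delta_right orthonormal_familyD if_distrib cong: if_cong)

text \<open>The residual is orthogonal to the family, so pairing it with itself is the same as
  pairing it with the standard basis vector at \<open>x\<close>, which reads off its entry at
  \<open>x\<close>.\<close>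

lemma residual_norm:
  assumes "x \<in> I"
  shows "inner_prod I (residual K u x) (residual K u x)
    = complex_of_real (1 - (\<Sum>k\<in>K. (cmod (u k x))\<^sup>2))"
proof -
  have "inner_prod I (residual K u x) (residual K u x)
      = residual K u x x - (\<Sum>k\<in>K. cnj (cnj (u k x)) * inner_prod I (u k) (residual K u x))"
    by (subst (1) residual_def)
       (simp only: inner_prod_diff_left inner_prod_sum_left
         inner_prod_delta_left[OF fin(1) assms])
  also have "\<dots> = residual K u x x"
    by (simp add: residual_orthogonal assms)
  also have "\<dots> = complex_of_real (1 - (\<Sum>k\<in>K. (cmod (u k x))\<^sup>2))"
    unfolding residual_def of_real_diff of_real_sum
    by (simp add: complex_norm_square mult.commute del: of_real_power)
  finally show ?thesis .
qed

lemma bessel_pointwise: "x \<in> I \<Longrightarrow> (\<Sum>k\<in>K. (cmod (u k x))\<^sup>2) \<le> 1"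
  using residual_norm[of x] unfolding inner_prod_self of_real_eq_iff
  by (smt (verit) sum_nonneg zero_le_power2)

lemma sum_orthonormal_norms: "(\<Sum>x\<in>I. \<Sum>k\<in>K. (cmod (u k x))\<^sup>2) = real (card K)"
proof -
  have "(\<Sum>x\<in>I. (cmod (u k x))\<^sup>2) = 1" if "k \<in> K" for k
    using orthonormal_familyD(2)[OF that that] unfolding inner_prod_self
    by (metis of_real_eq_1_iff)
  then show ?thesis by (subst sum.swap) simp
qed

text \<open>The squared norms of all residuals are nonnegative and add up to
  \<open>card I - card K\<close>. When this is 0, every residual vanishes.\<close>

lemma orthonormal_complete:
  assumes "card K = card I" "x \<in> I" "y \<in> I"
  shows "(\<Sum>k\<in>K. u k y * cnj (u k x)) = (if y = x then 1 else 0)"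
proof -
  have "(\<Sum>x\<in>I. 1 - (\<Sum>k\<in>K. (cmod (u k x))\<^sup>2)) = 0"
    using assms(1) by (simp add: sum_subtractf sum_orthonormal_norms)
  then have "1 - (\<Sum>k\<in>K. (cmod (u k x))\<^sup>2) = 0"
    using fin(1) bessel_pointwise assms(2)
    by (subst (asm) sum_nonneg_eq_0_iff) auto
  then have "residual K u x = (\<lambda>_. 0)"
    using inner_prod_self_eq_0_iff[OF fin(1) residual_in_vecs[OF assms(2)]]
      residual_norm[OF assms(2)] by (simp del: of_real_diff)
  from fun_cong[OF this, of y] show ?thesis
    by (simp add: residual_def mult.commute)
qed

text \<open>The same count: if the squared residual norms have a positive sum, one of them is
  positive, and that residual is normalised.\<close>

lemma orthonormal_extend:
  assumes "card K < card I"
  obtains v where "v \<in> vecs I" "inner_prod I v v = 1" "\<And>k. k \<in> K \<Longrightarrow> inner_prod I (u k) v = 0"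
proof -
  have "\<exists>x\<in>I. (\<Sum>k\<in>K. (cmod (u k x))\<^sup>2) < 1"
  proof (rule ccontr)
    assume "\<not> ?thesis"
    then have "(\<Sum>x\<in>I. 1) \<le> (\<Sum>x\<in>I. \<Sum>k\<in>K. (cmod (u k x))\<^sup>2)"
      by (intro sum_mono) force
    then show False using assms sum_orthonormal_norms by simp
  qed
  then obtain x where x: "x \<in> I" and lt: "(\<Sum>k\<in>K. (cmod (u k x))\<^sup>2) < 1" by blast
  define q where "q = 1 - (\<Sum>k\<in>K. (cmod (u k x))\<^sup>2)"
  define v where "v = (\<lambda>y. complex_of_real (1 / sqrt q) * residual K u x y)"
  have q: "q > 0" using lt by (simp add: q_def)
  have "v \<in> vecs I" using residual_in_vecs[OF x] by (auto simp: v_def vecs_def)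
  moreover have "inner_prod I v v = complex_of_real (1 / sqrt q * (1 / sqrt q) * q)"
    unfolding v_def inner_prod_scale_left inner_prod_scale_right residual_norm[OF x] q_def[symmetric]
      of_real_mult complex_cnj_complex_of_real mult.assoc ..
  moreover have "1 / sqrt q * (1 / sqrt q) * q = 1" using q by (simp add: field_simps)
  moreover have "inner_prod I (u k) v = 0" if "k \<in> K" for k
    unfolding v_def inner_prod_scale_right residual_orthogonal[OF x that] by simp
  ultimately show thesis using that by simp
qed

end

lemma orthonormal_expand:
  assumes "finite I" "finite K" "orthonormal_family I K u" "card K = card I" "v \<in> vecs I"
  shows "v = (\<lambda>x. \<Sum>k\<in>K. inner_prod I (u k) v * u k x)"
proof
  fix x
  show "v x = (\<Sum>k\<in>K. inner_prod I (u k) v * u k x)"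
  proof (cases "x \<in> I")
    case True
    have "(\<Sum>k\<in>K. inner_prod I (u k) v * u k x) = (\<Sum>y\<in>I. (\<Sum>k\<in>K. u k x * cnj (u k y)) * v y)"
      unfolding inner_prod_def sum_distrib_right
      by (subst sum.swap) (simp add: algebra_simps)
    also have "\<dots> = (\<Sum>y\<in>I. if y = x then v y else 0)"
      by (intro sum.cong refl)
         (auto simp: orthonormal_complete[OF assms(1-4) _ True])
    finally show ?thesis using True assms(1) by simp
  next
    case False
    then show ?thesis using assms(3,5) by (auto simp: vecs_def orthonormal_family_def)
  qed
qed


subsection \<open>The spectral theorem\<close>

definition hermitian_on :: "'i set \<Rightarrow> 'i op \<Rightarrow> bool" where
  "hermitian_on I X \<longleftrightarrow> X \<in> ops I \<and> (\<forall>x y. X y x = cnj (X x y))"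

lemma hermitian_inner_prod:
  assumes "hermitian_on I X"
  shows "inner_prod I (op_apply I X v) w = inner_prod I v (op_apply I X w)"
proof -
  have *: "cnj (X x y) = X y x" for x y using assms unfolding hermitian_on_def by metis
  show ?thesis
    unfolding inner_prod_def op_apply_def sum_distrib_left sum_distrib_right cnj_sum
    by (subst sum.swap) (simp add: * mult_ac)
qed

lemma op_apply_in_vecs: "X \<in> ops I \<Longrightarrow> op_apply I X v \<in> vecs I"
  by (auto simp: ops_def vecs_def op_apply_def)

lemma op_apply_diff: "op_apply I X (\<lambda>x. v x - w x) = (\<lambda>x. op_apply I X v x - op_apply I X w x)"
  by (simp add: op_apply_def algebra_simps sum_subtractf)

lemma op_apply_scale: "op_apply I X (\<lambda>x. c * v x) = (\<lambda>x. c * op_apply I X v x)"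
  by (simp add: op_apply_def algebra_simps sum_distrib_left)

text \<open>Tychonoff's theorem, since vectors are functions with the product topology.\<close>

lemma compact_functions_pointwise:
  fixes B :: "'a \<Rightarrow> 'b::topological_space set"
  assumes "\<And>x. compact (B x)"
  shows "compact {f. \<forall>x. f x \<in> B x}"
proof -
  have "compactin (product_topology (\<lambda>_. euclidean) UNIV) (PiE UNIV B)"
    using assms by (subst compactin_PiE) auto
  then show ?thesis
    unfolding euclidean_product_topology by (simp add: PiE_def Pi_def)
qed

lemma continuous_on_coordinate:
  "continuous_on S (\<lambda>v :: 'a \<Rightarrow> 'b::topological_space. v x)"
  by (rule continuous_on_subset[OF continuous_on_product_coordinates subset_UNIV])

lemma continuous_on_inner_prod [continuous_intros]:
  fixes f g :: "'a::topological_space \<Rightarrow> 'i vec"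
  assumes "\<And>x. continuous_on S (\<lambda>t. f t x)" "\<And>x. continuous_on S (\<lambda>t. g t x)"
  shows "continuous_on S (\<lambda>t. inner_prod I (f t) (g t))"
  unfolding inner_prod_def by (intro continuous_intros assms)

lemma compact_orthogonal_sphere:
  assumes "finite I"
  shows "compact {v \<in> vecs I. inner_prod I v v = 1 \<and> (\<forall>k\<in>K. inner_prod I (u k) v = 0)}"
    (is "compact ?S")
proof -
  \<comment> \<open>Coordinates outside \<open>I\<close> are pinned to 0, which keeps the box
    compact and inside \<open>vecs I\<close> although the index type may be infinite.\<close>
  define B where "B = (\<lambda>x. if x \<in> I then cball (0::complex) 1 else {0})"
  have "compact {f. \<forall>x. f x \<in> B x}"
    by (intro compact_functions_pointwise) (auto simp: B_def)
  moreover have "closed {v. inner_prod I v v = 1}"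
    by (intro closed_Collect_eq continuous_intros continuous_on_product_coordinates)
  moreover have "closed {v. \<forall>k\<in>K. inner_prod I (u k) v = 0}"
  proof -
    have "{v. \<forall>k\<in>K. inner_prod I (u k) v = 0} = (\<Inter>k\<in>K. {v. inner_prod I (u k) v = 0})" by auto
    then show ?thesis
      by (auto intro!: closed_INT closed_Collect_eq continuous_intros continuous_on_product_coordinates)
  qed
  ultimately have "compact ({f. \<forall>x. f x \<in> B x} \<inter>
      ({v. inner_prod I v v = 1} \<inter> {v. \<forall>k\<in>K. inner_prod I (u k) v = 0}))"
    by (intro compact_Int_closed closed_Int)
  moreover have "?S = {f. \<forall>x. f x \<in> B x} \<inter>
      ({v. inner_prod I v v = 1} \<inter> {v. \<forall>k\<in>K. inner_prod I (u k) v = 0})"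
  proof -
    have "cmod (v x) \<le> 1" if "inner_prod I v v = 1" "x \<in> I" for v x
    proof -
      have "(cmod (v x))\<^sup>2 \<le> (\<Sum>x\<in>I. (cmod (v x))\<^sup>2)"
        using assms that(2) by (intro member_le_sum) auto
      also have "\<dots> = 1" using that(1) unfolding inner_prod_self by (metis of_real_eq_1_iff)
      finally show ?thesis by (simp add: abs_le_square_iff[of _ 1, simplified] power_le_one_iff)
    qed
    then show ?thesis by (auto simp: B_def vecs_def)
  qed
  ultimately show ?thesis by simp
qed

lemma linear_le_quadratic_imp_zero:
  fixes a b :: real
  assumes "\<And>t. t > 0 \<Longrightarrow> 2 * t * a \<le> t\<^sup>2 * b" "a \<ge> 0"
  shows "a = 0"
proof (rule ccontr)
  assume "a \<noteq> 0"
  then have a: "a > 0" using assms(2) by simp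
  define t where "t = a / (\<bar>b\<bar> + 1)"
  have t: "t > 0" using a by (simp add: t_def)
  then have "2 * a \<le> t * b" using assms(1)[OF t] by (simp add: power2_eq_square)
  also have "\<dots> \<le> t * \<bar>b\<bar>" using t by simp
  also have "\<dots> \<le> a" using a by (simp add: t_def field_simps)
  finally show False using a by simp
qed

text \<open>A maximiser of the Rayleigh quotient on the orthogonal complement of eigenvectors is an
  eigenvector: \<open>B = \<lambda> - X\<close> is positive there with \<open>\<langle>v, B v\<rangle> = 0\<close>, so moving from \<open>v\<close> in the
  direction \<open>- B v\<close> shows \<open>B v = 0\<close>.\<close>

lemma eigenvector_extend:
  assumes fin: "finite I" "finite K" and on: "orthonormal_family I K u" and card: "card K < card I"
    and X: "hermitian_on I X"
    and eig: "\<And>k. k \<in> K \<Longrightarrow> op_apply I X (u k) = (\<lambda>x. complex_of_real (d k) * u k x)"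
  obtains v \<mu> where "v \<in> vecs I" "inner_prod I v v = 1" "\<And>k. k \<in> K \<Longrightarrow> inner_prod I (u k) v = 0"
    "op_apply I X v = (\<lambda>x. complex_of_real \<mu> * v x)"
proof -
  define L where "L = {v \<in> vecs I. \<forall>k\<in>K. inner_prod I (u k) v = 0}"
  define S where "S = {v \<in> vecs I. inner_prod I v v = 1 \<and> (\<forall>k\<in>K. inner_prod I (u k) v = 0)}"
  define q where "q = (\<lambda>v. Re (inner_prod I v (op_apply I X v)))"
  have "S \<noteq> {}"
  proof -
    obtain v where "v \<in> vecs I" "inner_prod I v v = 1" "\<And>k. k \<in> K \<Longrightarrow> inner_prod I (u k) v = 0"
      using orthonormal_extend[OF fin on card] by metis
    then show ?thesis unfolding S_def by blast
  qed
  moreover have S: "compact S" unfolding S_def by (rule compact_orthogonal_sphere[OF fin(1)])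
  moreover have "continuous_on S q"
    unfolding q_def op_apply_def
    by (rule continuous_on_Re continuous_on_inner_prod continuous_on_coordinate
        continuous_on_sum continuous_on_mult continuous_on_const)+
  ultimately obtain v where v: "v \<in> S" and max: "\<And>w. w \<in> S \<Longrightarrow> q w \<le> q v"
    using continuous_attains_sup[of S q] by metis
  define \<mu> where "\<mu> = q v"
  define B where "B = (\<lambda>w x. complex_of_real \<mu> * w x - op_apply I X w x)"
  \<comment> \<open>Hermiticity moves \<open>X\<close> onto the eigenvectors \<open>u k\<close>, so
    their orthogonal complement is mapped into itself.\<close>
  have XL: "op_apply I X w \<in> L" if "w \<in> L" for w
  proof -
    have "X \<in> ops I" using X unfolding hermitian_on_def by blast
    moreover have "inner_prod I (u k) (op_apply I X w) = 0" if "k \<in> K" for k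
      unfolding hermitian_inner_prod[OF X, symmetric] eig[OF that] inner_prod_scale_left
      using \<open>w \<in> L\<close> that by (simp add: L_def)
    ultimately show ?thesis by (simp add: L_def op_apply_in_vecs)
  qed
  have BL: "B w \<in> L" if "w \<in> L" for w
    using XL[OF that] that unfolding B_def L_def
    by (auto simp: vecs_def inner_prod_diff_right inner_prod_scale_right)
  have Lscale: "(\<lambda>x. c * w x) \<in> L" if "w \<in> L" for c w
    using that by (auto simp: L_def vecs_def inner_prod_scale_right)
  have Bherm: "inner_prod I (B v) w = inner_prod I v (B w)" for v w
    unfolding B_def inner_prod_diff_right inner_prod_scale_right inner_prod_diff_left
      inner_prod_scale_left hermitian_inner_prod[OF X] by simp
  have Bq: "Re (inner_prod I w (B w)) = \<mu> * (\<Sum>x\<in>I. (cmod (w x))\<^sup>2) - q w" for w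
    unfolding B_def inner_prod_diff_right inner_prod_scale_right inner_prod_self q_def by simp
  \<comment> \<open>Homogeneity: rescaling \<open>w\<close> to the unit sphere reduces the claim to
    the maximality of \<open>v\<close>.\<close>
  have Bpos: "Re (inner_prod I w (B w)) \<ge> 0" if w: "w \<in> L" for w
  proof -
    define r where "r = (\<Sum>x\<in>I. (cmod (w x))\<^sup>2)"
    show ?thesis
    proof (cases "r = 0")
      case True
      then have "w = (\<lambda>_. 0)"
        using inner_prod_self_eq_0_iff[OF fin(1), of w] w by (simp add: L_def inner_prod_self r_def)
      then show ?thesis by (simp add: inner_prod_def)
    next
      case False
      moreover have "r \<ge> 0" unfolding r_def by (intro sum_nonneg) auto
      ultimately have r: "r > 0" by simp
      define w' where "w' = (\<lambda>x. complex_of_real (1 / sqrt r) * w x)"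
      have rr: "1 / sqrt r * (1 / sqrt r) = 1 / r" using r by simp
      have rr2: "cnj (complex_of_real (1 / sqrt r)) * (complex_of_real (1 / sqrt r) * z)
          = complex_of_real (1 / r) * z" for z
        using arg_cong[OF rr, of complex_of_real] by (simp add: field_simps flip: of_real_mult)
      have "inner_prod I w' w' = complex_of_real (1 / r) * inner_prod I w w"
        unfolding w'_def inner_prod_scale_left inner_prod_scale_right rr2 ..
      also have "\<dots> = complex_of_real (1 / r * r)"
        unfolding inner_prod_self r_def of_real_mult ..
      finally have "inner_prod I w' w' = 1" using r by simp
      moreover have "w' \<in> L" using w unfolding w'_def by (rule Lscale)
      ultimately have "w' \<in> S" by (simp add: L_def S_def)
      then have "q w' \<le> \<mu>" unfolding \<mu>_def by (rule max)
      moreover have "q w' = 1 / r * q w"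
        unfolding q_def w'_def op_apply_scale inner_prod_scale_left inner_prod_scale_right rr2 by simp
      ultimately show ?thesis using r unfolding Bq r_def[symmetric] by (simp add: field_simps)
    qed
  qed
  have vL: "v \<in> L" using v by (simp add: S_def L_def)
  have vv: "(\<Sum>x\<in>I. (cmod (v x))\<^sup>2) = 1"
    using v unfolding S_def inner_prod_self by (metis (mono_tags, lifting) mem_Collect_eq of_real_eq_1_iff)
  define a where "a = Re (inner_prod I (B v) (B v))"
  define b where "b = Re (inner_prod I (B v) (B (B v)))"
  \<comment> \<open>\<open>a\<close> is the squared norm of \<open>B v\<close>. The quadratic form
    of \<open>B\<close> at v - t B v has no constant term, because it vanishes at
    \<open>v\<close>.\<close>
  have "2 * t * a \<le> t\<^sup>2 * b" for t
  proof -
    define w where "w = (\<lambda>x. v x - complex_of_real t * B v x)"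
    have "w \<in> L" using vL BL[OF vL] unfolding w_def L_def
      by (auto simp: vecs_def inner_prod_diff_right inner_prod_scale_right)
    then have "0 \<le> Re (inner_prod I w (B w))" by (rule Bpos)
    also have "B w = (\<lambda>x. B v x - complex_of_real t * B (B v) x)"
      unfolding w_def B_def op_apply_diff op_apply_scale by (simp add: algebra_simps)
    also have "Re (inner_prod I w \<dots>) = Re (inner_prod I v (B v)) - 2 * t * a + t\<^sup>2 * b"
      unfolding w_def inner_prod_diff_left inner_prod_scale_left inner_prod_diff_right
        inner_prod_scale_right Bherm[of v "B v", symmetric] a_def b_def
      by (simp add: algebra_simps power2_eq_square)
    also have "Re (inner_prod I v (B v)) = 0" unfolding Bq vv by (simp add: \<mu>_def)
    finally show ?thesis by simp
  qed
  moreover have "a \<ge> 0" unfolding a_def inner_prod_self by (simp add: sum_nonneg)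
  ultimately have "a = 0" by (intro linear_le_quadratic_imp_zero)
  then have "inner_prod I (B v) (B v) = 0" unfolding a_def inner_prod_self by simp
  then have "B v = (\<lambda>_. 0)"
    using inner_prod_self_eq_0_iff[OF fin(1)] BL[OF vL] by (simp add: L_def)
  then have "op_apply I X v = (\<lambda>x. complex_of_real \<mu> * v x)" by (simp add: B_def fun_eq_iff)
  then show thesis using v that unfolding S_def by blast
qed

text \<open>Eigenvectors are collected one at a time over subsets \<open>F\<close> of
  \<open>I\<close>; the elements of \<open>I\<close> are borrowed as labels and have no other
  relation to the eigenvectors.\<close>

lemma hermitian_eigenbasis:
  assumes fin: "finite I" and X: "hermitian_on I X"
  obtains u d where "orthonormal_basis I u"
    "\<And>k. k \<in> I \<Longrightarrow> op_apply I X (u k) = (\<lambda>x. complex_of_real (d k) * u k x)"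
proof -
  have "\<exists>u d. orthonormal_family I F u \<and>
      (\<forall>k\<in>F. op_apply I X (u k) = (\<lambda>x. complex_of_real (d k) * u k x))"
    if "finite F" "F \<subseteq> I" for F
    using that
  proof (induction F rule: finite_induct)
    case empty
    then show ?case by (auto simp: orthonormal_family_def)
  next
    case (insert k F)
    then obtain u d where on: "orthonormal_family I F u"
      and eig: "\<And>k. k \<in> F \<Longrightarrow> op_apply I X (u k) = (\<lambda>x. complex_of_real (d k) * u k x)"
      by auto
    have "card F < card I" using insert fin by (intro psubset_card_mono) auto
    from eigenvector_extend[OF fin \<open>finite F\<close> on this X eig] obtain v \<mu> where
      v: "v \<in> vecs I" "inner_prod I v v = 1" "\<And>k. k \<in> F \<Longrightarrow> inner_prod I (u k) v = 0"
      "op_apply I X v = (\<lambda>x. complex_of_real \<mu> * v x)" by metis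
    have v': "inner_prod I v (u k) = 0" if "k \<in> F" for k
      using v(3)[OF that] cnj_inner_prod[of I "u k" v] by simp
    have "orthonormal_family I (insert k F) (u(k := v))"
      using on v v' \<open>k \<notin> F\<close> by (auto simp: orthonormal_family_def)
    moreover have "\<forall>l\<in>insert k F. op_apply I X ((u(k := v)) l)
        = (\<lambda>x. complex_of_real ((d(k := \<mu>)) l) * (u(k := v)) l x)"
      using eig v(4) \<open>k \<notin> F\<close> by auto
    ultimately show ?case by blast
  qed
  from this[OF fin subset_refl] that show thesis
    unfolding orthonormal_basis_iff_family by blast
qed

text \<open>Completeness of the eigenbasis recovers each entry of \<open>X\<close> from its action
  on the \<open>u k\<close>.\<close>

lemma spectral_theorem:
  assumes fin: "finite I" and X: "hermitian_on I X"
  obtains u d where "orthonormal_basis I u" "X = spectral_op I u d"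
    "\<And>k. k \<in> I \<Longrightarrow> op_apply I X (u k) = (\<lambda>x. complex_of_real (d k) * u k x)"
proof -
  obtain u d where u: "orthonormal_basis I u"
    and eig: "\<And>k. k \<in> I \<Longrightarrow> op_apply I X (u k) = (\<lambda>x. complex_of_real (d k) * u k x)"
    using hermitian_eigenbasis[OF assms] by blast
  have on: "orthonormal_family I I u" using u by (simp add: orthonormal_basis_iff_family)
  have "X x y = spectral_op I u d x y" for x y
  proof (cases "x \<in> I \<and> y \<in> I")
    case True
    have "spectral_op I u d x y = (\<Sum>k\<in>I. op_apply I X (u k) x * cnj (u k y))"
      by (simp add: spectral_op_def ket_bra_def eig mult.assoc)
    also have "\<dots> = (\<Sum>z\<in>I. X x z * (\<Sum>k\<in>I. u k z * cnj (u k y)))"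
      unfolding op_apply_def sum_distrib_left sum_distrib_right
      by (subst sum.swap) (simp add: mult.assoc)
    also have "\<dots> = (\<Sum>z\<in>I. if z = y then X x z else 0)"
      by (intro sum.cong refl) (simp add: orthonormal_complete[OF fin fin on] True)
    also have "\<dots> = X x y" using True fin by simp
    finally show ?thesis by simp
  next
    case False
    have "\<forall>k\<in>I. u k \<in> vecs I" using u by (simp add: orthonormal_basis_def)
    then have "spectral_op I u d x y = 0"
      unfolding spectral_op_def ket_bra_def using False by (intro sum.neutral) (auto simp: vecs_def)
    moreover have "X x y = 0" using False X unfolding hermitian_on_def ops_def by blast
    ultimately show ?thesis by simp
  qed
  then have "X = spectral_op I u d" by (intro ext)
  then show thesis using that u eig by blast
qed


subsection \<open>Von Neumann entropy\<close>

lemma op_apply_spectral: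
  assumes "finite I" "orthonormal_basis I u" "k \<in> I"
  shows "op_apply I (spectral_op I u d) (u k) = (\<lambda>x. complex_of_real (d k) * u k x)"
proof
  fix x
  have "op_apply I (spectral_op I u d) (u k) x
      = (\<Sum>l\<in>I. complex_of_real (d l) * u l x * inner_prod I (u l) (u k))"
    unfolding op_apply_def spectral_op_def ket_bra_def inner_prod_def sum_distrib_left sum_distrib_right
    by (subst sum.swap) (simp add: mult_ac)
  also have "\<dots> = (\<Sum>l\<in>I. if l = k then complex_of_real (d l) * u l x else 0)"
    using assms by (intro sum.cong refl) (auto simp: orthonormal_basis_def)
  finally show "op_apply I (spectral_op I u d) (u k) x = complex_of_real (d k) * u k x"
    using assms by simp
qed

lemma hermitian_spectral_op:
  assumes "orthonormal_basis I u"
  shows "hermitian_on I (spectral_op I u d)"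
proof -
  have "\<forall>k\<in>I. u k \<in> vecs I" using assms by (simp add: orthonormal_basis_def)
  then have "spectral_op I u d \<in> ops I"
    unfolding ops_def spectral_op_def ket_bra_def by (auto simp: vecs_def intro!: sum.neutral)
  then show ?thesis by (auto simp: hermitian_on_def spectral_op_def ket_bra_def mult_ac)
qed

text \<open>Eigenvectors of the two decompositions with different eigenvalues are orthogonal.\<close>

lemma spectral_op_fun_unique:
  assumes fin: "finite I" and u: "orthonormal_basis I u" and v: "orthonormal_basis I v"
    and eq: "spectral_op I u d = spectral_op I v e"
  shows "spectral_op I u (\<lambda>k. f (d k)) = spectral_op I v (\<lambda>k. f (e k))"
proof -
  have 1: "inner_prod I (v l) (u k) * complex_of_real (f (d k)) = inner_prod I (v l) (u k) * complex_of_real (f (e l))"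
    if "k \<in> I" "l \<in> I" for k l
  proof -
    have "complex_of_real (d k) * inner_prod I (v l) (u k)
        = inner_prod I (v l) (op_apply I (spectral_op I u d) (u k))"
      by (simp add: op_apply_spectral[OF fin u that(1)] inner_prod_scale_right)
    also have "\<dots> = inner_prod I (op_apply I (spectral_op I v e) (v l)) (u k)"
      by (simp add: eq hermitian_inner_prod[OF hermitian_spectral_op[OF v]])
    also have "\<dots> = complex_of_real (e l) * inner_prod I (v l) (u k)"
      by (simp add: op_apply_spectral[OF fin v that(2)] inner_prod_scale_left)
    finally have "inner_prod I (v l) (u k) = 0 \<or> d k = e l" by auto
    then show ?thesis by auto
  qed
  have onv: "orthonormal_family I I v" and onu: "orthonormal_family I I u"
    using u v by (simp_all add: orthonormal_basis_iff_family)
  have uV: "u k \<in> vecs I" "v k \<in> vecs I" if "k \<in> I" for k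
    using that u v by (auto simp: orthonormal_basis_def)
  \<comment> \<open>Expanding one factor in each basis puts both sides into the same double sum over
    overlaps, where \<open>1\<close> exchanges the eigenvalues.\<close>
  have 2: "u k x = (\<Sum>l\<in>I. inner_prod I (v l) (u k) * v l x)" if "k \<in> I" for k x
    using orthonormal_expand[OF fin fin onv refl uV(1)[OF that]] by (rule fun_cong)
  have 3: "cnj (v l y) = (\<Sum>k\<in>I. inner_prod I (v l) (u k) * cnj (u k y))" if "l \<in> I" for l y
    using arg_cong[OF fun_cong[OF orthonormal_expand[OF fin fin onu refl uV(2)[OF that]], of y], of cnj]
    by (simp add: cnj_inner_prod)
  have "spectral_op I u (\<lambda>k. f (d k)) x y = spectral_op I v (\<lambda>k. f (e k)) x y" for x y
  proof -
    have "spectral_op I u (\<lambda>k. f (d k)) x y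
        = (\<Sum>k\<in>I. \<Sum>l\<in>I. inner_prod I (v l) (u k) * complex_of_real (f (d k)) * v l x * cnj (u k y))"
      unfolding spectral_op_def ket_bra_def
      by (intro sum.cong refl) (subst 2, auto simp: sum_distrib_left sum_distrib_right mult_ac)
    also have "\<dots> = (\<Sum>k\<in>I. \<Sum>l\<in>I. inner_prod I (v l) (u k) * complex_of_real (f (e l)) * v l x * cnj (u k y))"
      by (intro sum.cong refl) (simp add: 1)
    also have "\<dots> = spectral_op I v (\<lambda>k. f (e k)) x y"
      unfolding spectral_op_def ket_bra_def
      by (subst sum.swap, intro sum.cong refl) (subst 3, auto simp: sum_distrib_left mult_ac)
    finally show ?thesis .
  qed
  then show ?thesis by (intro ext)
qed

text \<open>Makes the definite description in \<open>op_fun\<close> usable: existence is immediate,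
  uniqueness is \<open>spectral_op_fun_unique\<close>.\<close>

lemma op_fun_spectral_op:
  assumes "finite I" "orthonormal_basis I u"
  shows "op_fun I f (spectral_op I u d) = spectral_op I u (\<lambda>k. f (d k))"
  unfolding op_fun_def
proof (rule the_equality)
  show "\<exists>u' d'. orthonormal_basis I u' \<and> spectral_op I u d = spectral_op I u' d' \<and>
      spectral_op I u (\<lambda>k. f (d k)) = spectral_op I u' (\<lambda>k. f (d' k))"
    using assms by blast
next
  fix Y assume "\<exists>u' d'. orthonormal_basis I u' \<and> spectral_op I u d = spectral_op I u' d' \<and>
      Y = spectral_op I u' (\<lambda>k. f (d' k))"
  then show "Y = spectral_op I u (\<lambda>k. f (d k))"
    using spectral_op_fun_unique[OF assms(1) assms(2)] by metis
qed

lemma op_trace_spectral_mult: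
  assumes fin: "finite I" and u: "orthonormal_basis I u"
  shows "op_trace I (op_mult I (spectral_op I u d) (spectral_op I u e)) = complex_of_real (\<Sum>k\<in>I. d k * e k)"
proof -
  have "op_mult I (spectral_op I u d) (spectral_op I u e) x x
      = (\<Sum>k\<in>I. op_apply I (spectral_op I u d) (u k) x * (complex_of_real (e k) * cnj (u k x)))" for x
    unfolding op_mult_def spectral_op_def[of I u e] ket_bra_def op_apply_def sum_distrib_left sum_distrib_right
    by (subst sum.swap) (simp add: mult_ac)
  also have "\<dots> x = (\<Sum>k\<in>I. complex_of_real (d k * e k) * (cnj (u k x) * u k x))" for x
    by (intro sum.cong refl) (simp add: op_apply_spectral[OF fin u])
  finally have "op_trace I (op_mult I (spectral_op I u d) (spectral_op I u e))
      = (\<Sum>k\<in>I. complex_of_real (d k * e k) * inner_prod I (u k) (u k))"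
    unfolding op_trace_def inner_prod_def sum_distrib_left by (simp, subst sum.swap, simp)
  then show ?thesis using u by (simp add: orthonormal_basis_def)
qed

lemma von_neumann_entropy_spectral_op:
  assumes "finite I" "orthonormal_basis I u"
  shows "von_neumann_entropy I (spectral_op I u d) = - (\<Sum>k\<in>I. d k * ln (d k))"
  unfolding von_neumann_entropy_def op_fun_spectral_op[OF assms] op_trace_spectral_mult[OF assms]
  by simp

text \<open>Eigenvectors may be labelled by any set of the right size. This fits the reduced density
  matrices, whose eigenvectors carry labels (s, k) and not multi-indices.\<close>

lemma von_neumann_entropy_eqI:
  assumes fin: "finite I" and on: "orthonormal_family I K u" and K: "finite K" "card K = card I"
    and X: "\<And>x y. X x y = (\<Sum>k\<in>K. complex_of_real (d k) * (u k x * cnj (u k y)))"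
  shows "von_neumann_entropy I X = - (\<Sum>k\<in>K. d k * ln (d k))"
proof -
  obtain h where h: "bij_betw h I K" using fin K by (metis finite_same_card_bij)
  have hK: "h x \<in> K" if "x \<in> I" for x using h that by (auto simp: bij_betw_def)
  have inj: "h x = h y \<longleftrightarrow> x = y" if "x \<in> I" "y \<in> I" for x y
    using h that by (auto simp: bij_betw_def inj_on_def)
  have "orthonormal_basis I (u \<circ> h)"
    using on hK inj by (auto simp: orthonormal_basis_def orthonormal_family_def)
  moreover have "X = spectral_op I (u \<circ> h) (d \<circ> h)"
    unfolding spectral_op_def ket_bra_def
    by (intro ext) (simp add: X sum.reindex_bij_betw[OF h, symmetric])
  ultimately have "von_neumann_entropy I X = - (\<Sum>k\<in>I. d (h k) * ln (d (h k)))"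
    using von_neumann_entropy_spectral_op[OF fin] by simp
  then show ?thesis
    by (simp add: sum.reindex_bij_betw[OF h, of "\<lambda>k. d k * ln (d k)"])
qed

text \<open>The convex function x ln x lies above its tangent line at \<open>t\<close>.\<close>

lemma mult_ln_ge:
  fixes p t :: real assumes "p \<ge> 0" "t > 0"
  shows "p * ln p \<ge> p * ln t + p - t"
proof (cases "p = 0")
  case False
  then have p: "p > 0" using assms by simp
  have "ln (t / p) \<le> t / p - 1" using p assms by (intro ln_le_minus_one) simp
  then have "p * (ln t - ln p) \<le> p * (t / p - 1)" using p assms by (simp add: ln_div)
  then show ?thesis using p by (simp add: algebra_simps)
qed (use assms in simp)

lemma von_neumann_entropy_le_ln_card:
  assumes fin: "finite I" and X: "hermitian_on I X" and tr: "op_trace I X = 1"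
    and pos: "\<And>v. v \<in> vecs I \<Longrightarrow> Re (inner_prod I v (op_apply I X v)) \<ge> 0"
  shows "von_neumann_entropy I X \<le> ln (real (card I))"
proof -
  obtain u d where u: "orthonormal_basis I u" and Xu: "X = spectral_op I u d"
    and eig: "\<And>k. k \<in> I \<Longrightarrow> op_apply I X (u k) = (\<lambda>x. complex_of_real (d k) * u k x)"
    using spectral_theorem[OF fin X] by blast
  have I: "I \<noteq> {}" using tr by (auto simp: op_trace_def)
  then have c: "real (card I) > 0" using fin by (simp add: card_gt_0_iff)
  have d: "d k \<ge> 0" if "k \<in> I" for k
    using pos[of "u k"] u that by (simp add: eig inner_prod_scale_right orthonormal_basis_def)
  have "op_trace I X = (\<Sum>k\<in>I. complex_of_real (d k) * inner_prod I (u k) (u k))"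
    unfolding Xu op_trace_def spectral_op_def ket_bra_def inner_prod_def sum_distrib_left
    by (subst sum.swap) (simp add: mult_ac)
  also have "\<dots> = complex_of_real (\<Sum>k\<in>I. d k)" using u by (simp add: orthonormal_basis_def)
  finally have sum1: "(\<Sum>k\<in>I. d k) = 1" using tr by (metis of_real_eq_1_iff)
  \<comment> \<open>Tangents are taken at the uniform value \<open>1 / card I\<close>; the linear
    terms cancel since both distributions have total mass 1.\<close>
  have "(\<Sum>k\<in>I. d k * ln (d k)) \<ge> (\<Sum>k\<in>I. d k * ln (1 / card I) + d k - 1 / card I)"
    using c d by (intro sum_mono mult_ln_ge) auto
  also have "(\<Sum>k\<in>I. d k * ln (1 / card I) + d k - 1 / card I) = - ln (card I)"
    using c I by (simp add: sum_subtractf sum.distrib sum1 sum_distrib_right[symmetric] ln_div)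
  finally show ?thesis unfolding Xu von_neumann_entropy_spectral_op[OF fin u] by simp
qed

section \<open>Moments of Haar-random vectors\<close>

text \<open>The last two clauses say that the span of the family is exactly \<open>H\<close>. They
  also encode that \<open>H\<close> is a linear subspace.\<close>

definition subspace_basis :: "'i set \<Rightarrow> 'i vec set \<Rightarrow> 's set \<Rightarrow> ('s \<Rightarrow> 'i vec) \<Rightarrow> bool" where
  "subspace_basis I H S \<phi> \<longleftrightarrow> finite I \<and> finite S \<and> orthonormal_family I S \<phi> \<and>
     (\<forall>z. (\<lambda>x. \<Sum>s\<in>S. z s * \<phi> s x) \<in> H) \<and>
     (\<forall>\<psi>\<in>H. \<psi> = (\<lambda>x. \<Sum>s\<in>S. inner_prod I (\<phi> s) \<psi> * \<phi> s x))"

lemma op_apply_op_mult: "op_apply I (op_mult I X Y) v = op_apply I X (op_apply I Y v)"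
  unfolding op_apply_def op_mult_def sum_distrib_left sum_distrib_right
  by (intro ext, subst sum.swap) (simp add: mult.assoc)

lemma op_apply_zero: "op_apply I X (\<lambda>_. 0) = (\<lambda>_. 0)"
  by (simp add: op_apply_def)

lemma op_mult_in_unitary_group:
  assumes "U \<in> unitary_group I H" "V \<in> unitary_group I H"
  shows "op_mult I U V \<in> unitary_group I H"
proof -
  have U: "op_apply I U ` H = H" "U \<in> ops I"
      "\<And>v w. v \<in> H \<Longrightarrow> w \<in> H \<Longrightarrow> inner_prod I (op_apply I U v) (op_apply I U w) = inner_prod I v w"
    and V: "op_apply I V ` H = H" "V \<in> ops I"
      "\<And>v w. v \<in> H \<Longrightarrow> w \<in> H \<Longrightarrow> inner_prod I (op_apply I V v) (op_apply I V w) = inner_prod I v w"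
      "\<And>v. v \<in> vecs I \<Longrightarrow> \<forall>w\<in>H. inner_prod I w v = 0 \<Longrightarrow> op_apply I V v = (\<lambda>_. 0)"
    using assms by (auto simp: unitary_group_def)
  have "op_mult I U V \<in> ops I" using U(2) V(2) by (auto simp: ops_def op_mult_def)
  moreover have "op_apply I (op_mult I U V) ` H = H"
    unfolding op_apply_op_mult using U(1) V(1) by (metis image_image)
  moreover have "inner_prod I (op_apply I (op_mult I U V) v) (op_apply I (op_mult I U V) w) = inner_prod I v w"
    if "v \<in> H" "w \<in> H" for v w
  proof -
    have "op_apply I V v \<in> H" "op_apply I V w \<in> H" using V(1) that by auto
    then show ?thesis unfolding op_apply_op_mult using U(3) V(3) that by simp
  qed
  ultimately show ?thesis
    using V(4) by (simp add: unitary_group_def op_apply_op_mult op_apply_zero)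
qed

context
  fixes I :: "'i set" and H S and \<phi> :: "'s \<Rightarrow> 'i vec"
  assumes basis: "subspace_basis I H S \<phi>"
begin

lemma basis_finite: "finite I" "finite S"
  and basis_orthonormal: "s \<in> S \<Longrightarrow> t \<in> S \<Longrightarrow> inner_prod I (\<phi> s) (\<phi> t) = (if s = t then 1 else 0)"
  and basis_in_vecs: "s \<in> S \<Longrightarrow> \<phi> s \<in> vecs I"
  and basis_comb: "(\<lambda>x. \<Sum>s\<in>S. z s * \<phi> s x) \<in> H"
  using basis by (auto simp: subspace_basis_def orthonormal_family_def)

lemma basis_expand: "\<psi> \<in> H \<Longrightarrow> \<psi> = (\<lambda>x. \<Sum>s\<in>S. inner_prod I (\<phi> s) \<psi> * \<phi> s x)"
  using basis unfolding subspace_basis_def by blast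

lemma basis_mem:
  assumes "s \<in> S"
  shows "\<phi> s \<in> H"
proof -
  have "(\<lambda>x. \<Sum>t\<in>S. (if t = s then 1 else 0) * \<phi> t x) \<in> H" by (rule basis_comb)
  then show ?thesis using assms basis_finite by (simp add: if_distribR if_distrib cong: if_cong)
qed

lemma basis_coeff: "s \<in> S \<Longrightarrow> inner_prod I (\<phi> s) (\<lambda>x. \<Sum>t\<in>S. z t * \<phi> t x) = z s"
  unfolding inner_prod_sum_right using basis_finite
  by (simp add: basis_orthonormal if_distrib cong: if_cong)

lemma basis_parseval:
  assumes "v \<in> H"
  shows "inner_prod I v w = (\<Sum>s\<in>S. cnj (inner_prod I (\<phi> s) v) * inner_prod I (\<phi> s) w)"
  by (subst basis_expand[OF assms]) (simp only: inner_prod_sum_left)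

lemma basis_sum_norm:
  assumes "\<psi> \<in> unit_vecs I H"
  shows "(\<Sum>s\<in>S. (cmod (inner_prod I (\<phi> s) \<psi>))\<^sup>2) = 1"
proof -
  have "complex_of_real (\<Sum>s\<in>S. (cmod (inner_prod I (\<phi> s) \<psi>))\<^sup>2)
      = (\<Sum>s\<in>S. cnj (inner_prod I (\<phi> s) \<psi>) * inner_prod I (\<phi> s) \<psi>)"
    unfolding of_real_sum by (intro sum.cong refl) (simp only: complex_norm_square mult.commute)
  also have "\<dots> = 1"
    using basis_parseval[of \<psi> \<psi>] assms by (simp add: unit_vecs_def)
  finally show ?thesis by (metis of_real_eq_1_iff)
qed

end

section \<open>Unitaries exchanging two orthonormal bases, and rotations of two basis
  vectors\<close>

definition change_of_basis :: "'s set \<Rightarrow> ('s \<Rightarrow> 'i vec) \<Rightarrow> ('s \<Rightarrow> 'i vec) \<Rightarrow> 'i op" where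
  "change_of_basis S \<phi> \<phi>' = (\<lambda>x y. \<Sum>s\<in>S. \<phi> s x * cnj (\<phi>' s y))"

lemma op_apply_change_of_basis:
  "op_apply I (change_of_basis S \<phi> \<phi>') v = (\<lambda>x. \<Sum>s\<in>S. inner_prod I (\<phi>' s) v * \<phi> s x)"
  unfolding op_apply_def change_of_basis_def inner_prod_def sum_distrib_left sum_distrib_right
  by (intro ext, subst sum.swap) (simp add: mult_ac)

text \<open>The operator sends \<open>\<phi>' s\<close> to \<open>\<phi> s\<close>, so the
  coefficients of the image in the first basis are those of the argument in the second. Isometry is
  then Parseval's identity in both bases.\<close>

lemma change_of_basis_unitary:
  assumes b: "subspace_basis I H S \<phi>" and b': "subspace_basis I H S \<phi>'"
  shows "change_of_basis S \<phi> \<phi>' \<in> unitary_group I H"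
proof -
  let ?V = "change_of_basis S \<phi> \<phi>'"
  have coeff: "inner_prod I (\<phi> s) (op_apply I ?V v) = inner_prod I (\<phi>' s) v" if "s \<in> S" for s v
    unfolding op_apply_change_of_basis by (rule basis_coeff[OF b that])
  have mem: "op_apply I ?V v \<in> H" for v
    unfolding op_apply_change_of_basis by (rule basis_comb[OF b])
  have "?V \<in> ops I"
    using basis_in_vecs[OF b] basis_in_vecs[OF b']
    by (auto simp: ops_def change_of_basis_def vecs_def intro!: sum.neutral)
  moreover have "v \<in> op_apply I ?V ` H" if "v \<in> H" for v
  proof -
    define w where "w = (\<lambda>x. \<Sum>s\<in>S. inner_prod I (\<phi> s) v * \<phi>' s x)"
    have "op_apply I ?V w = (\<lambda>x. \<Sum>s\<in>S. inner_prod I (\<phi> s) v * \<phi> s x)"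
      unfolding op_apply_change_of_basis w_def
      by (intro ext sum.cong refl) (simp add: basis_coeff[OF b'])
    then have "op_apply I ?V w = v" using basis_expand[OF b that] by simp
    moreover have "w \<in> H" unfolding w_def by (rule basis_comb[OF b'])
    ultimately show ?thesis by blast
  qed
  moreover have "inner_prod I (op_apply I ?V v) (op_apply I ?V w) = inner_prod I v w"
    if "v \<in> H" "w \<in> H" for v w
    unfolding basis_parseval[OF b mem] basis_parseval[OF b' that(1)]
    by (intro sum.cong refl) (simp add: coeff)
  moreover have "op_apply I ?V v = (\<lambda>_. 0)" if "\<forall>w\<in>H. inner_prod I w v = 0" for v
    unfolding op_apply_change_of_basis using that basis_mem[OF b'] by simp
  ultimately show ?thesis using mem unfolding unitary_group_def by blast
qed

lemma sum_split_two:
  fixes f :: "'a \<Rightarrow> 'b::comm_monoid_add"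
  assumes "finite S" "j \<in> S" "k \<in> S" "j \<noteq> k"
  shows "sum f S = f j + (f k + sum f (S - {j, k}))"
proof -
  have "S = insert j (insert k (S - {j, k}))" using assms by auto
  then have "sum f S = sum f (insert j (insert k (S - {j, k})))" by simp
  then show ?thesis using assms by simp
qed

text \<open>A balanced rotation in the plane of two basis vectors with relative phase \<omega>.
  Comparing the old and the new basis under Haar invariance relates the fourth moments.\<close>

lemma subspace_basis_rotate:
  assumes b: "subspace_basis I H S \<phi>" and jk: "j \<in> S" "k \<in> S" "j \<noteq> k" and w: "cnj \<omega> * \<omega> = 1"
    and r: "r = complex_of_real (1 / sqrt 2)"
    and \<phi>': "\<phi>' = \<phi>(j := (\<lambda>x. r * (\<phi> j x + \<omega> * \<phi> k x)), k := (\<lambda>x. r * (\<phi> j x - \<omega> * \<phi> k x)))"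
  shows "subspace_basis I H S \<phi>'"
proof -
  note fin = basis_finite[OF b]
  have rr: "r * r = 1 / 2" "cnj r = r"
    unfolding r by (simp_all flip: of_real_mult)
  have w': "\<omega> * cnj \<omega> = 1" using w by (simp add: mult.commute)
  have \<phi>'1: "\<phi>' j = (\<lambda>x. r * (\<phi> j x + \<omega> * \<phi> k x))" "\<phi>' k = (\<lambda>x. r * (\<phi> j x - \<omega> * \<phi> k x))"
     "\<And>s. s \<noteq> j \<Longrightarrow> s \<noteq> k \<Longrightarrow> \<phi>' s = \<phi> s"
    using jk by (auto simp: \<phi>')
  note on = basis_orthonormal[OF b]
  have ij: "inner_prod I (\<phi>' j) v = r * (inner_prod I (\<phi> j) v + cnj \<omega> * inner_prod I (\<phi> k) v)"
    "inner_prod I (\<phi>' k) v = r * (inner_prod I (\<phi> j) v - cnj \<omega> * inner_prod I (\<phi> k) v)"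
    "inner_prod I v (\<phi>' j) = r * (inner_prod I v (\<phi> j) + \<omega> * inner_prod I v (\<phi> k))"
    "inner_prod I v (\<phi>' k) = r * (inner_prod I v (\<phi> j) - \<omega> * inner_prod I v (\<phi> k))" for v
    unfolding \<phi>'1 inner_prod_scale_left inner_prod_scale_right inner_prod_add_left
      inner_prod_diff_left inner_prod_add_right inner_prod_diff_right rr by simp_all
  have "r * (r + \<omega> * (r * cnj \<omega>)) = r * r * (1 + \<omega> * cnj \<omega>)" by (simp add: algebra_simps)
  then have rw: "r * (r + \<omega> * (r * cnj \<omega>)) = 1" by (simp only: rr w') simp
  have "inner_prod I (\<phi>' s) (\<phi>' t) = (if s = t then 1 else 0)" if st: "s \<in> S" "t \<in> S" for s t
    using jk st rw rr(1)
    by (cases "s = j"; cases "s = k"; cases "t = j"; cases "t = k")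
       (simp_all add: ij \<phi>'1(3) on mult.assoc w w')
  moreover have "\<phi>' s \<in> vecs I" if "s \<in> S" for s
    using basis_in_vecs[OF b] jk that by (auto simp: \<phi>' vecs_def)
  moreover have "(\<lambda>x. \<Sum>s\<in>S. z s * \<phi>' s x) \<in> H" for z
  proof -
    \<comment> \<open>Coefficients of the same combination in the old basis, found by collecting the
      terms at \<open>j\<close> and \<open>k\<close>.\<close>
    define z' where "z' = z(j := r * (z j + z k), k := r * \<omega> * (z j - z k))"
    have "(\<Sum>s\<in>S. z s * \<phi>' s x) = (\<Sum>s\<in>S. z' s * \<phi> s x)" for x
      unfolding sum_split_two[OF fin(2) jk, of "\<lambda>s. z s * \<phi>' s x"]
        sum_split_two[OF fin(2) jk, of "\<lambda>s. z' s * \<phi> s x"]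
      using jk by (simp add: \<phi>'1 z'_def algebra_simps)
    then show ?thesis using basis_comb[OF b] by simp
  qed
  moreover have "\<psi> = (\<lambda>x. \<Sum>s\<in>S. inner_prod I (\<phi>' s) \<psi> * \<phi>' s x)" if "\<psi> \<in> H" for \<psi>
  proof -
    define f where "f = (\<lambda>x s. inner_prod I (\<phi> s) \<psi> * \<phi> s x)"
    define f' where "f' = (\<lambda>x s. inner_prod I (\<phi>' s) \<psi> * \<phi>' s x)"
    \<comment> \<open>The cross terms between \<open>\<phi> j\<close> and \<open>\<phi> k\<close>
      cancel in the sum of the two contributions.\<close>
    have two: "f' x j + f' x k = f x j + f x k" for x
    proof -
      have "f' x j + f' x k = r * r * (2 * f x j + 2 * (cnj \<omega> * \<omega>) * f x k)"
        unfolding f_def f'_def ij unfolding \<phi>'1 by (simp add: algebra_simps)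
      then show ?thesis by (simp only: rr w) (simp add: distrib_left)
    qed
    have rest: "sum (f' x) (S - {j, k}) = sum (f x) (S - {j, k})" for x
      by (intro sum.cong refl) (simp add: f_def f'_def \<phi>'1)
    have "sum (f' x) S = sum (f x) S" for x
      unfolding sum_split_two[OF fin(2) jk, of "f' x"] sum_split_two[OF fin(2) jk, of "f x"]
        add.assoc[symmetric] two rest ..
    then show ?thesis using basis_expand[OF b that] by (simp add: f_def f'_def)
  qed
  ultimately show ?thesis using fin unfolding subspace_basis_def orthonormal_family_def by blast
qed

text \<open>Each |a + \<omega> b|^2 is |a|^2 + |b|^2 plus an interference term, of which only the
  square survives the sum. The signs 1 and -1 alone would leave the squared real part of a cnj(b); i
  and -i add the squared imaginary part, and together they give |a|^2 |b|^2.\<close>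

lemma sum_rotated_fourth_powers:
  "(cmod (a + b))^4 + (cmod (a - b))^4 + (cmod (a + \<i> * b))^4 + (cmod (a - \<i> * b))^4
    = 4 * ((cmod a)^4 + (cmod b)^4 + 4 * ((cmod a)\<^sup>2 * (cmod b)\<^sup>2))"
proof -
  have *: "(cmod z)^4 = ((Re z)\<^sup>2 + (Im z)\<^sup>2)\<^sup>2" for z
    by (metis cmod_power2 numeral_Bit0 power2_eq_square power_add)
  show ?thesis unfolding * cmod_power2 by (simp add: power2_eq_square algebra_simps)
qed

section \<open>Haar averages of basis coefficients\<close>

lemma continuous_on_op_entry: "continuous_on A (\<lambda>U :: 'i op. U x y)"
  by (rule continuous_on_product_then_coordinatewise[OF continuous_on_coordinate])

context
  fixes I :: "'i set" and H :: "'i vec set" and M :: "'i op measure" and \<psi>0 :: "'i vec"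
  assumes haar: "haar_prob (unitary_group I H) (op_mult I) M"
    and \<psi>0: "\<psi>0 \<in> unit_vecs I H"
begin

lemma haar_prob_space: "prob_space M"
  and haar_sets: "sets M = sets (restrict_space borel (unitary_group I H))"
  and haar_invariant: "V \<in> unitary_group I H \<Longrightarrow> distr M M (op_mult I V) = M"
  using haar by (auto simp: haar_prob_def)

lemma haar_space: "space M = unitary_group I H"
  using sets_eq_imp_space_eq[OF haar_sets] by (simp add: space_restrict_space)

lemma haar_measurable_continuous:
  fixes f :: "'i op \<Rightarrow> 'b::topological_space"
  assumes "continuous_on UNIV f"
  shows "f \<in> measurable M borel"
  using measurable_restrict_space1[OF borel_measurable_continuous_onI[OF assms]]
  by (simp add: measurable_cong_sets[OF haar_sets refl])

text \<open>\<open>haar_prob\<close> only equates measures; pulling an integral back along a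
  translation also calls for its measurability, here from continuity in each matrix entry.\<close>

lemma haar_translation_measurable:
  assumes V: "V \<in> unitary_group I H"
  shows "op_mult I V \<in> measurable M M"
proof -
  have "continuous_on UNIV (\<lambda>(U :: 'i op) x y. \<Sum>z\<in>I. V x z * U z y)"
    by (intro continuous_on_coordinatewise_then_product continuous_on_sum continuous_on_mult
        continuous_on_const continuous_on_op_entry)
  then have "op_mult I V \<in> measurable M borel"
    by (intro haar_measurable_continuous) (simp add: op_mult_def)
  then have "op_mult I V \<in> measurable M (restrict_space borel (unitary_group I H))"
    using V by (intro measurable_restrict_space2) (auto simp: haar_space op_mult_in_unitary_group)
  then show ?thesis by (simp add: measurable_cong_sets[OF refl haar_sets])
qed

lemma haar_unit_vec:
  assumes "U \<in> space M"
  shows "op_apply I U \<psi>0 \<in> unit_vecs I H"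
  using assms \<psi>0 unfolding haar_space by (auto simp: unitary_group_def unit_vecs_def)

lemma haar_coeff_measurable:
  "(\<lambda>U. inner_prod I v (op_apply I U \<psi>0)) \<in> borel_measurable M"
  unfolding inner_prod_def op_apply_def
  by (intro haar_measurable_continuous continuous_on_sum continuous_on_mult continuous_on_const
      continuous_on_op_entry)

text \<open>Left translation by the change of basis turns the coefficient at \<open>\<phi> s\<close>
  into the one at \<open>\<phi>' s\<close>, and the measure is invariant under it.\<close>

lemma haar_change_of_basis:
  fixes f :: "complex \<Rightarrow> real"
  assumes b: "subspace_basis I H S \<phi>" and b': "subspace_basis I H S \<phi>'" and s: "s \<in> S"
    and f: "f \<in> borel_measurable borel"
  shows "(\<integral>U. f (inner_prod I (\<phi> s) (op_apply I U \<psi>0)) \<partial>M)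
       = (\<integral>U. f (inner_prod I (\<phi>' s) (op_apply I U \<psi>0)) \<partial>M)"
proof -
  let ?V = "change_of_basis S \<phi> \<phi>'"
  have V: "?V \<in> unitary_group I H" by (rule change_of_basis_unitary[OF b b'])
  have "(\<integral>U. f (inner_prod I (\<phi> s) (op_apply I U \<psi>0)) \<partial>M)
      = (\<integral>U. f (inner_prod I (\<phi> s) (op_apply I U \<psi>0)) \<partial>(distr M M (op_mult I ?V)))"
    by (simp add: haar_invariant[OF V])
  also have "\<dots> = (\<integral>U. f (inner_prod I (\<phi> s) (op_apply I (op_mult I ?V U) \<psi>0)) \<partial>M)"
    by (intro integral_distr haar_translation_measurable[OF V]
        measurable_compose[OF haar_coeff_measurable f])
  finally show ?thesis
    unfolding op_apply_op_mult op_apply_change_of_basis basis_coeff[OF b s] .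
qed

text \<open>The squared coefficients of a unit vector add up to 1, so every such product is bounded
  by 1 on a probability space.\<close>

lemma haar_integrable_coeff_products:
  assumes b: "subspace_basis I H S \<phi>" and st: "s \<in> S" "t \<in> S"
  shows "integrable M (\<lambda>U. (cmod (inner_prod I (\<phi> s) (op_apply I U \<psi>0)))\<^sup>2 *
           (cmod (inner_prod I (\<phi> t) (op_apply I U \<psi>0)))\<^sup>2)"
proof -
  interpret prob_space M by (rule haar_prob_space)
  have le1: "(cmod (inner_prod I (\<phi> s) (op_apply I U \<psi>0)))\<^sup>2 \<le> 1" if "U \<in> space M" "s \<in> S" for s U
  proof -
    have "(cmod (inner_prod I (\<phi> s) (op_apply I U \<psi>0)))\<^sup>2
        \<le> (\<Sum>s\<in>S. (cmod (inner_prod I (\<phi> s) (op_apply I U \<psi>0)))\<^sup>2)"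
      using basis_finite[OF b] that by (intro member_le_sum) auto
    then show ?thesis using basis_sum_norm[OF b haar_unit_vec[OF that(1)]] by simp
  qed
  have "norm ((cmod (inner_prod I (\<phi> s) (op_apply I U \<psi>0)))\<^sup>2 *
           (cmod (inner_prod I (\<phi> t) (op_apply I U \<psi>0)))\<^sup>2) \<le> 1" if "U \<in> space M" for U
    using mult_mono[OF le1[OF that st(1)] le1[OF that st(2)]] by (simp add: abs_mult)
  then show ?thesis
    using haar_coeff_measurable
    by (intro integrable_const_bound[where B = 1] AE_I2) auto
qed

text \<open>Averaging \<open>|c\<^sub>j + \<omega> c\<^sub>k|\<^sup>4\<close> over the fourth roots of unity \<open>\<omega>\<close>.\<close>

lemma haar_fourth_moment_relation:
  assumes b: "subspace_basis I H S \<phi>" and jk: "j \<in> S" "k \<in> S" "j \<noteq> k"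
  defines "c \<equiv> \<lambda>s U. cmod (inner_prod I (\<phi> s) (op_apply I U \<psi>0))"
  shows "4 * (\<integral>U. (c j U)^4 \<partial>M)
    = (\<integral>U. (c j U)^4 \<partial>M) + (\<integral>U. (c k U)^4 \<partial>M) + 4 * (\<integral>U. (c j U)\<^sup>2 * (c k U)\<^sup>2 \<partial>M)"
proof -
  define z where "z = (\<lambda>s U. inner_prod I (\<phi> s) (op_apply I U \<psi>0))"
  have c: "c s U = cmod (z s U)" for s U by (simp add: c_def z_def)
  have rot: "(\<integral>U. (c j U)^4 \<partial>M) = (\<integral>U. (cmod (z j U + \<omega> * z k U))^4 \<partial>M) / 4"
    and int: "integrable M (\<lambda>U. (cmod (z j U + \<omega> * z k U))^4)"
    if w: "cnj \<omega> * \<omega> = 1" for \<omega>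
  proof -
    define r where "r = complex_of_real (1 / sqrt 2)"
    \<comment> \<open>The conjugate of \<omega> appears because the inner product is antilinear in
      its first argument: the new coefficient at \<open>j\<close> is then \<open>r\<close> times z_j
      + \<omega> z_k.\<close>
    define \<phi>' where "\<phi>' = \<phi>(j := (\<lambda>x. r * (\<phi> j x + cnj \<omega> * \<phi> k x)), k := (\<lambda>x. r * (\<phi> j x - cnj \<omega> * \<phi> k x)))"
    have b': "subspace_basis I H S \<phi>'"
      using w by (intro subspace_basis_rotate[OF b jk _ r_def \<phi>'_def]) (simp add: mult.commute)
    have "cmod r ^ 4 = 1 / 4"
      by (simp add: r_def norm_divide power_divide power4_eq_xxxx)
    then have r4: "(cmod (inner_prod I (\<phi>' j) (op_apply I U \<psi>0)))^4 = (cmod (z j U + \<omega> * z k U))^4 / 4" for U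
      using jk
      by (simp add: \<phi>'_def z_def inner_prod_scale_left inner_prod_add_left norm_mult power_mult_distrib)
    show "(\<integral>U. (c j U)^4 \<partial>M) = (\<integral>U. (cmod (z j U + \<omega> * z k U))^4 \<partial>M) / 4"
      using haar_change_of_basis[OF b b' jk(1), of "\<lambda>z. (cmod z)^4"]
      unfolding r4 by (simp add: c z_def)
    have "integrable M (\<lambda>U. (cmod (inner_prod I (\<phi>' j) (op_apply I U \<psi>0)))^4)"
      using haar_integrable_coeff_products[OF b' jk(1) jk(1)]
      by (simp add: power4_eq_xxxx power2_eq_square mult.assoc)
    from integrable_mult_right[OF this, of 4]
    show "integrable M (\<lambda>U. (cmod (z j U + \<omega> * z k U))^4)"
      unfolding r4 by simp
  qed
  have int4: "integrable M (\<lambda>U. (c s U)^4)" if "s \<in> S" for s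
    using haar_integrable_coeff_products[OF b that that]
    by (simp add: c_def power4_eq_xxxx power2_eq_square mult.assoc)
  have int22: "integrable M (\<lambda>U. (c j U)\<^sup>2 * (c k U)\<^sup>2)"
    using haar_integrable_coeff_products[OF b jk(1,2)] by (simp add: c_def)
  \<comment> \<open>Four copies of the same moment, each evaluated with a different fourth root of
    unity.\<close>
  have "4 * (\<integral>U. (c j U)^4 \<partial>M) = (\<integral>U. (cmod (z j U + 1 * z k U))^4 \<partial>M) / 4
      + (\<integral>U. (cmod (z j U + (- 1) * z k U))^4 \<partial>M) / 4
      + (\<integral>U. (cmod (z j U + \<i> * z k U))^4 \<partial>M) / 4
      + (\<integral>U. (cmod (z j U + (- \<i>) * z k U))^4 \<partial>M) / 4"
    using rot[of 1] rot[of "- 1"] rot[of \<i>] rot[of "- \<i>"] by simp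
  also have "\<dots> = (\<integral>U. ((cmod (z j U + 1 * z k U))^4 + (cmod (z j U + (- 1) * z k U))^4
      + (cmod (z j U + \<i> * z k U))^4 + (cmod (z j U + (- \<i>) * z k U))^4) / 4 \<partial>M)"
    using int[of 1] int[of "- 1"] int[of \<i>] int[of "- \<i>"] by (simp add: add_divide_distrib)
  also have "\<dots> = (\<integral>U. (c j U)^4 + (c k U)^4 + 4 * ((c j U)\<^sup>2 * (c k U)\<^sup>2) \<partial>M)"
  proof -
    have "((cmod (z j U + 1 * z k U))^4 + (cmod (z j U + (- 1) * z k U))^4
      + (cmod (z j U + \<i> * z k U))^4 + (cmod (z j U + (- \<i>) * z k U))^4) / 4
      = (c j U)^4 + (c k U)^4 + 4 * ((c j U)\<^sup>2 * (c k U)\<^sup>2)" for U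
      using sum_rotated_fourth_powers[of "z j U" "z k U"] by (simp add: c)
    then show ?thesis by (simp only:)
  qed
  also have "\<dots> = (\<integral>U. (c j U)^4 \<partial>M) + (\<integral>U. (c k U)^4 \<partial>M) + 4 * (\<integral>U. (c j U)\<^sup>2 * (c k U)\<^sup>2 \<partial>M)"
    using int4[OF jk(1)] int4[OF jk(2)] int22 by simp
  finally show ?thesis .
qed

text \<open>Exchanging the two indices in the previous relation shows that all fourth moments equal
  one number \<open>m\<close>, and then that all mixed moments are \<open>m / 2\<close>. Expanding
  the square of the total mass 1 gives D m + D (D - 1) m / 2 = 1, where D is
  \<open>card S\<close>.\<close>

lemma haar_fourth_moment:
  assumes b: "subspace_basis I H S \<phi>" and j: "j \<in> S"
  shows "(\<integral>U. (cmod (inner_prod I (\<phi> j) (op_apply I U \<psi>0)))^4 \<partial>M)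
    = 2 / (real (card S) * (real (card S) + 1))"
proof -
  interpret prob_space M by (rule haar_prob_space)
  define c where "c = (\<lambda>s U. cmod (inner_prod I (\<phi> s) (op_apply I U \<psi>0)))"
  define m where "m = (\<integral>U. (c j U)^4 \<partial>M)"
  define m2 where "m2 = (\<lambda>s t. \<integral>U. (c s U)\<^sup>2 * (c t U)\<^sup>2 \<partial>M)"
  have rel: "4 * (\<integral>U. (c s U)^4 \<partial>M) = (\<integral>U. (c s U)^4 \<partial>M) + (\<integral>U. (c t U)^4 \<partial>M) + 4 * m2 s t"
    if "s \<in> S" "t \<in> S" "s \<noteq> t" for s t
    using haar_fourth_moment_relation[OF b that] by (simp add: c_def m2_def)
  have m2_sym: "m2 s t = m2 t s" for s t by (simp add: m2_def mult.commute)
  have diag: "m2 s s = (\<integral>U. (c s U)^4 \<partial>M)" for s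
    by (simp add: m2_def power4_eq_xxxx power2_eq_square mult.assoc)
  have same: "(\<integral>U. (c s U)^4 \<partial>M) = m" if "s \<in> S" for s
  proof (cases "s = j")
    case False
    then show ?thesis
      using rel[OF that j] rel[OF j that] m2_sym[of s j] unfolding m_def by simp
  qed (simp add: m_def)
  have off: "m2 s t = m / 2" if "s \<in> S" "t \<in> S" "s \<noteq> t" for s t
    using rel[OF that] same that by simp
  have row: "(\<Sum>t\<in>S. m2 s t) = m * (real (card S) + 1) / 2" if "s \<in> S" for s
  proof -
    have "(\<Sum>t\<in>S. m2 s t) = (\<Sum>t\<in>S. m / 2 + (if t = s then m / 2 else 0))"
      by (intro sum.cong refl) (auto simp: off diag same that)
    also have "\<dots> = m * (real (card S) + 1) / 2"
      using that basis_finite[OF b] by (simp add: sum.distrib) (simp add: field_simps)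
    finally show ?thesis .
  qed
  have "(1::real) = (\<integral>U. 1 \<partial>M)" by (simp add: prob_space)
  also have "\<dots> = (\<integral>U. (\<Sum>s\<in>S. \<Sum>t\<in>S. (c s U)\<^sup>2 * (c t U)\<^sup>2) \<partial>M)"
  proof (intro Bochner_Integration.integral_cong refl)
    fix U assume "U \<in> space M"
    then have "(\<Sum>s\<in>S. (c s U)\<^sup>2) = 1"
      using basis_sum_norm[OF b haar_unit_vec] by (simp add: c_def)
    then show "1 = (\<Sum>s\<in>S. \<Sum>t\<in>S. (c s U)\<^sup>2 * (c t U)\<^sup>2)"
      unfolding sum_distrib_left[symmetric] sum_distrib_right[symmetric] by simp
  qed
  also have "\<dots> = (\<Sum>s\<in>S. \<Sum>t\<in>S. m2 s t)"
    unfolding m2_def using haar_integrable_coeff_products[OF b]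
    by (simp add: c_def Bochner_Integration.integral_sum)
  also have "\<dots> = real (card S) * (m * (real (card S) + 1) / 2)" by (simp add: row)
  finally have "m * (real (card S) * (real (card S) + 1)) = 2" by (simp add: mult_ac)
  moreover have "card S > 0" using j basis_finite[OF b] by (auto simp: card_gt_0_iff)
  ultimately have "m = 2 / (real (card S) * (real (card S) + 1))"
    by (simp add: eq_divide_eq)
  then show ?thesis unfolding m_def c_def .
qed

end

section \<open>The tensor square of a spin representation\<close>

text \<open>Matrix entry of J_+ between levels l - 1 and l of spin n/2. It vanishes at 0 and, by
  truncated subtraction, at every l above n, so shifted indices may leave the range
  harmlessly.\<close>

definition ladder :: "nat \<Rightarrow> nat \<Rightarrow> real" where
  "ladder n l = sqrt (real (l * (Suc n - l)))"

lemma ladder_0 [simp]: "ladder n 0 = 0" and ladder_Suc_n: "l > n \<Longrightarrow> ladder n l = 0"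
  and ladder_reflect: "l \<le> n \<Longrightarrow> ladder n (n - l) = ladder n (Suc l)"
  by (simp_all add: ladder_def mult.commute Suc_diff_le)

lemma ladder_nonzero: "0 < l \<Longrightarrow> l \<le> n \<Longrightarrow> ladder n l \<noteq> 0"
  by (simp only: ladder_def real_sqrt_eq_zero_cancel_iff of_nat_eq_0_iff) simp

lemma ladder_square: "l \<le> Suc n \<Longrightarrow> ladder n l * ladder n l = real l * (real n + 1 - real l)"
  by (simp add: ladder_def of_nat_diff)

type_synonym pvec = "(nat \<times> nat) vec"

abbreviation grid :: "nat \<Rightarrow> (nat \<times> nat) set" where
  "grid n \<equiv> {..n} \<times> {..n}"

text \<open>J_+ on both factors together. At \<open>a = 0\<close> the truncated \<open>a - 1\<close>
  reads a wrong entry, but its coefficient \<open>ladder n 0\<close> is 0.\<close>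

definition raise :: "nat \<Rightarrow> pvec \<Rightarrow> pvec" where
  "raise n v = (\<lambda>(a, b). complex_of_real (ladder n a) * v (a - 1, b)
                       + complex_of_real (ladder n b) * v (a, b - 1))"

definition lower :: "nat \<Rightarrow> pvec \<Rightarrow> pvec" where
  "lower n v = (\<lambda>(a, b). complex_of_real (ladder n (Suc a)) * v (Suc a, b)
                       + complex_of_real (ladder n (Suc b)) * v (a, Suc b))"

text \<open>Levels are counted from the bottom, so weight \<open>s\<close> is the J_z eigenvalue s -
  n.\<close>

definition has_weight :: "nat \<Rightarrow> pvec \<Rightarrow> bool" where
  "has_weight s v \<longleftrightarrow> (\<forall>a b. v (a, b) \<noteq> 0 \<longrightarrow> a + b = s)"

lemma raise_in_vecs: "v \<in> vecs (grid n) \<Longrightarrow> raise n v \<in> vecs (grid n)"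
  and lower_in_vecs: "v \<in> vecs (grid n) \<Longrightarrow> lower n v \<in> vecs (grid n)"
  by (auto simp: vecs_def raise_def lower_def ladder_Suc_n not_le)

lemma raise_scale: "raise n (\<lambda>x. c * v x) = (\<lambda>x. c * raise n v x)"
  and lower_scale: "lower n (\<lambda>x. c * v x) = (\<lambda>x. c * lower n v x)"
  by (auto simp: raise_def lower_def algebra_simps)

lemma lower_diff: "lower n (\<lambda>x. v x - w x) = (\<lambda>x. lower n v x - lower n w x)"
  by (auto simp: lower_def algebra_simps)

lemma raise_sum: "raise n (\<lambda>x. \<Sum>k\<in>K. v k x * c k) p = (\<Sum>k\<in>K. raise n (v k) p * c k)"
  and lower_sum: "lower n (\<lambda>x. \<Sum>k\<in>K. v k x * c k) p = (\<Sum>k\<in>K. lower n (v k) p * c k)"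
  by (cases p; simp add: raise_def lower_def algebra_simps sum.distrib sum_distrib_left)+

lemma raise_cnj: "raise n (\<lambda>x. cnj (v x)) p = cnj (raise n v p)"
  and lower_cnj: "lower n (\<lambda>x. cnj (v x)) p = cnj (lower n v p)"
  by (cases p; simp add: raise_def lower_def)+

lemma raise_weight: "has_weight s v \<Longrightarrow> has_weight (Suc s) (raise n v)"
  unfolding has_weight_def
proof (intro allI impI)
  fix a b assume v: "\<forall>a b. v (a, b) \<noteq> 0 \<longrightarrow> a + b = s" and nz: "raise n v (a, b) \<noteq> 0"
  have "(a \<noteq> 0 \<and> v (a - 1, b) \<noteq> 0) \<or> (b \<noteq> 0 \<and> v (a, b - 1) \<noteq> 0)"
    by (rule ccontr) (use nz in \<open>auto simp: raise_def\<close>)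
  then show "a + b = Suc s"
  proof
    assume *: "a \<noteq> 0 \<and> v (a - 1, b) \<noteq> 0"
    then have "a - 1 + b = s" using v by blast
    moreover have "a > 0" using * by blast
    ultimately show ?thesis by linarith
  next
    assume *: "b \<noteq> 0 \<and> v (a, b - 1) \<noteq> 0"
    then have "a + (b - 1) = s" using v by blast
    moreover have "b > 0" using * by blast
    ultimately show ?thesis by linarith
  qed
qed

lemma inner_prod_zero_right: "inner_prod I u (\<lambda>_. 0) = 0"
  by (simp add: inner_prod_def)

lemma sum_shift_zero_ends:
  fixes h :: "nat \<Rightarrow> 'a::comm_monoid_add"
  assumes "h 0 = 0" "h (Suc n) = 0"
  shows "(\<Sum>a\<le>n. h (Suc a)) = (\<Sum>a\<le>n. h a)"
  using sum.atMost_Suc_shift[of h n] assms by simp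

text \<open>Summation by parts in each index; the boundary terms carry \<open>ladder n 0\<close> or
  \<open>ladder n (Suc n)\<close>. The pairing is bilinear, without conjugation, so that it applies
  to kernels as well as to inner products.\<close>

lemma sum_lower_mult: "(\<Sum>p\<in>grid n. lower n f p * g p) = (\<Sum>p\<in>grid n. f p * raise n g p)"
proof -
  have 1: "(\<Sum>a\<le>n. \<Sum>b\<le>n. complex_of_real (ladder n (Suc a)) * f (Suc a, b) * g (a, b))
      = (\<Sum>a\<le>n. \<Sum>b\<le>n. complex_of_real (ladder n a) * f (a, b) * g (a - 1, b))"
    using sum_shift_zero_ends[of "\<lambda>a. \<Sum>b\<le>n. complex_of_real (ladder n a) * f (a, b) * g (a - 1, b)" n]
    by (simp add: ladder_Suc_n)
  have 2: "(\<Sum>a\<le>n. \<Sum>b\<le>n. complex_of_real (ladder n (Suc b)) * f (a, Suc b) * g (a, b))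
      = (\<Sum>a\<le>n. \<Sum>b\<le>n. complex_of_real (ladder n b) * f (a, b) * g (a, b - 1))"
    using sum_shift_zero_ends[of "\<lambda>b. complex_of_real (ladder n b) * f (a, b) * g (a, b - 1)" n for a]
    by (simp add: ladder_Suc_n)
  have "(\<Sum>p\<in>grid n. lower n f p * g p)
      = (\<Sum>a\<le>n. \<Sum>b\<le>n. complex_of_real (ladder n (Suc a)) * f (Suc a, b) * g (a, b))
      + (\<Sum>a\<le>n. \<Sum>b\<le>n. complex_of_real (ladder n (Suc b)) * f (a, Suc b) * g (a, b))"
    unfolding sum.cartesian_product' lower_def by (simp add: sum.distrib algebra_simps)
  also have "\<dots> = (\<Sum>p\<in>grid n. f p * raise n g p)"
    unfolding sum.cartesian_product' raise_def 1 2 by (simp add: sum.distrib algebra_simps)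
  finally show ?thesis .
qed

lemma inner_prod_raise: "inner_prod (grid n) (raise n f) g = inner_prod (grid n) f (lower n g)"
  using sum_lower_mult[of n g "\<lambda>x. cnj (f x)"]
  by (simp add: inner_prod_def raise_cnj mult.commute)

text \<open>The commutator [J_-, J_+] = -2 J_z on weight \<open>s\<close>. In coordinates the mixed
  terms agree and the diagonal ones differ by (a + 1)(n - a) - a (n + 1 - a) = n - 2 a, and likewise
  for b.\<close>

lemma lower_raise:
  assumes v: "v \<in> vecs (grid n)" and s: "has_weight s v"
  shows "lower n (raise n v) = (\<lambda>p. raise n (lower n v) p + complex_of_real (2 * real n - 2 * real s) * v p)"
proof
  fix p :: "nat \<times> nat"
  obtain a b where p: "p = (a, b)" by (cases p)
  show "lower n (raise n v) p = raise n (lower n v) p + complex_of_real (2 * real n - 2 * real s) * v p"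
  proof (cases "p \<in> grid n")
    case False
    then have zero: "f p = 0" if "f \<in> vecs (grid n)" for f :: pvec
      using that unfolding vecs_def by blast
    show ?thesis
      unfolding zero[OF v] zero[OF lower_in_vecs[OF raise_in_vecs[OF v]]]
        zero[OF raise_in_vecs[OF lower_in_vecs[OF v]]] by simp
  next
    case True
    then have le: "a \<le> n" "b \<le> n" by (auto simp: p)
    let ?l = "\<lambda>l. complex_of_real (ladder n l)"
    have sq: "?l l * (?l l * z) = complex_of_real (real l * (real n + 1 - real l)) * z" if "l \<le> Suc n" for l z
      using ladder_square[OF that] by (simp flip: of_real_mult mult.assoc)

    have e1: "lower n (raise n v) (a, b) = ?l (Suc a) * (?l (Suc a) * v (a, b)) + ?l (Suc b) * (?l (Suc b) * v (a, b))
        + ?l (Suc a) * ?l b * v (Suc a, b - 1) + ?l (Suc b) * ?l a * v (a - 1, Suc b)"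
      by (simp add: lower_def raise_def algebra_simps)
    have e2: "raise n (lower n v) (a, b) = ?l a * (?l a * v (a, b)) + ?l b * (?l b * v (a, b))
        + ?l (Suc a) * ?l b * v (Suc a, b - 1) + ?l (Suc b) * ?l a * v (a - 1, Suc b)"
      by (cases a; cases b) (simp_all add: lower_def raise_def algebra_simps)
    have "v (a, b) = 0 \<or> s = a + b" using s unfolding has_weight_def by blast
    moreover have "a \<le> Suc n" "b \<le> Suc n" "Suc a \<le> Suc n" "Suc b \<le> Suc n" using le by auto
    ultimately show ?thesis unfolding p e1 e2
      by (elim disjE) (simp_all only: sq, simp_all add: algebra_simps)
  qed
qed


subsection \<open>Lowest weight vectors\<close>

text \<open>Solution of the two-term recursion that annihilation by \<open>lower\<close> imposes
  along the line a + b = s, started with the value 1 at (0, s). For \<open>s \<le> n\<close> no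
  denominator vanishes on that line.\<close>

definition lowest_unnormalised :: "nat \<Rightarrow> nat \<Rightarrow> pvec" where
  "lowest_unnormalised n s = (\<lambda>(a, b). if a + b = s
     then \<Prod>i<a. - complex_of_real (ladder n (s - i) / ladder n (Suc i)) else 0)"

lemma lowest_unnormalised_props:
  assumes "s \<le> n"
  shows "lowest_unnormalised n s \<in> vecs (grid n)" "has_weight s (lowest_unnormalised n s)"
    "lower n (lowest_unnormalised n s) = (\<lambda>_. 0)" "lowest_unnormalised n s (0, s) = 1"
proof -
  show "lowest_unnormalised n s \<in> vecs (grid n)"
    using assms by (auto simp: vecs_def lowest_unnormalised_def)
  show "has_weight s (lowest_unnormalised n s)"
    by (auto simp: has_weight_def lowest_unnormalised_def)
  show "lowest_unnormalised n s (0, s) = 1" by (simp add: lowest_unnormalised_def)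
  have "lower n (lowest_unnormalised n s) (a, b) = 0" for a b
  proof (cases "Suc (a + b) = s")
    case True
    then have "s - a = Suc b" by simp
    moreover have "ladder n (Suc a) \<noteq> 0" using True assms by (intro ladder_nonzero) auto
    ultimately show ?thesis using True by (simp add: lower_def lowest_unnormalised_def)
  qed (simp add: lower_def lowest_unnormalised_def)
  then show "lower n (lowest_unnormalised n s) = (\<lambda>_. 0)" by auto
qed

text \<open>The same recursion propagates a zero at (0, s) along the whole weight line.\<close>

lemma lowest_weight_zero:
  assumes s: "s \<le> n" and u: "u \<in> vecs (grid n)" "has_weight s u" "lower n u = (\<lambda>_. 0)" and 0: "u (0, s) = 0"
  shows "u = (\<lambda>_. 0)"
proof -
  have "a + b = s \<Longrightarrow> u (a, b) = 0" for a b
  proof (induction a arbitrary: b)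
    case (Suc a)
    then have "u (a, Suc b) = 0" by simp
    moreover have "lower n u (a, b) = 0" using u(3) by simp
    moreover have "ladder n (Suc a) \<noteq> 0" using Suc.prems s by (intro ladder_nonzero) auto
    ultimately show ?case by (simp add: lower_def)
  qed (use 0 in simp)
  then have "u p = 0" for p
    using u(2) unfolding has_weight_def by (cases p) blast
  then show ?thesis by (intro ext)
qed

definition lowest :: "nat \<Rightarrow> nat \<Rightarrow> pvec" where
  "lowest n s = (\<lambda>p. complex_of_real
     (1 / sqrt (\<Sum>p\<in>grid n. (cmod (lowest_unnormalised n s p))\<^sup>2)) * lowest_unnormalised n s p)"

lemma lowest_props:
  assumes s: "s \<le> n"
  shows "lowest n s \<in> vecs (grid n)" "has_weight s (lowest n s)"
    "lower n (lowest n s) = (\<lambda>_. 0)" "lowest n s (0, s) \<noteq> 0"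
    "inner_prod (grid n) (lowest n s) (lowest n s) = 1"
proof -
  note u = lowest_unnormalised_props[OF s]
  define q where "q = (\<Sum>p\<in>grid n. (cmod (lowest_unnormalised n s p))\<^sup>2)"
  have "(cmod (lowest_unnormalised n s (0, s)))\<^sup>2 \<le> q"
    unfolding q_def using s by (intro member_le_sum) auto
  then have q: "q > 0" using u(4) by simp
  have l: "lowest n s = (\<lambda>p. complex_of_real (1 / sqrt q) * lowest_unnormalised n s p)"
    by (simp add: lowest_def q_def)
  show "lowest n s \<in> vecs (grid n)" "has_weight s (lowest n s)"
    using u(1,2) by (auto simp: l vecs_def has_weight_def)
  show "lower n (lowest n s) = (\<lambda>_. 0)" unfolding l lower_scale u(3) by simp
  show "lowest n s (0, s) \<noteq> 0" using q u(4) by (simp add: l)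
  have "inner_prod (grid n) (lowest n s) (lowest n s) = complex_of_real (1 / sqrt q * (1 / sqrt q) * q)"
    unfolding l inner_prod_scale_left inner_prod_scale_right inner_prod_self[of _ "lowest_unnormalised n s"]
      q_def[symmetric] of_real_mult complex_cnj_complex_of_real mult.assoc ..
  also have "1 / sqrt q * (1 / sqrt q) * q = 1" using q by (simp add: field_simps)
  finally show "inner_prod (grid n) (lowest n s) (lowest n s) = 1" by simp
qed

text \<open>Subtracting the multiple of \<open>lowest n s\<close> with the same entry at (0, s)
  leaves a lowest weight vector that vanishes there.\<close>

lemma lowest_weight_unique:
  assumes s: "s \<le> n" and u: "u \<in> vecs (grid n)" "has_weight s u" "lower n u = (\<lambda>_. 0)"
  obtains c where "u = (\<lambda>p. c * lowest n s p)"
proof -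
  note l = lowest_props[OF s]
  define c where "c = u (0, s) / lowest n s (0, s)"
  define d where "d = (\<lambda>p. u p - c * lowest n s p)"
  have "d = (\<lambda>_. 0)"
  proof (rule lowest_weight_zero[OF s])
    show "d \<in> vecs (grid n)" using u(1) l(1) by (auto simp: d_def vecs_def)
    show "has_weight s d" unfolding d_def has_weight_def
    proof (intro allI impI)
      fix a b assume "u (a, b) - c * lowest n s (a, b) \<noteq> 0"
      then have "u (a, b) \<noteq> 0 \<or> lowest n s (a, b) \<noteq> 0" by auto
      then show "a + b = s" using u(2) l(2) unfolding has_weight_def by blast
    qed
    show "lower n d = (\<lambda>_. 0)" unfolding d_def lower_diff lower_scale u(3) l(3) by simp
    show "d (0, s) = 0" using l(4) by (simp add: d_def c_def)
  qed
  then have "u = (\<lambda>p. c * lowest n s p)" by (simp add: d_def fun_eq_iff)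
  then show thesis by (rule that)
qed


subsection \<open>The Clebsch-Gordan basis\<close>

text \<open>The component of spin \<open>J = n - s\<close> is spanned by \<open>tower n s k\<close>, \<open>k = 0, \<dots>, 2J\<close>.\<close>

definition tower :: "nat \<Rightarrow> nat \<Rightarrow> nat \<Rightarrow> pvec" where
  "tower n s k = (raise n ^^ k) (lowest n s)"

text \<open>Eigenvalue of J_- J_+ on step k of the tower: (k + 1)(2 J - k) with J = n - s. Its zero
  at k = 2 J ends the tower.\<close>

definition tower_coeff :: "nat \<Rightarrow> nat \<Rightarrow> nat \<Rightarrow> real" where
  "tower_coeff n s k = (real k + 1) * (2 * (real n - real s) - real k)"

lemma tower_0 [simp]: "tower n s 0 = lowest n s" and tower_Suc: "tower n s (Suc k) = raise n (tower n s k)"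
  by (simp_all add: tower_def)

lemma tower_in_vecs: "s \<le> n \<Longrightarrow> tower n s k \<in> vecs (grid n)"
  by (induction k) (simp_all add: tower_Suc raise_in_vecs lowest_props)

lemma tower_weight: "s \<le> n \<Longrightarrow> has_weight (s + k) (tower n s k)"
  by (induction k) (simp_all add: tower_Suc raise_weight lowest_props)

text \<open>Each use of the commutator adds 2 n - 2 (s + i); the sum over i from 0 to k is
  \<open>tower_coeff n s k\<close>.\<close>

lemma lower_tower_Suc:
  assumes "s \<le> n"
  shows "lower n (tower n s (Suc k)) = (\<lambda>p. complex_of_real (tower_coeff n s k) * tower n s k p)"
proof (induction k)
  case 0
  show ?case
    unfolding tower_Suc lower_raise[OF tower_in_vecs tower_weight, OF assms assms]
    by (simp add: lowest_props[OF assms] tower_coeff_def raise_def fun_eq_iff)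
next
  case (Suc k)
  have "lower n (tower n s (Suc (Suc k))) = lower n (raise n (tower n s (Suc k)))"
    by (simp only: tower_Suc)
  also have "\<dots> = (\<lambda>p. raise n (lower n (tower n s (Suc k))) p
      + complex_of_real (2 * real n - 2 * real (s + Suc k)) * tower n s (Suc k) p)"
    by (rule lower_raise[OF tower_in_vecs[OF assms] tower_weight[OF assms]])
  also have "\<dots> = (\<lambda>p. complex_of_real (tower_coeff n s k) * tower n s (Suc k) p
      + complex_of_real (2 * real n - 2 * real (s + Suc k)) * tower n s (Suc k) p)"
    unfolding Suc raise_scale by (simp only: tower_Suc)
  also have "\<dots> = (\<lambda>p. complex_of_real (tower_coeff n s (Suc k)) * tower n s (Suc k) p)"
    unfolding distrib_right[symmetric] of_real_add[symmetric]
    by (simp add: tower_coeff_def algebra_simps)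
  finally show ?case .
qed

text \<open>Raising operators are moved across the inner product one at a time; the shorter tower is
  lowered to its bottom and then killed.\<close>

lemma tower_orthogonal_less:
  assumes "s \<le> n" "t \<le> n" "l < k"
  shows "inner_prod (grid n) (tower n s k) (tower n t l) = 0"
  using \<open>l < k\<close>
proof (induction l arbitrary: k)
  case 0
  then obtain k' where "k = Suc k'" by (cases k) auto
  then show ?case
    using lowest_props(3)[OF assms(2)] by (simp add: tower_Suc inner_prod_raise inner_prod_zero_right)
next
  case (Suc l)
  then obtain k' where "k = Suc k'" by (cases k) auto
  then show ?case
    using Suc by (simp add: tower_Suc[of n s] inner_prod_raise lower_tower_Suc[OF assms(2)]
        inner_prod_scale_right)
qed

lemma inner_prod_weight_neq:
  assumes "has_weight s u" "has_weight t v" "s \<noteq> t"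
  shows "inner_prod I u v = 0"
proof -
  have "u x = 0 \<or> v x = 0" for x
  proof (cases x)
    case (Pair a b)
    then show ?thesis using assms unfolding has_weight_def by blast
  qed
  then show ?thesis unfolding inner_prod_def by (intro sum.neutral) auto
qed

lemma tower_orthogonal:
  assumes "s \<le> n" "t \<le> n" "(s, k) \<noteq> (t, l)"
  shows "inner_prod (grid n) (tower n s k) (tower n t l) = 0"
proof (cases k l rule: linorder_cases)
  case less
  then show ?thesis
    using tower_orthogonal_less[OF assms(2,1)] cnj_inner_prod[of "grid n" "tower n t l" "tower n s k"] by simp
next
  \<comment> \<open>Equal heights force different \<open>s\<close>, hence different weights.\<close>
  case equal
  then show ?thesis
    using assms by (intro inner_prod_weight_neq[OF tower_weight tower_weight]) auto
next
  case greater
  then show ?thesis using tower_orthogonal_less[OF assms(1,2)] by simp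
qed

definition tower_norm :: "nat \<Rightarrow> nat \<Rightarrow> nat \<Rightarrow> real" where
  "tower_norm n s k = (\<Prod>i<k. tower_coeff n s i)"

lemma tower_norm_Suc: "tower_norm n s (Suc k) = tower_coeff n s k * tower_norm n s k"
  by (simp add: tower_norm_def mult.commute)

lemma inner_prod_tower:
  assumes "s \<le> n"
  shows "inner_prod (grid n) (tower n s k) (tower n s k) = complex_of_real (tower_norm n s k)"
proof (induction k)
  case (Suc k)
  have "inner_prod (grid n) (tower n s (Suc k)) (tower n s (Suc k))
      = inner_prod (grid n) (tower n s k) (lower n (tower n s (Suc k)))"
    by (simp add: tower_Suc inner_prod_raise)
  then show ?case
    by (simp add: lower_tower_Suc[OF assms] inner_prod_scale_right Suc tower_norm_Suc)
qed (simp add: lowest_props[OF assms] tower_norm_def)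

lemma tower_coeff_pos: "s \<le> n \<Longrightarrow> k < 2 * (n - s) \<Longrightarrow> tower_coeff n s k > 0"
  and tower_coeff_top: "s \<le> n \<Longrightarrow> tower_coeff n s (2 * (n - s)) = 0"
  unfolding tower_coeff_def by (auto simp: of_nat_diff)

lemma tower_norm_pos: "s \<le> n \<Longrightarrow> k \<le> 2 * (n - s) \<Longrightarrow> tower_norm n s k > 0"
  unfolding tower_norm_def by (intro prod_pos) (auto intro: tower_coeff_pos)


text \<open>Clebsch-Gordan vectors: the label (s, k) is spin J = n - s at weight s + k.
  \<open>tower_norm\<close> is a squared norm, hence the square root.\<close>

definition cg :: "nat \<Rightarrow> nat \<times> nat \<Rightarrow> pvec" where
  "cg n = (\<lambda>(s, k) p. complex_of_real (1 / sqrt (tower_norm n s k)) * tower n s k p)"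

definition cg_index :: "nat \<Rightarrow> (nat \<times> nat) set" where
  "cg_index n = (SIGMA s:{..n}. {..2 * (n - s)})"

lemma finite_cg_index: "finite (cg_index n)"
  by (simp add: cg_index_def)

text \<open>The odd numbers 2 J + 1 for J = 0, ..., n add up to (n + 1)^2. This dimension count is
  what makes the towers a complete basis.\<close>

lemma card_cg_index: "card (cg_index n) = card (grid n)"
proof -
  have "card (cg_index n) = (\<Sum>s\<le>n. Suc (2 * (n - s)))" by (simp add: cg_index_def)
  also have "\<dots> = (\<Sum>s\<le>n. Suc (2 * s))"
    by (rule sum.reindex_bij_witness[where i = "\<lambda>s. n - s" and j = "\<lambda>s. n - s"]) auto
  also have "\<dots> = Suc n * Suc n" by (induction n) auto
  finally show ?thesis by simp
qed

lemma cg_orthonormal: "orthonormal_family (grid n) (cg_index n) (cg n)"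
  unfolding orthonormal_family_def
proof (intro conjI ballI)
  fix x assume x: "x \<in> cg_index n"
  obtain s k where xe: "x = (s, k)" by (cases x)
  have s: "s \<le> n" "k \<le> 2 * (n - s)" using x by (auto simp: xe cg_index_def)
  show "cg n x \<in> vecs (grid n)" using tower_in_vecs[OF s(1), of k] by (auto simp: xe cg_def vecs_def)
  fix y assume y: "y \<in> cg_index n"
  obtain t l where ye: "y = (t, l)" by (cases y)
  have t: "t \<le> n" "l \<le> 2 * (n - t)" using y by (auto simp: ye cg_index_def)
  show "inner_prod (grid n) (cg n x) (cg n y) = (if x = y then 1 else 0)"
  proof (cases "x = y")
    case True
    define q where "q = tower_norm n s k"
    have q: "q > 0" using tower_norm_pos[OF s] by (simp add: q_def)
    have "inner_prod (grid n) (cg n x) (cg n y) = complex_of_real (1 / sqrt q * (1 / sqrt q) * q)"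
      unfolding True[symmetric] xe cg_def prod.case inner_prod_scale_left inner_prod_scale_right
        inner_prod_tower[OF s(1)] q_def[symmetric] of_real_mult complex_cnj_complex_of_real mult.assoc ..
    also have "1 / sqrt q * (1 / sqrt q) * q = 1" using q by (simp add: field_simps)
    finally show ?thesis using True by simp
  next
    case False
    then show ?thesis
      using tower_orthogonal[OF s(1) t(1), of k l]
      unfolding xe ye cg_def prod.case inner_prod_scale_left inner_prod_scale_right by simp
  qed
qed

lemma cg_in_vecs: "s \<le> n \<Longrightarrow> k \<le> 2 * (n - s) \<Longrightarrow> cg n (s, k) \<in> vecs (grid n)"
  using bspec[OF conjunct1[OF cg_orthonormal[unfolded orthonormal_family_def]], of "(s, k)"]
  by (simp add: cg_index_def)

lemma inner_prod_cg:
  assumes "s \<le> n" "t \<le> n" "k \<le> 2 * (n - s)" "l \<le> 2 * (n - t)"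
  shows "inner_prod (grid n) (cg n (s, k)) (cg n (t, l)) = (if s = t \<and> k = l then 1 else 0)"
  using cg_orthonormal[unfolded orthonormal_family_def, THEN conjunct2, rule_format, of "(s, k)" n "(t, l)"]
    assms by (simp add: cg_index_def)

lemma raise_cg:
  assumes s: "s \<le> n" and k: "k \<le> 2 * (n - s)"
  shows "raise n (cg n (s, k)) p = complex_of_real (sqrt (tower_coeff n s k)) * cg n (s, Suc k) p"
proof (cases "k = 2 * (n - s)")
  case True
  \<comment> \<open>At the top the next vector has squared norm 0, so both sides vanish.\<close>
  have "inner_prod (grid n) (tower n s (Suc k)) (tower n s (Suc k)) = 0"
    unfolding inner_prod_tower[OF s] tower_norm_Suc True tower_coeff_top[OF s] by simp
  then have "tower n s (Suc k) = (\<lambda>_. 0)"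
    using inner_prod_self_eq_0_iff[OF _ tower_in_vecs[OF s]] by simp
  then show ?thesis
    unfolding cg_def prod.case raise_scale tower_Suc[symmetric] by simp
next
  case False
  then have "tower_coeff n s k > 0" "tower_norm n s k > 0"
    using k tower_coeff_pos[OF s] tower_norm_pos[OF s] by auto
  then have "1 / sqrt (tower_norm n s k) = sqrt (tower_coeff n s k) * (1 / sqrt (tower_norm n s (Suc k)))"
    by (simp add: tower_norm_Suc real_sqrt_mult)
  then show ?thesis
    unfolding cg_def prod.case raise_scale tower_Suc[symmetric]
    by (metis mult.assoc of_real_mult)
qed

lemma lower_cg_0: "s \<le> n \<Longrightarrow> lower n (cg n (s, 0)) p = 0"
  unfolding cg_def prod.case lower_scale by (simp add: lowest_props)

lemma lower_cg_Suc:
  assumes s: "s \<le> n" and k: "k < 2 * (n - s)"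
  shows "lower n (cg n (s, Suc k)) p = complex_of_real (sqrt (tower_coeff n s k)) * cg n (s, k) p"
proof -
  define q where "q = tower_coeff n s k"
  have q: "q > 0" "tower_norm n s k > 0"
    using k tower_coeff_pos[OF s] tower_norm_pos[OF s] by (auto simp: q_def)
  have "1 / sqrt (tower_norm n s (Suc k)) * q = sqrt q * (1 / sqrt (tower_norm n s k))"
    using q unfolding tower_norm_Suc q_def[symmetric] real_sqrt_mult
    by (simp add: field_simps)
  then show ?thesis
    unfolding cg_def prod.case lower_scale lower_tower_Suc[OF s] q_def[symmetric]
    by (metis mult.assoc of_real_mult)
qed

lemma cg_weight: "s \<le> n \<Longrightarrow> has_weight (s + k) (cg n (s, k))"
  using tower_weight[of s n k] unfolding has_weight_def cg_def by simp


subsection \<open>The commutant\<close>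

type_synonym kernel = "nat \<times> nat \<Rightarrow> nat \<times> nat \<Rightarrow> complex"

text \<open>\<open>N\<close> is supported on the grid and commutes with J_z, J_+ and J_-.
  Multiplying by J_+ on the right acts on a row of \<open>N\<close> by the transpose, which is
  \<open>lower\<close>; this is why raising one index equals lowering the other.\<close>

definition intertwiner :: "nat \<Rightarrow> kernel \<Rightarrow> bool" where
  "intertwiner n N \<longleftrightarrow>
     (\<forall>a c. N a c \<noteq> 0 \<longrightarrow> a \<in> grid n \<and> c \<in> grid n \<and> fst a + snd a = fst c + snd c) \<and>
     (\<forall>a c. raise n (\<lambda>a. N a c) a = lower n (N a) c) \<and>
     (\<forall>a c. lower n (\<lambda>a. N a c) a = raise n (N a) c)"

definition cg_proj :: "nat \<Rightarrow> nat \<Rightarrow> kernel" where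
  "cg_proj n s = (\<lambda>a c. \<Sum>k\<le>2 * (n - s). cg n (s, k) a * cnj (cg n (s, k) c))"

lemma cg_proj_cnj: "cnj (cg_proj n s a c) = cg_proj n s c a"
  by (simp add: cg_proj_def mult.commute)

text \<open>Raising the first index climbs the tower, lowering the second descends it with the same
  coefficients, and the two sums agree after an index shift whose end terms are 0. The other
  relation is the conjugate transpose of this one.\<close>

lemma cg_proj_intertwiner:
  assumes s: "s \<le> n"
  shows "intertwiner n (cg_proj n s)"
proof -
  note on = cg_in_vecs[OF s]
  have "a \<in> grid n \<and> c \<in> grid n \<and> fst a + snd a = fst c + snd c" if nz: "cg_proj n s a c \<noteq> 0" for a c
  proof -
    obtain k where k: "k \<le> 2 * (n - s)" "cg n (s, k) a * cnj (cg n (s, k) c) \<noteq> 0"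
    proof (rule sum.not_neutral_contains_not_neutral[OF nz[unfolded cg_proj_def]])
      fix k assume "k \<in> {..2 * (n - s)}" "cg n (s, k) a * cnj (cg n (s, k) c) \<noteq> 0"
      then show thesis by (intro that) simp_all
    qed
    then have "cg n (s, k) a \<noteq> 0" "cg n (s, k) c \<noteq> 0" by auto
    moreover have "p \<in> grid n" if "cg n (s, k) p \<noteq> 0" for p
      using on[OF k(1)] that unfolding vecs_def by blast
    ultimately have "a \<in> grid n" "c \<in> grid n" by blast+
    moreover have "fst a + snd a = fst c + snd c"
    proof -
      have "fst p + snd p = s + k" if "cg n (s, k) p \<noteq> 0" for p
        using cg_weight[OF s, of k] that unfolding has_weight_def by (cases p) simp
      then show ?thesis
        using \<open>cg n (s, k) a \<noteq> 0\<close> \<open>cg n (s, k) c \<noteq> 0\<close> by simp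
    qed
    ultimately show ?thesis by simp
  qed
  moreover have RL: "raise n (\<lambda>a. cg_proj n s a c) a = lower n (cg_proj n s a) c" for a c
  proof -
    define g where "g = (\<lambda>k. complex_of_real (sqrt (tower_coeff n s k)) * (cg n (s, Suc k) a * cnj (cg n (s, k) c)))"
    have "raise n (\<lambda>a. cg_proj n s a c) a = (\<Sum>k\<le>2 * (n - s). g k)"
      unfolding cg_proj_def raise_sum
      by (intro sum.cong refl) (simp add: raise_cg[OF s] g_def)
    also have "\<dots> = (\<Sum>k<2 * (n - s). g k)"
      by (simp add: g_def tower_coeff_top[OF s] lessThan_Suc_atMost[symmetric])
    also have "\<dots> = (\<Sum>k\<le>2 * (n - s). cnj (lower n (cg n (s, k)) c) * cg n (s, k) a)"
    proof (cases "2 * (n - s)")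
      case 0
      then show ?thesis by (simp add: lower_cg_0[OF s])
    next
      case (Suc j)
      show ?thesis
        unfolding Suc sum.atMost_Suc_shift lessThan_Suc_atMost lower_cg_0[OF s]
        using Suc by (auto intro!: sum.cong simp: lower_cg_Suc[OF s] g_def)
    qed
    also have "\<dots> = lower n (\<lambda>c. \<Sum>k\<le>2 * (n - s). cnj (cg n (s, k) c) * cg n (s, k) a) c"
      unfolding lower_sum lower_cnj ..
    also have "\<dots> = lower n (cg_proj n s a) c"
      by (simp add: cg_proj_def[abs_def] mult.commute)
    finally show ?thesis .
  qed
  moreover have "lower n (\<lambda>a. cg_proj n s a c) a = raise n (cg_proj n s a) c" for a c
  proof -
    have "lower n (\<lambda>a. cg_proj n s a c) a = cnj (lower n (cg_proj n s c) a)"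
      unfolding lower_cnj[symmetric] cg_proj_cnj ..
    also have "\<dots> = raise n (cg_proj n s a) c"
      unfolding RL[symmetric] raise_cnj[symmetric] cg_proj_cnj ..
    finally show ?thesis .
  qed
  ultimately show ?thesis unfolding intertwiner_def by blast
qed

text \<open>Schur's lemma for the multiplicity-free representation: an intertwiner preserves the space of
  lowest weight vectors of each weight, which is a line, and is determined by its values there.\<close>

lemma intertwiner_expand:
  assumes N: "intertwiner n N"
  obtains x where "\<And>a c. N a c = (\<Sum>s\<le>n. x s * cg_proj n s a c)"
proof -
  have supp: "N a c \<noteq> 0 \<Longrightarrow> a \<in> grid n \<and> c \<in> grid n \<and> fst a + snd a = fst c + snd c" for a c
    using N unfolding intertwiner_def by blast
  have RL: "raise n (\<lambda>a. N a c) a = lower n (N a) c" and LR: "lower n (\<lambda>a. N a c) a = raise n (N a) c" for a c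
    using N unfolding intertwiner_def by blast+
  \<comment> \<open>The operator with kernel \<open>N\<close>; the two relations make it commute
    with raising and lowering.\<close>
  define ap where "ap = (\<lambda>v a. \<Sum>c\<in>grid n. N a c * v c)"
  have ap_raise: "ap (raise n v) = raise n (ap v)" for v
  proof
    fix a
    have "raise n (ap v) a = (\<Sum>c\<in>grid n. lower n (N a) c * v c)"
      unfolding ap_def raise_sum RL ..
    then show "ap (raise n v) a = raise n (ap v) a" unfolding sum_lower_mult ap_def by simp
  qed
  have ap_lower: "ap (lower n v) = lower n (ap v)" for v
  proof
    fix a
    have "lower n (ap v) a = (\<Sum>c\<in>grid n. v c * raise n (N a) c)"
      unfolding ap_def lower_sum LR by (simp add: mult.commute)
    then show "ap (lower n v) a = lower n (ap v) a"
      unfolding sum_lower_mult[symmetric] ap_def by (simp add: mult.commute)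
  qed
  have ap_scale: "ap (\<lambda>p. c * v p) = (\<lambda>p. c * ap v p)" for c v
    by (simp add: ap_def sum_distrib_left mult_ac)
  have "\<exists>c. ap (lowest n s) = (\<lambda>p. c * lowest n s p)" if s: "s \<le> n" for s
  proof -
    have "ap (lowest n s) \<in> vecs (grid n)"
      using supp by (force simp: ap_def vecs_def intro!: sum.neutral)
    moreover have "has_weight s (ap (lowest n s))"
      unfolding has_weight_def ap_def
    proof (intro allI impI)
      fix a b assume "(\<Sum>c\<in>grid n. N (a, b) c * lowest n s c) \<noteq> 0"
      then obtain c where "N (a, b) c * lowest n s c \<noteq> 0"
        by (rule sum.not_neutral_contains_not_neutral)
      then show "a + b = s"
        using supp[of "(a, b)" c] lowest_props(2)[OF s] unfolding has_weight_def
        by (cases c) simp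
    qed
    moreover have "lower n (ap (lowest n s)) = (\<lambda>_. 0)"
      unfolding ap_lower[symmetric] lowest_props(3)[OF s] by (simp add: ap_def)
    ultimately show ?thesis using lowest_weight_unique[OF s] by metis
  qed
  then obtain x where x: "\<And>s. s \<le> n \<Longrightarrow> ap (lowest n s) = (\<lambda>p. x s * lowest n s p)" by metis
  \<comment> \<open>The scalar on the lowest vector is carried up the whole tower by commutation
    with \<open>raise\<close>.\<close>
  have ap_tower: "ap (tower n s k) = (\<lambda>p. x s * tower n s k p)" if "s \<le> n" for s k
    by (induction k) (simp_all add: x that tower_Suc ap_raise raise_scale)
  have cg: "ap (cg n (s, k)) a = x s * cg n (s, k) a" if "s \<le> n" for s k a
    unfolding cg_def prod.case ap_scale ap_tower[OF that] by simp
  have "N a c = (\<Sum>s\<le>n. x s * cg_proj n s a c)" for a c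
  proof (cases "c \<in> grid n")
    case True
    \<comment> \<open>Completeness of the coupled basis recovers the kernel from its action on that
      basis.\<close>
    have "N a c = (\<Sum>c'\<in>grid n. if c' = c then N a c' else 0)" using True by simp
    also have "\<dots> = (\<Sum>c'\<in>grid n. N a c' * (\<Sum>p\<in>cg_index n. cg n p c' * cnj (cg n p c)))"
      using orthonormal_complete[OF _ finite_cg_index cg_orthonormal card_cg_index True]
      by (intro sum.cong refl) simp
    also have "\<dots> = (\<Sum>p\<in>cg_index n. ap (cg n p) a * cnj (cg n p c))"
      unfolding ap_def sum_distrib_left sum_distrib_right
      by (subst sum.swap) (simp add: mult.assoc)
    also have "\<dots> = (\<Sum>s\<le>n. \<Sum>k\<le>2 * (n - s). ap (cg n (s, k)) a * cnj (cg n (s, k) c))"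
      unfolding cg_index_def by (subst sum.Sigma) (auto simp: case_prod_beta)
    also have "\<dots> = (\<Sum>s\<le>n. x s * cg_proj n s a c)"
      unfolding cg_proj_def sum_distrib_left by (intro sum.cong refl) (simp add: cg mult.assoc)
    finally show ?thesis .
  next
    case False
    then have "N a c = 0" using supp by blast
    moreover have "cg_proj n s a c = 0" if "s \<le> n" for s
      using cg_proj_intertwiner[OF that] False unfolding intertwiner_def by blast
    ultimately show ?thesis by simp
  qed
  then show thesis by (rule that)
qed

text \<open>Orthogonal idempotents, written out: by orthonormality of the coupled basis only
  \<open>s = t\<close> and \<open>k = l\<close> survive.\<close>

lemma sum_cg_proj_mult:
  assumes "s \<le> n" "t \<le> n"
  shows "(\<Sum>c\<in>grid n. cg_proj n s a c * cnj (cg_proj n t b c)) = (if s = t then cg_proj n s a b else 0)"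
proof -
  note ip = inner_prod_cg[OF assms]
  have "(\<Sum>c\<in>grid n. cg_proj n s a c * cnj (cg_proj n t b c))
     = (\<Sum>c\<in>grid n. \<Sum>k\<le>2 * (n - s). \<Sum>l\<le>2 * (n - t).
         cg n (s, k) a * cnj (cg n (t, l) b) * (cnj (cg n (s, k) c) * cg n (t, l) c))"
    unfolding cg_proj_def cnj_sum sum_product by (intro sum.cong refl) (simp add: mult_ac)
  also have "\<dots> = (\<Sum>k\<le>2 * (n - s). \<Sum>l\<le>2 * (n - t).
         cg n (s, k) a * cnj (cg n (t, l) b) * inner_prod (grid n) (cg n (s, k)) (cg n (t, l)))"
    unfolding inner_prod_def sum_distrib_left
    by (subst sum.swap, intro sum.cong refl, subst sum.swap) (rule refl)
  also have "\<dots> = (\<Sum>k\<le>2 * (n - s). \<Sum>l\<le>2 * (n - t).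
         if k = l then (if s = t then cg n (s, k) a * cnj (cg n (t, k) b) else 0) else 0)"
    by (intro sum.cong refl) (auto simp: ip)
  also have "\<dots> = (if s = t then cg_proj n s a b else 0)"
    by (cases "s = t") (auto simp: cg_proj_def cong: if_cong)
  finally show ?thesis .
qed

lemma sum_cg_proj_diag:
  assumes "s \<le> n"
  shows "(\<Sum>a\<in>grid n. cg_proj n s a a) = of_nat (2 * (n - s) + 1)"
proof -
  have "inner_prod (grid n) (cg n (s, k)) (cg n (s, k)) = 1" if "k \<le> 2 * (n - s)" for k
    using inner_prod_cg[OF assms assms that that] by simp
  then show ?thesis
    unfolding cg_proj_def inner_prod_def by (subst sum.swap) (simp add: mult.commute)
qed

section \<open>Infinitesimal characterisation of the invariant tensors\<close>

text \<open>The parameter is complex so that complex derivatives apply; real values give elements of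
  \<open>SU2\<close>.\<close>

definition rot :: "complex \<Rightarrow> complex^2^2" where
  "rot t = (\<chi> i j. if i = j then cos t else if i = 1 then sin t else - sin t)"

definition phase :: "complex \<Rightarrow> complex^2^2" where
  "phase \<alpha> = (\<chi> i j. if i = j then (if i = 1 then \<alpha> else cnj \<alpha>) else 0)"

lemma rot_nth: "rot t $ 1 $ 1 = cos t" "rot t $ 1 $ 2 = sin t" "rot t $ 2 $ 1 = - sin t" "rot t $ 2 $ 2 = cos t"
  by (simp_all add: rot_def)

lemma phase_nth: "phase \<alpha> $ 1 $ 1 = \<alpha>" "phase \<alpha> $ 1 $ 2 = 0" "phase \<alpha> $ 2 $ 1 = 0" "phase \<alpha> $ 2 $ 2 = cnj \<alpha>"
  by (simp_all add: phase_def)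

lemma matrix_mult_2_nth:
  fixes A B :: "complex^2^2"
  shows "(A ** B) $ i $ j = A $ i $ 1 * B $ 1 $ j + A $ i $ 2 * B $ 2 $ j"
  by (simp add: matrix_matrix_mult_def sum_2)

lemma mat_1_2_nth: "(mat 1 :: complex^2^2) $ 1 $ 1 = 1" "(mat 1 :: complex^2^2) $ 1 $ 2 = 0"
  "(mat 1 :: complex^2^2) $ 2 $ 1 = 0" "(mat 1 :: complex^2^2) $ 2 $ 2 = 1"
  by (simp_all add: mat_def)

lemma matrix_2_eqI:
  assumes "(A :: complex^2^2) $ 1 $ 1 = B $ 1 $ 1" "A $ 1 $ 2 = B $ 1 $ 2"
    "A $ 2 $ 1 = B $ 2 $ 1" "A $ 2 $ 2 = B $ 2 $ 2"
  shows "A = B"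
  using assms by (simp add: vec_eq_iff forall_2)

lemma SU2_iff:
  "g \<in> SU2 \<longleftrightarrow> g $ 2 $ 1 = - cnj (g $ 1 $ 2) \<and> g $ 2 $ 2 = cnj (g $ 1 $ 1) \<and>
     g $ 1 $ 1 * cnj (g $ 1 $ 1) + g $ 1 $ 2 * cnj (g $ 1 $ 2) = 1"
proof -
  define a b c d where "a = g $ 1 $ 1" and "b = g $ 1 $ 2" and "c = g $ 2 $ 1" and "d = g $ 2 $ 2"
  have "g \<in> SU2 \<longleftrightarrow> a * cnj a + b * cnj b = 1 \<and> a * cnj c + b * cnj d = 0 \<and>
      c * cnj a + d * cnj b = 0 \<and> c * cnj c + d * cnj d = 1 \<and> a * d - b * c = 1"
    unfolding SU2_def mem_Collect_eq det_2 vec_eq_iff forall_2 matrix_mult_2_nth mat_1_2_nth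
    by (simp add: a_def b_def c_def d_def conj_assoc)
  also have "\<dots> \<longleftrightarrow> c = - cnj b \<and> d = cnj a \<and> a * cnj a + b * cnj b = 1"
  proof
    assume h: "a * cnj a + b * cnj b = 1 \<and> a * cnj c + b * cnj d = 0 \<and>
      c * cnj a + d * cnj b = 0 \<and> c * cnj c + d * cnj d = 1 \<and> a * d - b * c = 1"
    then have 1: "a * cnj a + b * cnj b = 1" and 2: "c * cnj a + d * cnj b = 0" and 3: "a * d - b * c = 1"
      by auto
    \<comment> \<open>Multiples of two unitarity relations are combined so that the determinant
      appears.\<close>
    have "c = c * (a * cnj a + b * cnj b) - a * (c * cnj a + d * cnj b)" by (simp add: 1 2)
    also have "\<dots> = - cnj b * (a * d - b * c)" by (simp add: algebra_simps)
    finally have c: "c = - cnj b" by (simp add: 3)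
    have "d = d * (a * cnj a + b * cnj b) - b * (c * cnj a + d * cnj b)" by (simp add: 1 2)
    also have "\<dots> = cnj a * (a * d - b * c)" by (simp add: algebra_simps)
    finally have "d = cnj a" by (simp add: 3)
    then show "c = - cnj b \<and> d = cnj a \<and> a * cnj a + b * cnj b = 1" using c 1 by blast
  next
    assume h: "c = - cnj b \<and> d = cnj a \<and> a * cnj a + b * cnj b = 1"
    then have "c = - cnj b" "d = cnj a" "a * cnj a + b * cnj b = 1" by auto
    then show "a * cnj a + b * cnj b = 1 \<and> a * cnj c + b * cnj d = 0 \<and>
      c * cnj a + d * cnj b = 0 \<and> c * cnj c + d * cnj d = 1 \<and> a * d - b * c = 1"
      by (simp add: algebra_simps)
  qed
  finally show ?thesis by (simp add: a_def b_def c_def d_def)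
qed

lemma rot_in_SU2: "rot (complex_of_real t) \<in> SU2"
proof -
  have "cos (complex_of_real t) * cos (complex_of_real t) + sin (complex_of_real t) * sin (complex_of_real t) = 1"
    using sin_cos_squared_add[of "complex_of_real t"] by (simp add: power2_eq_square add.commute)
  then show ?thesis by (simp add: SU2_iff rot_nth cnj_cos cnj_sin)
qed

lemma phase_in_SU2: "phase (cis t) \<in> SU2"
  by (simp add: SU2_iff phase_nth cis_cnj cis_mult)

text \<open>Reduces invariance under the group to two one-parameter families. The moduli of the
  first row determine \<open>t\<close>; the sum and the difference of \<open>p\<close> and
  \<open>q\<close> are the arguments of its entries.\<close>

lemma SU2_euler:
  assumes "g \<in> SU2"
  obtains p t q where "g = phase (cis p) ** rot (complex_of_real t) ** phase (cis q)"
proof -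
  define a b where "a = g $ 1 $ 1" and "b = g $ 1 $ 2"
  have ab: "a * cnj a + b * cnj b = 1" and g2: "g $ 2 $ 1 = - cnj b" "g $ 2 $ 2 = cnj a"
    using assms unfolding SU2_iff a_def b_def by auto
  have "complex_of_real ((cmod a)\<^sup>2 + (cmod b)\<^sup>2) = complex_of_real 1"
    using ab unfolding of_real_add complex_norm_square by simp
  then have "(cmod a)\<^sup>2 + (cmod b)\<^sup>2 = 1" by (simp only: of_real_eq_iff)
  then obtain t where t: "cmod a = cos t" "cmod b = sin t"
    using sincos_total_pi_half[of "cmod a" "cmod b"] by auto
  define p q where "p = (Arg a + Arg b) / 2" and "q = (Arg a - Arg b) / 2"
  have pq: "p + q = Arg a" "p - q = Arg b" by (simp_all add: p_def q_def field_simps)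
  have a: "a = complex_of_real (cos t) * cis (p + q)" and b: "b = complex_of_real (sin t) * cis (p - q)"
    using rcis_cmod_Arg[of a] rcis_cmod_Arg[of b] by (simp_all add: rcis_def t pq)
  have ca: "cnj a = complex_of_real (cos t) * cis (- p - q)"
    unfolding a by (simp add: cis_cnj)
  have cb: "cnj b = complex_of_real (sin t) * cis (q - p)"
    unfolding b by (simp add: cis_cnj)
  have cm: "cis (p - q) = cis p * cis (- q)" "cis (q - p) = cis q * cis (- p)"
    "cis (- p - q) = cis (- p) * cis (- q)"
    by (simp_all add: cis_mult)
  have "g = phase (cis p) ** rot (complex_of_real t) ** phase (cis q)"
  proof (rule matrix_2_eqI)
    show "g $ 1 $ 1 = (phase (cis p) ** rot (complex_of_real t) ** phase (cis q)) $ 1 $ 1"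
      unfolding matrix_mult_2_nth rot_nth phase_nth a_def[symmetric]
      by (simp add: a cis_mult[symmetric] cos_of_real)
    show "g $ 1 $ 2 = (phase (cis p) ** rot (complex_of_real t) ** phase (cis q)) $ 1 $ 2"
      unfolding matrix_mult_2_nth rot_nth phase_nth b_def[symmetric]
      by (simp add: b cm cis_cnj sin_of_real)
    show "g $ 2 $ 1 = (phase (cis p) ** rot (complex_of_real t) ** phase (cis q)) $ 2 $ 1"
      unfolding matrix_mult_2_nth rot_nth phase_nth g2
      by (simp add: cb cm cis_cnj sin_of_real)
    show "g $ 2 $ 2 = (phase (cis p) ** rot (complex_of_real t) ** phase (cis q)) $ 2 $ 2"
      unfolding matrix_mult_2_nth rot_nth phase_nth g2
      by (simp add: ca cm cis_cnj cos_of_real)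
  qed
  then show thesis by (rule that)
qed


subsection \<open>Derivatives along rotations\<close>

definition has_coeff_derivative :: "(complex \<Rightarrow> complex poly) \<Rightarrow> complex poly \<Rightarrow> complex \<Rightarrow> bool" where
  "has_coeff_derivative P P' t \<longleftrightarrow>
     (\<forall>k. ((\<lambda>t. coeff (P t) k) has_field_derivative coeff P' k) (at t))"

lemma has_coeff_derivative_const: "has_coeff_derivative (\<lambda>_. P) 0 t"
  by (simp add: has_coeff_derivative_def)

lemma has_coeff_derivative_mult:
  assumes "has_coeff_derivative P P' t" "has_coeff_derivative Q Q' t"
  shows "has_coeff_derivative (\<lambda>t. P t * Q t) (P' * Q t + P t * Q') t"
  unfolding has_coeff_derivative_def
proof
  fix k
  have "((\<lambda>t. \<Sum>i\<le>k. coeff (P t) i * coeff (Q t) (k - i)) has_field_derivative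
      (\<Sum>i\<le>k. coeff P' i * coeff (Q t) (k - i) + coeff Q' (k - i) * coeff (P t) i)) (at t)"
    using assms unfolding has_coeff_derivative_def by (intro DERIV_sum DERIV_mult) auto
  then show "((\<lambda>t. coeff (P t * Q t) k) has_field_derivative coeff (P' * Q t + P t * Q') k) (at t)"
    by (simp add: coeff_mult sum.distrib mult.commute[of "coeff Q' _"])
qed

lemma has_coeff_derivative_power:
  assumes "has_coeff_derivative P P' t"
  shows "has_coeff_derivative (\<lambda>t. P t ^ l) (of_nat l * P t ^ (l - 1) * P') t"
proof (induction l)
  case (Suc l)
  have "P' * P t ^ l + P t * (of_nat l * P t ^ (l - 1) * P') = of_nat (Suc l) * P t ^ (Suc l - 1) * P'"
    by (cases l) (simp_all add: algebra_simps)
  with has_coeff_derivative_mult[OF assms Suc] show ?case by simp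
qed (simp add: has_coeff_derivative_const)

lemma has_coeff_derivative_linear:
  assumes "(f has_field_derivative f') (at t)" "(g has_field_derivative g') (at t)"
  shows "has_coeff_derivative (\<lambda>t. [:f t, g t:]) [:f', g':] t"
  unfolding has_coeff_derivative_def using assms
  by (auto simp: coeff_pCons split: nat.split)

text \<open>The image of x^l y^(n-l) under \<open>g\<close>, at y = 1. The square roots of binomials
  are left out so that it can be differentiated as a plain product.\<close>

definition spin_poly :: "nat \<Rightarrow> complex^2^2 \<Rightarrow> nat \<Rightarrow> complex poly" where
  "spin_poly n g l = [:g $ 2 $ 1, g $ 1 $ 1:] ^ l * [:g $ 2 $ 2, g $ 1 $ 2:] ^ (n - l)"

text \<open>Right multiplication by \<open>rot t\<close> mixes the two linear factors
  \<open>P\<close> and \<open>Q\<close> among themselves, with P' = -Q and Q' = P. The product rule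
  then trades one factor for the other, moving \<open>l\<close> by one.\<close>

lemma spin_poly_rot_derivative:
  assumes l: "l \<le> n"
  shows "has_coeff_derivative (\<lambda>t. spin_poly n (g ** rot t) l)
    (of_nat (n - l) * spin_poly n (g ** rot t) (Suc l) - of_nat l * spin_poly n (g ** rot t) (l - 1)) t"
proof -
  define P where "P = (\<lambda>t. [:(g ** rot t) $ 2 $ 1, (g ** rot t) $ 1 $ 1:])"
  define Q where "Q = (\<lambda>t. [:(g ** rot t) $ 2 $ 2, (g ** rot t) $ 1 $ 2:])"
  have P: "has_coeff_derivative P (- Q t) t" and Q: "has_coeff_derivative Q (P t) t"
    unfolding P_def Q_def matrix_mult_2_nth rot_nth minus_pCons minus_zero
    by (rule has_coeff_derivative_linear; auto intro!: derivative_eq_intros)+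
  have "of_nat l * P t ^ (l - 1) * - Q t * Q t ^ (n - l) + P t ^ l * (of_nat (n - l) * Q t ^ (n - l - 1) * P t)
     = of_nat (n - l) * (P t ^ Suc l * Q t ^ (n - Suc l)) - of_nat l * (P t ^ (l - 1) * Q t ^ (n - (l - 1)))"
  proof (cases l)
    case (Suc j)
    then have "n - j = Suc (n - l)" using l by simp
    then show ?thesis by (simp add: Suc algebra_simps)
  qed (simp add: algebra_simps)
  then show ?thesis
    using has_coeff_derivative_mult[OF has_coeff_derivative_power[OF P, of l]
        has_coeff_derivative_power[OF Q, of "n - l"]]
    by (simp add: spin_poly_def P_def Q_def)
qed

text \<open>The normalisation of the basis turns the coefficients n - l and l + 1 into the symmetric
  \<open>ladder\<close> entries, by (l + 1) (n choose l + 1) = (n - l) (n choose l). The factor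
  \<open>c\<close> stands for the normalisation of the row.\<close>

lemma ladder_binomial:
  assumes "l < n"
  shows "real (n - l) * sqrt (real (n choose l) / c) = ladder n (Suc l) * sqrt (real (n choose Suc l) / c)"
    and "real (Suc l) * sqrt (real (n choose Suc l) / c) = ladder n (Suc l) * sqrt (real (n choose l) / c)"
proof -
  have b: "real (Suc l) * real (n choose Suc l) = real (n - l) * real (n choose l)"
    using binomial_absorption[of l n] binomial_absorb_comp[of n l]
    by (simp only: of_nat_mult[symmetric])
  have "real (n - l) * sqrt (real (n choose l) / c) = sqrt ((real (n - l))\<^sup>2 * (real (n choose l) / c))"
    by (simp only: real_sqrt_mult real_sqrt_abs abs_of_nat)
  also have "(real (n - l))\<^sup>2 * (real (n choose l) / c) = real (n - l) * (real (n - l) * real (n choose l)) / c"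
    by (simp add: power2_eq_square)
  also have "\<dots> = real (Suc l * (n - l)) * (real (n choose Suc l) / c)"
    unfolding b[symmetric] by (simp only: of_nat_mult times_divide_eq_right times_divide_eq_left mult_ac)
  finally show "real (n - l) * sqrt (real (n choose l) / c) = ladder n (Suc l) * sqrt (real (n choose Suc l) / c)"
    by (simp only: real_sqrt_mult ladder_def diff_Suc_Suc)
  have "real (Suc l) * sqrt (real (n choose Suc l) / c) = sqrt ((real (Suc l))\<^sup>2 * (real (n choose Suc l) / c))"
    by (simp only: real_sqrt_mult real_sqrt_abs abs_of_nat)
  also have "(real (Suc l))\<^sup>2 * (real (n choose Suc l) / c) = real (Suc l) * (real (Suc l) * real (n choose Suc l)) / c"
    by (simp add: power2_eq_square)
  also have "\<dots> = real (Suc l * (n - l)) * (real (n choose l) / c)"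
    unfolding b by (simp only: of_nat_mult times_divide_eq_right times_divide_eq_left mult_ac)
  finally show "real (Suc l) * sqrt (real (n choose Suc l) / c) = ladder n (Suc l) * sqrt (real (n choose l) / c)"
    by (simp only: real_sqrt_mult ladder_def diff_Suc_Suc)
qed

lemma spin_rep_eq:
  "k \<le> n \<Longrightarrow> l \<le> n \<Longrightarrow> spin_rep n g k l
    = complex_of_real (sqrt (real (n choose l) / real (n choose k))) * coeff (spin_poly n g l) k"
  by (simp add: spin_rep_def spin_poly_def)

lemma coeff_of_nat_mult: "coeff (of_nat m * (p :: complex poly)) k = of_nat m * coeff p k"
  by (induction m) (simp_all add: algebra_simps)

lemma spin_rep_rot_derivative:
  assumes k: "k \<le> n" and l: "l \<le> n"
  shows "((\<lambda>t. spin_rep n (g ** rot t) k l) has_field_derivative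
    (complex_of_real (ladder n (Suc l)) * spin_rep n (g ** rot t) k (Suc l)
     - complex_of_real (ladder n l) * spin_rep n (g ** rot t) k (l - 1))) (at t)"
proof -
  define c where "c = real (n choose k)"
  define p where "p = (\<lambda>l. coeff (spin_poly n (g ** rot t) l) k)"
  define r where "r = (\<lambda>l. complex_of_real (sqrt (real (n choose l) / c)))"
  have "((\<lambda>t. r l * coeff (spin_poly n (g ** rot t) l) k) has_field_derivative
      r l * (of_nat (n - l) * p (Suc l) - of_nat l * p (l - 1))) (at t)"
    using spin_poly_rot_derivative[OF l, of g t] unfolding has_coeff_derivative_def
    by (intro DERIV_cmult) (simp add: p_def coeff_of_nat_mult)
  moreover have "r l * (of_nat (n - l) * p (Suc l))
      = complex_of_real (ladder n (Suc l)) * spin_rep n (g ** rot t) k (Suc l)"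
  proof (cases "l < n")
    case True
    have "complex_of_real (real (n - l) * sqrt (real (n choose l) / c))
        = complex_of_real (ladder n (Suc l) * sqrt (real (n choose Suc l) / c))"
      by (simp only: ladder_binomial(1)[OF True])
    then have "r l * of_nat (n - l) = complex_of_real (ladder n (Suc l)) * r (Suc l)"
      by (simp add: r_def mult.commute)
    then show ?thesis using True k by (simp add: spin_rep_eq p_def r_def c_def mult.assoc[symmetric])
  qed (use l in \<open>simp add: ladder_Suc_n\<close>)
  moreover have "r l * (of_nat l * p (l - 1))
      = complex_of_real (ladder n l) * spin_rep n (g ** rot t) k (l - 1)"
  proof (cases l)
    case (Suc j)
    then have j: "j < n" using l by simp
    have "complex_of_real (real (Suc j) * sqrt (real (n choose Suc j) / c))
        = complex_of_real (ladder n (Suc j) * sqrt (real (n choose j) / c))"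
      by (simp only: ladder_binomial(2)[OF j])
    then have "r l * of_nat l = complex_of_real (ladder n l) * r j"
      unfolding Suc r_def by (simp only: of_real_mult of_real_of_nat_eq mult.commute)
    then show ?thesis using Suc j k by (simp add: spin_rep_eq p_def r_def c_def mult.assoc[symmetric])
  qed simp
  ultimately show ?thesis
    using k l by (simp add: spin_rep_eq right_diff_distrib r_def c_def)
qed

lemma all_midxs_iff: "m \<in> all_midxs n \<longleftrightarrow> (\<forall>f. m f \<le> n)"
  by (auto simp: midxs_def PiE_def Pi_def)

lemma finite_midxs: "finite (midxs n A)"
  unfolding midxs_def by (intro finite_PiE) auto

definition four_raise :: "nat \<Rightarrow> midx vec \<Rightarrow> midx vec" where
  "four_raise n \<psi> = (\<lambda>m. \<Sum>f\<in>UNIV. complex_of_real (ladder n (m f)) * \<psi> (m(f := m f - 1)))"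

definition four_lower :: "nat \<Rightarrow> midx vec \<Rightarrow> midx vec" where
  "four_lower n \<psi> = (\<lambda>m. \<Sum>f\<in>UNIV. complex_of_real (ladder n (Suc (m f))) * \<psi> (m(f := Suc (m f))))"

lemma tensor4_rep_rot_derivative:
  assumes m: "m \<in> all_midxs n" and m': "m' \<in> all_midxs n"
  shows "((\<lambda>t. tensor4_rep n (g ** rot t) m m') has_field_derivative
    (\<Sum>f\<in>UNIV. complex_of_real (ladder n (Suc (m' f))) * tensor4_rep n (g ** rot t) m (m'(f := Suc (m' f)))
     - complex_of_real (ladder n (m' f)) * tensor4_rep n (g ** rot t) m (m'(f := m' f - 1)))) (at t)"
proof -
  have T: "tensor4_rep n h m (m'(f := v)) = spin_rep n h (m f) v * (\<Prod>y\<in>UNIV - {f}. spin_rep n h (m y) (m' y))"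
    for h f v
    unfolding tensor4_rep_def by (subst prod.remove[of _ f]) (auto intro!: prod.cong)
  show ?thesis
    unfolding T unfolding tensor4_rep_def
    using m m' spin_rep_rot_derivative[of "m f" n "m' f" g t for f]
    by (intro DERIV_cong[OF has_field_derivative_prod[OF spin_rep_rot_derivative]])
       (auto simp: all_midxs_iff algebra_simps)
qed

text \<open>Summation by parts in the coordinate \<open>f\<close>. The layers \<open>m f = n\<close>
  on the left and \<open>m f = 0\<close> on the right have coefficient 0, and the shift is a
  bijection between the rest.\<close>

lemma sum_shift_midx:
  "(\<Sum>m\<in>all_midxs n. complex_of_real (ladder n (Suc (m f))) * F (m(f := Suc (m f))) * G m)
   = (\<Sum>m\<in>all_midxs n. complex_of_real (ladder n (m f)) * F m * G (m(f := m f - 1)))"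
proof (rule sum.reindex_bij_witness_not_neutral
      [where S' = "{m \<in> all_midxs n. m f = n}" and T' = "{m \<in> all_midxs n. m f = 0}" and
        j = "\<lambda>m. m(f := Suc (m f))" and i = "\<lambda>m. m(f := m f - 1)"])
  fix m assume "m \<in> all_midxs n - {m \<in> all_midxs n. m f = n}"
  then have "\<forall>g. m g \<le> n" "m f < n" unfolding all_midxs_iff Diff_iff mem_Collect_eq
    by (auto simp: order.strict_iff_order)
  then show "m(f := Suc (m f)) \<in> all_midxs n - {m \<in> all_midxs n. m f = 0}"
    by (simp add: all_midxs_iff)
next
  fix m assume "m \<in> all_midxs n - {m \<in> all_midxs n. m f = 0}"
  then have m: "\<forall>g. m g \<le> n" "m f > 0" unfolding all_midxs_iff Diff_iff mem_Collect_eq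
    by auto
  then show "(m(f := m f - 1))(f := Suc ((m(f := m f - 1)) f)) = m" by simp
  have "m f \<le> n" using m(1) by blast
  then have "m f - 1 < n" using m(2) by simp
  then show "m(f := m f - 1) \<in> all_midxs n - {m \<in> all_midxs n. m f = n}"
    using m by (simp add: all_midxs_iff)
qed (simp_all add: finite_midxs ladder_Suc_n)

text \<open>Differentiation acts on the column index of the representation; moving the shift onto
  \<psi> makes the generator J_+ - J_- act on \<psi> before the group element. Hence (J_+ - J_-)
  \<psi> = 0 makes the derivative vanish for every \<open>g\<close> and \<open>t\<close> at
  once.\<close>

lemma op_apply_rot_derivative:
  assumes m: "m \<in> all_midxs n"
  shows "((\<lambda>t. op_apply (all_midxs n) (tensor4_rep n (g ** rot t)) \<psi> m) has_field_derivative
    op_apply (all_midxs n) (tensor4_rep n (g ** rot t)) (\<lambda>m. four_raise n \<psi> m - four_lower n \<psi> m) m) (at t)"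
proof -
  define T where "T = tensor4_rep n (g ** rot t) m"
  let ?A = "all_midxs n"
  let ?l = "\<lambda>l. complex_of_real (ladder n l)"
  have "((\<lambda>t. op_apply ?A (tensor4_rep n (g ** rot t)) \<psi> m) has_field_derivative
    (\<Sum>m'\<in>?A. (\<Sum>f\<in>UNIV. ?l (Suc (m' f)) * T (m'(f := Suc (m' f))) - ?l (m' f) * T (m'(f := m' f - 1))) * \<psi> m')) (at t)"
    unfolding op_apply_def T_def
    by (intro DERIV_sum DERIV_cmult_right tensor4_rep_rot_derivative m) simp
  moreover have "(\<Sum>m'\<in>?A. (\<Sum>f\<in>UNIV. ?l (Suc (m' f)) * T (m'(f := Suc (m' f))) - ?l (m' f) * T (m'(f := m' f - 1))) * \<psi> m')
      = (\<Sum>f\<in>UNIV. (\<Sum>m'\<in>?A. ?l (Suc (m' f)) * T (m'(f := Suc (m' f))) * \<psi> m')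
           - (\<Sum>m'\<in>?A. ?l (m' f) * \<psi> m' * T (m'(f := m' f - 1))))"
    unfolding sum_distrib_right sum_subtractf[symmetric]
    by (subst sum.swap) (simp add: algebra_simps)
  moreover have "\<dots> = (\<Sum>f\<in>UNIV. (\<Sum>m'\<in>?A. ?l (m' f) * T m' * \<psi> (m'(f := m' f - 1)))
           - (\<Sum>m'\<in>?A. ?l (Suc (m' f)) * \<psi> (m'(f := Suc (m' f))) * T m'))"
    unfolding sum_shift_midx ..
  moreover have "\<dots> = op_apply ?A (tensor4_rep n (g ** rot t)) (\<lambda>m. four_raise n \<psi> m - four_lower n \<psi> m) m"
    unfolding op_apply_def T_def[symmetric] four_raise_def four_lower_def sum_subtractf[symmetric] sum_distrib_left
    by (subst (2) sum.swap) (simp add: algebra_simps)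
  ultimately show ?thesis by simp
qed


subsection \<open>The invariants\<close>

lemma pCons_0_1_power: "(pCons 0 1 :: complex poly) ^ l = monom 1 l"
  by (induction l) (simp_all add: monom_Suc)

lemma spin_rep_1: "k \<le> n \<Longrightarrow> l \<le> n \<Longrightarrow> spin_rep n (mat 1) k l = (if k = l then 1 else 0)"
  by (simp add: spin_rep_def mat_1_2_nth pCons_0_1_power pCons_one)

lemma op_apply_tensor4_rep_1:
  assumes "m \<in> all_midxs n"
  shows "op_apply (all_midxs n) (tensor4_rep n (mat 1)) \<psi> m = \<psi> m"
proof -
  have "tensor4_rep n (mat 1) m m' = (if m' = m then 1 else 0)" if "m' \<in> all_midxs n" for m'
  proof (cases "m' = m")
    case True
    then show ?thesis using assms by (simp add: tensor4_rep_def spin_rep_1 all_midxs_iff)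
  next
    case False
    then obtain f where "m f \<noteq> m' f" unfolding fun_eq_iff by metis
    then have "spin_rep n (mat 1) (m f) (m' f) = 0"
      using assms that by (simp add: spin_rep_1 all_midxs_iff)
    then show ?thesis using False unfolding tensor4_rep_def by (auto simp: prod_zero_iff)
  qed
  then have "op_apply (all_midxs n) (tensor4_rep n (mat 1)) \<psi> m = (\<Sum>m'\<in>all_midxs n. if m' = m then \<psi> m' else 0)"
    unfolding op_apply_def by (intro sum.cong refl) auto
  then show ?thesis using assms by (simp add: finite_midxs)
qed

lemma op_apply_tensor4_rep_in_vecs: "op_apply (all_midxs n) (tensor4_rep n g) \<psi> \<in> vecs (all_midxs n)"
proof -
  have "tensor4_rep n g m m' = 0" if m: "m \<notin> all_midxs n" for m m'
  proof -
    obtain f where "\<not> m f \<le> n" using m unfolding all_midxs_iff by blast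
    then have "spin_rep n g (m f) (m' f) = 0" by (simp add: spin_rep_def)
    then show ?thesis unfolding tensor4_rep_def by (auto simp: prod_zero_iff)
  qed
  then show ?thesis by (auto simp: vecs_def op_apply_def)
qed

lemma spin_rep_phase:
  "spin_rep n (g ** phase \<alpha>) k l = \<alpha> ^ l * cnj \<alpha> ^ (n - l) * spin_rep n g k l"
proof -
  have "[:(g ** phase \<alpha>) $ 2 $ 1, (g ** phase \<alpha>) $ 1 $ 1:] = smult \<alpha> [:g $ 2 $ 1, g $ 1 $ 1:]"
    "[:(g ** phase \<alpha>) $ 2 $ 2, (g ** phase \<alpha>) $ 1 $ 2:] = smult (cnj \<alpha>) [:g $ 2 $ 2, g $ 1 $ 2:]"
    by (simp_all add: matrix_mult_2_nth phase_nth)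
  then show ?thesis unfolding spin_rep_def by (simp only: smult_power) simp
qed

lemma tensor4_rep_phase:
  "tensor4_rep n (g ** phase \<alpha>) m m'
    = \<alpha> ^ (\<Sum>f\<in>UNIV. m' f) * cnj \<alpha> ^ (\<Sum>f\<in>UNIV. n - m' f) * tensor4_rep n g m m'"
  unfolding tensor4_rep_def spin_rep_phase by (simp add: prod.distrib power_sum)

lemma sum_midx_complement:
  assumes "m \<in> all_midxs n"
  shows "(\<Sum>f\<in>UNIV. n - m f) + (\<Sum>f\<in>UNIV. m f) = 4 * n"
proof -
  have "(\<Sum>f\<in>UNIV. n - m f) + (\<Sum>f\<in>UNIV. m f) = (\<Sum>f\<in>(UNIV::4 set). n)"
    unfolding sum.distrib[symmetric] using assms by (intro sum.cong) (auto simp: all_midxs_iff)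
  then show ?thesis by simp
qed

text \<open>On total weight 2 n a basis vector picks up \<alpha>^(2 n) and the same power of its
  conjugate, with product 1.\<close>

lemma op_apply_phase:
  assumes "\<And>m. \<psi> m \<noteq> 0 \<Longrightarrow> (\<Sum>f\<in>UNIV. m f) = 2 * n" and \<alpha>: "\<alpha> * cnj \<alpha> = 1"
  shows "op_apply (all_midxs n) (tensor4_rep n (g ** phase \<alpha>)) \<psi> = op_apply (all_midxs n) (tensor4_rep n g) \<psi>"
proof -
  have "tensor4_rep n (g ** phase \<alpha>) m m' * \<psi> m' = tensor4_rep n g m m' * \<psi> m'" if "m' \<in> all_midxs n" for m m'
  proof (cases "\<psi> m' = 0")
    case False
    then have "(\<Sum>f\<in>UNIV. m' f) = 2 * n" by (rule assms)
    moreover from this have "(\<Sum>f\<in>UNIV. n - m' f) = 2 * n" using sum_midx_complement[OF that] by simp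
    ultimately show ?thesis
      using \<alpha> by (simp add: tensor4_rep_phase power_mult_distrib[symmetric])
  qed simp
  then show ?thesis unfolding op_apply_def by (intro ext sum.cong refl) simp
qed

lemma H_inv_weight:
  assumes \<psi>: "\<psi> \<in> H_inv n" and nz: "\<psi> m \<noteq> 0"
  shows "(\<Sum>f\<in>UNIV. m f) = 2 * n"
proof (rule ccontr)
  assume neq: "(\<Sum>f\<in>UNIV. m f) \<noteq> 2 * n"
  have m: "m \<in> all_midxs n" using \<psi> nz by (auto simp: H_inv_def vecs_def)
  define S where "S = (\<Sum>f\<in>UNIV. m f)"
  define S' where "S' = (\<Sum>f\<in>UNIV. n - m f)"
  have SS: "S' + S = 4 * n" unfolding S_def S'_def by (rule sum_midx_complement[OF m])
  \<comment> \<open>Chosen so that the entry at \<open>m\<close> acquires the factor -1, which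
    contradicts invariance. The denominator is nonzero since S + S' = 4 n and S differs from 2
    n.\<close>
  define \<theta> where "\<theta> = pi / (real S - real S')"
  have ne: "real S - real S' \<noteq> 0" using neq SS unfolding S_def[symmetric] by auto
  have "mat 1 ** phase (cis \<theta>) \<in> SU2" using phase_in_SU2 by (simp add: matrix_mul_lid)
  then have "op_apply (all_midxs n) (tensor4_rep n (mat 1 ** phase (cis \<theta>))) \<psi> m = \<psi> m"
    using \<psi> by (simp add: H_inv_def)
  moreover have "op_apply (all_midxs n) (tensor4_rep n (mat 1 ** phase (cis \<theta>))) \<psi> m
      = op_apply (all_midxs n) (tensor4_rep n (mat 1))
          (\<lambda>m'. cis \<theta> ^ (\<Sum>f\<in>UNIV. m' f) * cnj (cis \<theta>) ^ (\<Sum>f\<in>UNIV. n - m' f) * \<psi> m') m"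
    unfolding op_apply_def tensor4_rep_phase by (simp add: mult_ac)
  moreover have "\<dots> = cis \<theta> ^ S * cnj (cis \<theta>) ^ S' * \<psi> m"
    unfolding op_apply_tensor4_rep_1[OF m] S_def S'_def ..
  moreover have "cis \<theta> ^ S * cnj (cis \<theta>) ^ S' = cis pi"
  proof -
    have "cis \<theta> ^ S * cnj (cis \<theta>) ^ S' = cis (real S * \<theta> + real S' * (- \<theta>))"
      by (simp only: cis_cnj Complex.DeMoivre cis_mult)
    also have "real S * \<theta> + real S' * (- \<theta>) = (real S - real S') * \<theta>" by (simp add: algebra_simps)
    also have "\<dots> = pi" using ne by (simp add: \<theta>_def)
    finally show ?thesis .
  qed
  ultimately show False using nz by simp
qed

lemma four_raise_eq_0:
  assumes "\<And>m. \<psi> m \<noteq> 0 \<Longrightarrow> (\<Sum>f\<in>UNIV. m f) = 2 * n" "(\<Sum>f\<in>UNIV. m f) \<noteq> 2 * n + 1"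
  shows "four_raise N \<psi> m = 0"
  unfolding four_raise_def
proof (intro sum.neutral ballI)
  fix f
  show "complex_of_real (ladder N (m f)) * \<psi> (m(f := m f - 1)) = 0"
  proof (cases "m f")
    case (Suc j)
    have "(\<Sum>g\<in>UNIV. (m(f := j)) g) + 1 = (\<Sum>g\<in>UNIV. m g)"
      using Suc by (subst (1 2) sum.remove[of _ f]) auto
    then have "\<psi> (m(f := j)) = 0" using assms by fastforce
    then show ?thesis using Suc by simp
  qed simp
qed

lemma four_lower_eq_0:
  assumes "\<And>m. \<psi> m \<noteq> 0 \<Longrightarrow> (\<Sum>f\<in>UNIV. m f) = 2 * n" "(\<Sum>f\<in>UNIV. m f) + 1 \<noteq> 2 * n"
  shows "four_lower N \<psi> m = 0"
  unfolding four_lower_def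
proof (intro sum.neutral ballI)
  fix f
  have "(\<Sum>g\<in>UNIV. (m(f := Suc (m f))) g) = (\<Sum>g\<in>UNIV. m g) + 1"
    by (subst (1 2) sum.remove[of _ f]) auto
  then have "\<psi> (m(f := Suc (m f))) = 0" using assms by fastforce
  then show "complex_of_real (ladder N (Suc (m f))) * \<psi> (m(f := Suc (m f))) = 0" by simp
qed

lemma matrix_mult_rot_0: "(g :: complex^2^2) ** rot 0 = g"
  by (rule matrix_2_eqI) (simp_all add: matrix_mult_2_nth rot_nth)

text \<open>Forward: a curve constant in t has derivative 0, so J_+ \<psi> = J_- \<psi>; these have
  total weights 2 n + 1 and 2 n - 1, so at each index one of them is 0 and hence both are. Backward:
  \<psi> is unchanged by phases and rotations, and Euler angles reach every group element from
  these.\<close>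

theorem H_inv_iff:
  "\<psi> \<in> H_inv n \<longleftrightarrow> \<psi> \<in> vecs (all_midxs n) \<and> (\<forall>m. \<psi> m \<noteq> 0 \<longrightarrow> (\<Sum>f\<in>UNIV. m f) = 2 * n) \<and>
     (\<forall>m\<in>all_midxs n. four_raise n \<psi> m = 0 \<and> four_lower n \<psi> m = 0)"
  (is "?L \<longleftrightarrow> ?R")
proof
  assume L: ?L
  have w: "\<psi> m \<noteq> 0 \<Longrightarrow> (\<Sum>f\<in>UNIV. m f) = 2 * n" for m using H_inv_weight[OF L] .
  have "four_raise n \<psi> m = 0 \<and> four_lower n \<psi> m = 0" if m: "m \<in> all_midxs n" for m
  proof -
    let ?f = "\<lambda>t. op_apply (all_midxs n) (tensor4_rep n (mat 1 ** rot t)) \<psi> m"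
    let ?d = "op_apply (all_midxs n) (tensor4_rep n (mat 1 ** rot 0)) (\<lambda>m. four_raise n \<psi> m - four_lower n \<psi> m) m"
    have "(complex_of_real has_vector_derivative 1) (at 0)"
      using has_vector_derivative_of_real[OF DERIV_ident] by simp
    moreover have "(?f has_field_derivative ?d) (at (complex_of_real 0))"
      using op_apply_rot_derivative[OF m, of "mat 1" \<psi> 0] by simp
    \<comment> \<open>The complex derivative is restricted to real t, where \<open>rot\<close> lies
      in the group.\<close>
    ultimately have "((?f \<circ> complex_of_real) has_vector_derivative 1 * ?d) (at 0)"
      by (rule field_vector_diff_chain_at)
    moreover have "?f \<circ> complex_of_real = (\<lambda>_. \<psi> m)"
      using L rot_in_SU2 by (auto simp: H_inv_def matrix_mul_lid)
    ultimately have "((\<lambda>_. \<psi> m) has_vector_derivative ?d) (at (0::real))" by simp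
    then have "?d = 0" using has_vector_derivative_const vector_derivative_unique_at by blast
    then have "four_raise n \<psi> m = four_lower n \<psi> m"
      unfolding matrix_mult_rot_0 op_apply_tensor4_rep_1[OF m] by simp
    moreover have "four_raise n \<psi> m = 0 \<or> four_lower n \<psi> m = 0"
    proof (cases "(\<Sum>f\<in>UNIV. m f) = 2 * n + 1")
      case True
      then have "four_lower n \<psi> m = 0" by (intro four_lower_eq_0[OF w]) auto
      then show ?thesis ..
    next
      case False
      then have "four_raise n \<psi> m = 0" by (intro four_raise_eq_0[OF w]) auto
      then show ?thesis ..
    qed
    ultimately show ?thesis by auto
  qed
  then show ?R using w L by (auto simp: H_inv_def)
next
  assume R: ?R
  then have v: "\<psi> \<in> vecs (all_midxs n)" and w: "\<And>m. \<psi> m \<noteq> 0 \<Longrightarrow> (\<Sum>f\<in>UNIV. m f) = 2 * n"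
    and z: "\<And>m. m \<in> all_midxs n \<Longrightarrow> four_raise n \<psi> m - four_lower n \<psi> m = 0" by auto
  let ?op = "\<lambda>g. op_apply (all_midxs n) (tensor4_rep n g) \<psi>"
  have one: "?op (mat 1) = \<psi>"
  proof
    fix m show "?op (mat 1) m = \<psi> m"
      using op_apply_tensor4_rep_1[of m n \<psi>] op_apply_tensor4_rep_in_vecs[of n "mat 1" \<psi>] v
      by (cases "m \<in> all_midxs n") (auto simp: vecs_def)
  qed
  have phase: "?op (g ** phase (cis t)) = ?op g" for g t
    by (rule op_apply_phase[OF w]) (simp_all add: cis_cnj cis_mult)
  have rot: "?op (g ** rot t) = ?op g" for g t
  proof
    fix m
    show "?op (g ** rot t) m = ?op g m"
    proof (cases "m \<in> all_midxs n")
      case True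
      have "op_apply (all_midxs n) (tensor4_rep n (g ** rot t)) (\<lambda>m. four_raise n \<psi> m - four_lower n \<psi> m) m = 0" for t
        unfolding op_apply_def using z by (intro sum.neutral) simp
      then have "((\<lambda>t. ?op (g ** rot t) m) has_field_derivative 0) (at t)" for t
        using op_apply_rot_derivative[OF True, of g \<psi> t] by simp
      \<comment> \<open>Zero derivative on the whole complex plane; the constant is read off at t =
        0.\<close>
      then obtain c where "\<And>t. ?op (g ** rot t) m = c"
        using has_field_derivative_zero_constant[OF convex_UNIV, of "\<lambda>t. ?op (g ** rot t) m"] by auto
      then show ?thesis by (metis matrix_mult_rot_0)
    next
      case False
      then show ?thesis using op_apply_tensor4_rep_in_vecs[of n _ \<psi>] by (simp add: vecs_def)
    qed
  qed
  have "?op g = \<psi>" if g2: "g \<in> SU2" for g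
  proof -
    obtain p t q where g: "g = phase (cis p) ** rot (complex_of_real t) ** phase (cis q)"
      by (rule SU2_euler[OF g2])
    \<comment> \<open>Right factors are stripped one by one, since the invariance above holds for an
      arbitrary left factor \<open>g\<close>.\<close>
    have "?op g = ?op (phase (cis p))" unfolding g phase rot ..
    also have "\<dots> = ?op (mat 1 ** phase (cis p))" by (simp only: matrix_mul_lid)
    also have "\<dots> = \<psi>" unfolding phase one ..
    finally show ?thesis .
  qed
  then show ?L using v by (simp add: H_inv_def)
qed

section \<open>The entanglement entropy of invariant tensors\<close>

text \<open>The value \<open>undefined\<close> elsewhere matches the extensional functions of
  \<open>midxs n {i, j}\<close>.\<close>

definition half :: "4 \<Rightarrow> 4 \<Rightarrow> nat \<times> nat \<Rightarrow> midx" where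
  "half i j a = (\<lambda>f. if f = i then fst a else if f = j then snd a else undefined)"

definition join :: "4 \<Rightarrow> 4 \<Rightarrow> 4 \<Rightarrow> nat \<times> nat \<Rightarrow> nat \<times> nat \<Rightarrow> midx" where
  "join i j k a b = (\<lambda>f. if f = i then fst a else if f = j then snd a else if f = k then fst b else snd b)"

definition flip :: "nat \<Rightarrow> nat \<times> nat \<Rightarrow> nat \<times> nat" where
  "flip n c = (n - fst c, n - snd c)"

lemma bij_betw_flip: "bij_betw (flip n) (grid n) (grid n)"
  by (rule bij_betw_byWitness[of _ "flip n"]) (auto simp: flip_def)

lemma bij_betw_half:
  assumes "i \<noteq> j"
  shows "bij_betw (half i j) (grid n) (midxs n {i, j})"
proof (rule bij_betw_byWitness[of _ "\<lambda>m. (m i, m j)"])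
  show "\<forall>m\<in>midxs n {i, j}. half i j (m i, m j) = m"
    by (auto simp: midxs_def half_def PiE_def extensional_def)
  show "half i j ` grid n \<subseteq> midxs n {i, j}"
    by (auto simp: midxs_def half_def PiE_def extensional_def)
  show "(\<lambda>m. (m i, m j)) ` midxs n {i, j} \<subseteq> grid n"
    by (auto simp: midxs_def PiE_def)
qed (use assms in \<open>auto simp: half_def\<close>)

lemma card_midxs: "i \<noteq> j \<Longrightarrow> card (midxs n {i, j}) = card (grid n)"
  using bij_betw_same_card[OF bij_betw_half] by metis

definition spin_dim :: "nat \<Rightarrow> nat \<Rightarrow> real" where
  "spin_dim n s = real (2 * (n - s) + 1)"

lemma spin_dim_pos: "spin_dim n s > 0"
  by (simp add: spin_dim_def)

lemma midx_le: "m \<in> all_midxs n \<Longrightarrow> m f \<le> n"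
  by (simp add: all_midxs_iff)

lemma card_grid: "real (card (grid n)) = (real n + 1)\<^sup>2"
  by (simp add: power2_eq_square algebra_simps)

section \<open>Coordinates adapted to a split of the factors into {i, j} and {k, l}\<close>

context
  fixes i j k l :: 4
  assumes distinct: "distinct [i, j, k, l]"
begin

lemma neq: "i \<noteq> j" "i \<noteq> k" "i \<noteq> l" "j \<noteq> k" "j \<noteq> l" "k \<noteq> l"
  "j \<noteq> i" "k \<noteq> i" "l \<noteq> i" "k \<noteq> j" "l \<noteq> j" "l \<noteq> k"
  using distinct by auto

lemma UNIV_4: "UNIV = {i, j, k, l}"
proof -
  have "card {i, j, k, l} = CARD(4)" using neq by simp
  then show ?thesis using card_subset_eq[of "UNIV :: 4 set" "{i, j, k, l}"] by simp
qed

lemma factor_cases: "f = i \<or> f = j \<or> f = k \<or> f = l"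
  using UNIV_4 by blast

lemma complement: "- {i, j} = {k, l}"
  using factor_cases neq by auto

lemma sum_4: "(\<Sum>f\<in>UNIV. F f) = F i + F j + (F k + F l :: 'b::comm_monoid_add)"
  unfolding UNIV_4 using neq by (simp add: add.assoc)

lemma join_simps: "join i j k a b i = fst a" "join i j k a b j = snd a" "join i j k a b k = fst b"
  "join i j k a b l = snd b"
  using neq by (simp_all add: join_def)

lemma merge_half: "merge {i, j} (- {i, j}) (half i j a, half k l b) = join i j k a b"
proof
  fix f show "merge {i, j} (- {i, j}) (half i j a, half k l b) f = join i j k a b f"
    using factor_cases[of f] neq by (auto simp: merge_def half_def join_def)
qed

lemma join_upd:
  "(join i j k a b)(i := x) = join i j k (x, snd a) b" "(join i j k a b)(j := x) = join i j k (fst a, x) b"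
  "(join i j k a b)(k := x) = join i j k a (x, snd b)" "(join i j k a b)(l := x) = join i j k a (fst b, x)"
proof -
  show "(join i j k a b)(i := x) = join i j k (x, snd a) b" by (auto simp: join_def)
  show "(join i j k a b)(j := x) = join i j k (fst a, x) b" using neq by (auto simp: join_def)
  show "(join i j k a b)(k := x) = join i j k a (x, snd b)" using neq by (auto simp: join_def)
  show "(join i j k a b)(l := x) = join i j k a (fst b, x)"
  proof
    fix f show "((join i j k a b)(l := x)) f = join i j k a (fst b, x) f"
      using factor_cases[of f] neq by (auto simp: join_def)
  qed
qed

lemma join_in_all_midxs: "a \<in> grid n \<Longrightarrow> b \<in> grid n \<Longrightarrow> join i j k a b \<in> all_midxs n"
  by (auto simp: all_midxs_iff join_def)

lemma join_components: "join i j k (m i, m j) (m k, m l) = m"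
proof
  fix f show "join i j k (m i, m j) (m k, m l) f = m f"
    using factor_cases[of f] by (auto simp: join_def)
qed

lemma sum_all_midxs: "(\<Sum>m\<in>all_midxs n. F m) = (\<Sum>a\<in>grid n. \<Sum>b\<in>grid n. F (join i j k a b))"
proof -
  have "(\<Sum>m\<in>all_midxs n. F m) = (\<Sum>(a, b)\<in>grid n \<times> grid n. F (join i j k a b))"
    by (rule sum.reindex_bij_witness[where i = "\<lambda>(a, b). join i j k a b"
          and j = "\<lambda>m. ((m i, m j), (m k, m l))"])
       (auto simp: join_components join_simps midx_le join_in_all_midxs)
  then show ?thesis by (simp add: sum.cartesian_product)
qed

text \<open>With \<psi> read as a matrix of rows a and columns b, this is the matrix times its
  adjoint.\<close>

lemma reduced_density_half:
  assumes "a \<in> grid n" "a' \<in> grid n"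
  shows "reduced_density n {i, j} \<psi> (half i j a) (half i j a')
    = (\<Sum>b\<in>grid n. \<psi> (join i j k a b) * cnj (\<psi> (join i j k a' b)))"
proof -
  have "half i j a \<in> midxs n {i, j}" "half i j a' \<in> midxs n {i, j}"
    using bij_betw_half[OF neq(1), of n] assms by (auto simp: bij_betw_def)
  then show ?thesis
    unfolding reduced_density_def partial_trace_def ket_bra_def
    by (simp add: complement sum.reindex_bij_betw[OF bij_betw_half[OF neq(6)], symmetric])
       (simp add: complement[symmetric] merge_half)
qed

lemma reduced_density_outside:
  "m \<notin> midxs n A \<or> m' \<notin> midxs n A \<Longrightarrow> reduced_density n A \<psi> m m' = 0"
  by (auto simp: reduced_density_def partial_trace_def)

subsection \<open>All tensors: the entropy is at most maximal\<close>

lemma entanglement_entropy_le: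
  assumes "\<psi> \<in> unit_vecs (all_midxs n) (vecs (all_midxs n))"
  shows "entanglement_entropy n {i, j} \<psi> \<le> ln ((real n + 1)\<^sup>2)"
proof -
  let ?I = "midxs n {i, j}" and ?\<rho> = "reduced_density n {i, j} \<psi>"
  note hb = sum.reindex_bij_betw[OF bij_betw_half[OF neq(1)], symmetric]
  have "hermitian_on ?I ?\<rho>"
    unfolding hermitian_on_def
  proof (intro conjI allI)
    show "?\<rho> \<in> ops ?I" unfolding ops_def using reduced_density_outside by blast
    show "?\<rho> m' m = cnj (?\<rho> m m')" for m m'
      by (simp add: reduced_density_def partial_trace_def ket_bra_def mult.commute)
  qed
  moreover have "op_trace ?I ?\<rho> = 1"
  proof -
    have "op_trace ?I ?\<rho> = inner_prod (all_midxs n) \<psi> \<psi>"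
      unfolding op_trace_def hb inner_prod_def sum_all_midxs
      by (intro sum.cong refl) (simp add: reduced_density_half mult.commute)
    then show ?thesis using assms by (simp add: unit_vecs_def)
  qed
  moreover have "Re (inner_prod ?I v (op_apply ?I ?\<rho> v)) \<ge> 0" for v
  proof -
    \<comment> \<open>The adjoint of \<open>v\<close> times the matrix of \<psi>; its squared norm
      is the expectation of the density matrix in \<open>v\<close>.\<close>
    define z where "z = (\<lambda>b. \<Sum>a\<in>grid n. cnj (v (half i j a)) * \<psi> (join i j k a b))"
    have "inner_prod ?I v (op_apply ?I ?\<rho> v)
      = (\<Sum>a\<in>grid n. \<Sum>a'\<in>grid n. \<Sum>b\<in>grid n. cnj (v (half i j a)) * \<psi> (join i j k a b) *
           (v (half i j a') * cnj (\<psi> (join i j k a' b))))"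
      unfolding inner_prod_def op_apply_def hb sum_distrib_left
      by (intro sum.cong refl)
         (simp add: reduced_density_half sum_distrib_left sum_distrib_right mult_ac)
    also have "\<dots> = (\<Sum>a\<in>grid n. \<Sum>b\<in>grid n. \<Sum>a'\<in>grid n. cnj (v (half i j a)) * \<psi> (join i j k a b) *
           (v (half i j a') * cnj (\<psi> (join i j k a' b))))"
      by (rule sum.cong[OF refl]) (rule sum.swap)
    also have "\<dots> = (\<Sum>b\<in>grid n. \<Sum>a\<in>grid n. \<Sum>a'\<in>grid n. cnj (v (half i j a)) * \<psi> (join i j k a b) *
           (v (half i j a') * cnj (\<psi> (join i j k a' b))))"
      by (rule sum.swap)
    also have "\<dots> = (\<Sum>b\<in>grid n. z b * cnj (z b))"
      by (simp add: z_def sum_product)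
    also have "\<dots> = complex_of_real (\<Sum>b\<in>grid n. (cmod (z b))\<^sup>2)"
      unfolding of_real_sum by (intro sum.cong refl) (simp only: complex_norm_square)
    finally show ?thesis by (simp add: sum_nonneg)
  qed
  ultimately have "entanglement_entropy n {i, j} \<psi> \<le> ln (real (card ?I))"
    unfolding entanglement_entropy_def by (intro von_neumann_entropy_le_ln_card finite_midxs)
  also have "real (card ?I) = (real n + 1)\<^sup>2"
    unfolding card_midxs[OF neq(1)] by (rule card_grid)
  finally show ?thesis .
qed

text \<open>Witness: the maximally entangled state that pairs factor \<open>i\<close> with
  \<open>k\<close> and \<open>j\<close> with \<open>l\<close>. Its reduced density matrix is the
  identity divided by (n + 1)^2.\<close>

lemma entanglement_entropy_maximal:
  obtains \<psi> where "\<psi> \<in> unit_vecs (all_midxs n) (vecs (all_midxs n))"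
    "entanglement_entropy n {i, j} \<psi> = ln ((real n + 1)\<^sup>2)"
proof -
  define q where "q = complex_of_real (1 / (real n + 1))"
  define \<psi> where "\<psi> = (\<lambda>m. if m \<in> all_midxs n \<and> (m i, m j) = (m k, m l) then q else 0)"
  let ?I = "midxs n {i, j}"
  have \<psi>: "\<psi> (join i j k a b) = (if b = a then q else 0)" if "a \<in> grid n" "b \<in> grid n" for a b
    using that by (auto simp: \<psi>_def join_simps join_in_all_midxs prod_eq_iff)
  have qq: "cnj q * q = complex_of_real (1 / (real n + 1)\<^sup>2)" "q * cnj q = complex_of_real (1 / (real n + 1)\<^sup>2)"
    by (simp_all add: q_def power2_eq_square)
  have "inner_prod (all_midxs n) \<psi> \<psi> = (\<Sum>a\<in>grid n. \<Sum>b\<in>grid n. if b = a then cnj q * q else 0)"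
    unfolding inner_prod_def sum_all_midxs by (intro sum.cong refl) (simp add: \<psi>)
  also have "\<dots> = of_nat (card (grid n)) * (cnj q * q)" by simp
  also have "\<dots> = complex_of_real (real (card (grid n)) * (1 / (real n + 1)\<^sup>2))" by (simp add: qq)
  also have norm1: "real (card (grid n)) * (1 / (real n + 1)\<^sup>2) = 1"
  proof -
    have "real n + 1 \<noteq> 0" by linarith
    then show ?thesis unfolding card_grid by simp
  qed
  finally have "\<psi> \<in> unit_vecs (all_midxs n) (vecs (all_midxs n))"
    by (auto simp: unit_vecs_def vecs_def \<psi>_def)
  moreover have "entanglement_entropy n {i, j} \<psi> = ln ((real n + 1)\<^sup>2)"
  proof -
    define u where "u = (\<lambda>(x :: midx) y. if y = x then 1 else (0::complex))"
    have "reduced_density n {i, j} \<psi> x y = (\<Sum>z\<in>?I. complex_of_real (1 / (real n + 1)\<^sup>2) * (u z x * cnj (u z y)))" for x y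
    proof (cases "x \<in> ?I \<and> y \<in> ?I")
      case True
      then obtain a a' where a: "a \<in> grid n" "a' \<in> grid n" "x = half i j a" "y = half i j a'"
        using bij_betw_half[OF neq(1), of n] unfolding bij_betw_def by blast
      have "(x = y) = (a = a')" using a neq by (auto simp: half_def fun_eq_iff prod_eq_iff)
      moreover have "reduced_density n {i, j} \<psi> x y = (\<Sum>b\<in>grid n. if b = a then (if b = a' then q * cnj q else 0) else 0)"
        unfolding a(3,4) reduced_density_half[OF a(1,2)] using a(1,2)
        by (intro sum.cong refl) (auto simp: \<psi>)
      moreover have "(\<Sum>z\<in>?I. complex_of_real (1 / (real n + 1)\<^sup>2) * (u z x * cnj (u z y)))
          = (\<Sum>z\<in>?I. if z = x then (if z = y then complex_of_real (1 / (real n + 1)\<^sup>2) else 0) else 0)"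
        by (intro sum.cong refl) (auto simp: u_def)
      ultimately show ?thesis using True a(1) by (simp add: finite_midxs qq)
    next
      case False
      then have "u z x * cnj (u z y) = 0" if "z \<in> ?I" for z using that by (auto simp: u_def)
      then have "(\<Sum>z\<in>?I. complex_of_real (1 / (real n + 1)\<^sup>2) * (u z x * cnj (u z y))) = 0"
        by (intro sum.neutral ballI) simp
      then show ?thesis using reduced_density_outside[of x n "{i, j}" y \<psi>] False by simp
    qed
    moreover have "orthonormal_family ?I ?I u"
      by (auto simp: orthonormal_family_def vecs_def u_def inner_prod_delta_left finite_midxs)
    ultimately have "entanglement_entropy n {i, j} \<psi> = - (\<Sum>z\<in>?I. 1 / (real n + 1)\<^sup>2 * ln (1 / (real n + 1)\<^sup>2))"
      unfolding entanglement_entropy_def by (intro von_neumann_entropy_eqI finite_midxs refl)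
    also have "\<dots> = - (real (card (grid n)) * (1 / (real n + 1)\<^sup>2)) * ln (1 / (real n + 1)\<^sup>2)"
      by (simp add: card_midxs[OF neq(1)])
    also note norm1
    finally show ?thesis by (simp add: ln_div)
  qed
  ultimately show thesis by (rule that)
qed


subsection \<open>Invariant tensors as intertwiners\<close>

text \<open>The sign and the reflection \<open>c \<mapsto> n - c\<close> identify a spin representation with its dual.\<close>

definition kernel_of :: "nat \<Rightarrow> midx vec \<Rightarrow> kernel" where
  "kernel_of n \<psi> = (\<lambda>a c. if a \<in> grid n \<and> c \<in> grid n
     then (-1) ^ (fst c + snd c) * \<psi> (join i j k a (flip n c)) else 0)"

definition tensor_of :: "nat \<Rightarrow> kernel \<Rightarrow> midx vec" where
  "tensor_of n N = (\<lambda>m. if m \<in> all_midxs n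
     then (-1) ^ (n - m k + (n - m l)) * N (m i, m j) (n - m k, n - m l) else 0)"

lemma sign_square: "(-1) ^ s * ((-1) ^ s * z) = (z :: complex)"
  by (simp add: mult.assoc[symmetric] power_add[symmetric])

lemma tensor_of_join:
  "a \<in> grid n \<Longrightarrow> c \<in> grid n \<Longrightarrow> tensor_of n N (join i j k a (flip n c)) = (-1) ^ (fst c + snd c) * N a c"
  by (auto simp: tensor_of_def join_simps flip_def join_in_all_midxs)

lemma tensor_of_in_vecs: "tensor_of n N \<in> vecs (all_midxs n)"
  by (simp add: tensor_of_def vecs_def)

lemma tensor_of_kernel_of: "\<psi> \<in> vecs (all_midxs n) \<Longrightarrow> tensor_of n (kernel_of n \<psi>) = \<psi>"
proof
  fix m assume \<psi>: "\<psi> \<in> vecs (all_midxs n)"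
  show "tensor_of n (kernel_of n \<psi>) m = \<psi> m"
  proof (cases "m \<in> all_midxs n")
    case True
    then have "m f \<le> n" for f by (simp add: all_midxs_iff)
    then have "join i j k (m i, m j) (flip n (n - m k, n - m l)) = m"
      by (simp add: flip_def join_components)
    then show ?thesis using True
      by (simp add: tensor_of_def kernel_of_def all_midxs_iff sign_square)
  qed (use \<psi> in \<open>simp add: tensor_of_def vecs_def\<close>)
qed

lemma kernel_of_tensor_of:
  assumes "\<And>a c. N a c \<noteq> 0 \<Longrightarrow> a \<in> grid n \<and> c \<in> grid n"
  shows "kernel_of n (tensor_of n N) = N"
proof (intro ext)
  fix a c
  show "kernel_of n (tensor_of n N) a c = N a c"
    using assms[of a c] by (auto simp: kernel_of_def tensor_of_join sign_square)
qed

lemma sum_grid_flip: "(\<Sum>c\<in>grid n. F (flip n c)) = (\<Sum>c\<in>grid n. F c)"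
  by (rule sum.reindex_bij_betw[OF bij_betw_flip])

lemma inner_prod_tensor_of:
  "inner_prod (all_midxs n) (tensor_of n P) (tensor_of n Q) = (\<Sum>a\<in>grid n. \<Sum>c\<in>grid n. cnj (P a c) * Q a c)"
proof -
  have "inner_prod (all_midxs n) (tensor_of n P) (tensor_of n Q)
     = (\<Sum>a\<in>grid n. \<Sum>c\<in>grid n. cnj (tensor_of n P (join i j k a (flip n c))) * tensor_of n Q (join i j k a (flip n c)))"
    unfolding inner_prod_def sum_all_midxs
    by (rule sum.cong[OF refl]) (rule sum_grid_flip[symmetric])
  also have "\<dots> = (\<Sum>a\<in>grid n. \<Sum>c\<in>grid n. cnj (P a c) * Q a c)"
    by (intro sum.cong refl) (simp add: tensor_of_join mult_ac sign_square)
  finally show ?thesis .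
qed

text \<open>Under c \<mapsto> n - c the operator J_+ on the second pair becomes J_- with the same
  \<open>ladder\<close> entries, and the alternating sign turns the sum of the actions on the two
  pairs into a difference, that is, a commutator.\<close>

lemma kernel_of_raise:
  assumes a: "a \<in> grid n" and c: "c \<in> grid n"
  shows "raise n (\<lambda>a. kernel_of n \<psi> a c) a - lower n (kernel_of n \<psi> a) c
    = (-1) ^ (fst c + snd c) * four_raise n \<psi> (join i j k a (flip n c))" (is ?R)
   and "lower n (\<lambda>a. kernel_of n \<psi> a c) a - raise n (kernel_of n \<psi> a) c
    = (-1) ^ (fst c + snd c) * four_lower n \<psi> (join i j k a (flip n c))" (is ?L)
proof -
  obtain a1 a2 c1 c2 where e: "a = (a1, a2)" "c = (c1, c2)" by (cases a; cases c)
  have le: "a1 \<le> n" "a2 \<le> n" "c1 \<le> n" "c2 \<le> n" using a c by (auto simp: e)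
  let ?s = "(-1) ^ (c1 + c2) :: complex"
  let ?l = "\<lambda>l. complex_of_real (ladder n l)"
  have kN: "kernel_of n \<psi> (x, y) (z, w) = (if x \<le> n \<and> y \<le> n \<and> z \<le> n \<and> w \<le> n
      then (-1) ^ (z + w) * \<psi> (join i j k (x, y) (n - z, n - w)) else 0)" for x y z w
    by (auto simp: kernel_of_def flip_def)
  have up: "?l (n - z) * \<psi> (F (n - z - 1)) = (if z < n then ?l (Suc z) * \<psi> (F (n - Suc z)) else 0)"
    if "z \<le> n" for z F
    using that by (auto simp: ladder_reflect ladder_Suc_n)
  have down: "?l (Suc (n - z)) * \<psi> (F (Suc (n - z))) = (if z > 0 then ?l z * \<psi> (F (n - (z - 1))) else 0)"
    if "z \<le> n" for z F
  proof (cases z)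
    case (Suc y)
    then have "Suc (n - z) = n - y" "y \<le> n" using that by auto
    then show ?thesis using Suc by (simp add: ladder_reflect)
  qed (simp add: ladder_Suc_n)
  have "four_raise n \<psi> (join i j k a (flip n c))
     = ?l a1 * \<psi> (join i j k (a1 - 1, a2) (n - c1, n - c2)) + ?l a2 * \<psi> (join i j k (a1, a2 - 1) (n - c1, n - c2))
     + (?l (n - c1) * \<psi> (join i j k (a1, a2) (n - c1 - 1, n - c2))
       + ?l (n - c2) * \<psi> (join i j k (a1, a2) (n - c1, n - c2 - 1)))"
    unfolding four_raise_def sum_4 join_upd by (simp add: e flip_def join_simps)
  then have R: "four_raise n \<psi> (join i j k a (flip n c))
     = ?l a1 * \<psi> (join i j k (a1 - 1, a2) (n - c1, n - c2)) + ?l a2 * \<psi> (join i j k (a1, a2 - 1) (n - c1, n - c2))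
     + ((if c1 < n then ?l (Suc c1) * \<psi> (join i j k (a1, a2) (n - Suc c1, n - c2)) else 0)
       + (if c2 < n then ?l (Suc c2) * \<psi> (join i j k (a1, a2) (n - c1, n - Suc c2)) else 0))"
    unfolding up[OF le(3), of "\<lambda>z. join i j k (a1, a2) (z, n - c2)"]
      up[OF le(4), of "\<lambda>z. join i j k (a1, a2) (n - c1, z)"] .
  show ?R unfolding R unfolding e raise_def lower_def prod.case kN using le
    by (cases "c1 < n"; cases "c2 < n") (auto simp: algebra_simps ladder_Suc_n)
  have "four_lower n \<psi> (join i j k a (flip n c))
     = ?l (Suc a1) * \<psi> (join i j k (Suc a1, a2) (n - c1, n - c2)) + ?l (Suc a2) * \<psi> (join i j k (a1, Suc a2) (n - c1, n - c2))
     + (?l (Suc (n - c1)) * \<psi> (join i j k (a1, a2) (Suc (n - c1), n - c2))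
       + ?l (Suc (n - c2)) * \<psi> (join i j k (a1, a2) (n - c1, Suc (n - c2))))"
    unfolding four_lower_def sum_4 join_upd by (simp add: e flip_def join_simps)
  then have L: "four_lower n \<psi> (join i j k a (flip n c))
     = ?l (Suc a1) * \<psi> (join i j k (Suc a1, a2) (n - c1, n - c2)) + ?l (Suc a2) * \<psi> (join i j k (a1, Suc a2) (n - c1, n - c2))
     + ((if c1 > 0 then ?l c1 * \<psi> (join i j k (a1, a2) (n - (c1 - 1), n - c2)) else 0)
       + (if c2 > 0 then ?l c2 * \<psi> (join i j k (a1, a2) (n - c1, n - (c2 - 1))) else 0))"
    unfolding down[OF le(3), of "\<lambda>z. join i j k (a1, a2) (z, n - c2)"]
      down[OF le(4), of "\<lambda>z. join i j k (a1, a2) (n - c1, z)"] .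
  have l: "?l (Suc a1) * kernel_of n \<psi> (Suc a1, a2) (c1, c2)
        = ?s * (?l (Suc a1) * \<psi> (join i j k (Suc a1, a2) (n - c1, n - c2)))"
      "?l (Suc a2) * kernel_of n \<psi> (a1, Suc a2) (c1, c2)
        = ?s * (?l (Suc a2) * \<psi> (join i j k (a1, Suc a2) (n - c1, n - c2)))"
    unfolding kN using le by (cases "a1 < n"; cases "a2 < n"; auto simp: ladder_Suc_n)+
  have r: "?l c1 * kernel_of n \<psi> (a1, a2) (c1 - 1, c2)
        = - ?s * (if c1 > 0 then ?l c1 * \<psi> (join i j k (a1, a2) (n - (c1 - 1), n - c2)) else 0)"
    unfolding kN using le by (cases c1) auto
  have r': "?l c2 * kernel_of n \<psi> (a1, a2) (c1, c2 - 1)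
        = - ?s * (if c2 > 0 then ?l c2 * \<psi> (join i j k (a1, a2) (n - c1, n - (c2 - 1))) else 0)"
    unfolding kN using le by (cases c2) auto
  show ?L unfolding L unfolding e raise_def lower_def prod.case fst_conv snd_conv l r r'
    by (simp only: distrib_left minus_mult_left[symmetric] diff_conv_add_uminus minus_add_distrib minus_minus)
qed

text \<open>The conditions of \<open>H_inv_iff\<close> match the clauses of
  \<open>intertwiner\<close> one by one; since the second pair is reflected, total weight 2 n means
  that row and column have equal weight.\<close>

lemma H_inv_iff_intertwiner:
  assumes \<psi>: "\<psi> \<in> vecs (all_midxs n)"
  shows "\<psi> \<in> H_inv n \<longleftrightarrow> intertwiner n (kernel_of n \<psi>)"
proof -
  let ?N = "kernel_of n \<psi>"
  have weight: "(\<forall>m. \<psi> m \<noteq> 0 \<longrightarrow> (\<Sum>f\<in>UNIV. m f) = 2 * n) \<longleftrightarrow>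
     (\<forall>a c. ?N a c \<noteq> 0 \<longrightarrow> a \<in> grid n \<and> c \<in> grid n \<and> fst a + snd a = fst c + snd c)"
    (is "?W \<longleftrightarrow> ?W'")
  proof
    assume W: ?W
    show ?W'
    proof (intro allI impI)
      fix a c assume nz: "?N a c \<noteq> 0"
      then have g: "a \<in> grid n" "c \<in> grid n" by (auto simp: kernel_of_def split: if_splits)
      have "\<psi> (join i j k a (flip n c)) \<noteq> 0" using nz g by (simp add: kernel_of_def)
      then have "(\<Sum>f\<in>UNIV. join i j k a (flip n c) f) = 2 * n" using W by blast
      then have "fst a + snd a + (n - fst c + (n - snd c)) = 2 * n"
        unfolding sum_4 join_simps flip_def by simp
      moreover have "fst c \<le> n" "snd c \<le> n" using g by auto
      ultimately have "fst a + snd a = fst c + snd c" by linarith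
      then show "a \<in> grid n \<and> c \<in> grid n \<and> fst a + snd a = fst c + snd c" using g by blast
    qed
  next
    assume W': ?W'
    show ?W
    proof (intro allI impI)
      fix m assume nz: "\<psi> m \<noteq> 0"
      then have m: "m \<in> all_midxs n" using \<psi> unfolding vecs_def by blast
      then have le: "m f \<le> n" for f by (simp add: all_midxs_iff)
      have "tensor_of n ?N m \<noteq> 0" using nz by (simp add: tensor_of_kernel_of[OF \<psi>])
      then have "?N (m i, m j) (n - m k, n - m l) \<noteq> 0" using m by (simp add: tensor_of_def)
      then have "m i + m j = (n - m k) + (n - m l)" using W' by fastforce
      then show "(\<Sum>f\<in>UNIV. m f) = 2 * n" unfolding sum_4 using le[of k] le[of l] by linarith
    qed
  qed
  have out1: "(\<lambda>a. ?N a c) \<in> vecs (grid n)" and out2: "?N a \<in> vecs (grid n)" for a c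
    by (auto simp: kernel_of_def vecs_def)
  have zero: "raise n (\<lambda>_. 0) p = 0" "lower n (\<lambda>_. 0) p = 0" for p
    by (cases p; simp add: raise_def lower_def)+
  \<comment> \<open>\<open>intertwiner\<close> speaks about all index pairs,
    \<open>H_inv_iff\<close> only about those in range; outside the grid all terms are 0.\<close>
  have nongrid: "raise n (\<lambda>a. ?N a c) a = 0 \<and> lower n (?N a) c = 0 \<and>
      lower n (\<lambda>a. ?N a c) a = 0 \<and> raise n (?N a) c = 0" if ng: "\<not> (a \<in> grid n \<and> c \<in> grid n)" for a c
  proof (cases "a \<in> grid n")
    case True
    then have c: "c \<notin> grid n" using ng by blast
    then have "(\<lambda>a. ?N a c) = (\<lambda>_. 0)" by (simp add: kernel_of_def)
    moreover have "lower n (?N a) c = 0" "raise n (?N a) c = 0"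
      using lower_in_vecs[OF out2] raise_in_vecs[OF out2] c unfolding vecs_def by blast+
    ultimately show ?thesis using zero by simp
  next
    case False
    then have "?N a = (\<lambda>_. 0)" by (simp add: kernel_of_def)
    moreover have "lower n (\<lambda>a. ?N a c) a = 0" "raise n (\<lambda>a. ?N a c) a = 0"
      using lower_in_vecs[OF out1] raise_in_vecs[OF out1] False unfolding vecs_def by blast+
    ultimately show ?thesis using zero by simp
  qed
  have midx: "m \<in> all_midxs n \<longleftrightarrow> (\<exists>a\<in>grid n. \<exists>c\<in>grid n. m = join i j k a (flip n c))" for m
  proof
    assume "m \<in> all_midxs n"
    then have "m f \<le> n" for f by (simp add: all_midxs_iff)
    then have "m = join i j k (m i, m j) (flip n (n - m k, n - m l))" "(m i, m j) \<in> grid n"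
      "(n - m k, n - m l) \<in> grid n"
      by (simp_all add: flip_def join_components)
    then show "\<exists>a\<in>grid n. \<exists>c\<in>grid n. m = join i j k a (flip n c)" by blast
  next
    assume "\<exists>a\<in>grid n. \<exists>c\<in>grid n. m = join i j k a (flip n c)"
    then obtain a c where "a \<in> grid n" "c \<in> grid n" "m = join i j k a (flip n c)" by blast
    then show "m \<in> all_midxs n" by (auto simp: flip_def intro!: join_in_all_midxs)
  qed
  have "(\<forall>m\<in>all_midxs n. four_raise n \<psi> m = 0 \<and> four_lower n \<psi> m = 0) \<longleftrightarrow>
     (\<forall>a c. raise n (\<lambda>a. ?N a c) a = lower n (?N a) c) \<and> (\<forall>a c. lower n (\<lambda>a. ?N a c) a = raise n (?N a) c)"
    (is "?Z \<longleftrightarrow> ?Z1 \<and> ?Z2")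
  proof
    assume Z: ?Z
    have "raise n (\<lambda>a. ?N a c) a = lower n (?N a) c \<and> lower n (\<lambda>a. ?N a c) a = raise n (?N a) c" for a c
    proof (cases "a \<in> grid n \<and> c \<in> grid n")
      case True
      then have "join i j k a (flip n c) \<in> all_midxs n" using midx by blast
      then have "four_raise n \<psi> (join i j k a (flip n c)) = 0" "four_lower n \<psi> (join i j k a (flip n c)) = 0"
        using Z by blast+
      then have "raise n (\<lambda>a. ?N a c) a - lower n (?N a) c = 0" "lower n (\<lambda>a. ?N a c) a - raise n (?N a) c = 0"
        using kernel_of_raise[of a n c \<psi>] True by (simp_all only: mult_zero_right)
      then show ?thesis by (simp only: right_minus_eq)
    next
      case False
      from nongrid[OF this] show ?thesis by (simp only:)
    qed
    then show "?Z1 \<and> ?Z2" by blast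
  next
    assume Z: "?Z1 \<and> ?Z2"
    show ?Z
    proof
      fix m assume "m \<in> all_midxs n"
      then obtain a c where ac: "a \<in> grid n" "c \<in> grid n" and m: "m = join i j k a (flip n c)"
        using midx by blast
      have "raise n (\<lambda>a. ?N a c) a - lower n (?N a) c = 0" "lower n (\<lambda>a. ?N a c) a - raise n (?N a) c = 0"
        using Z by (simp_all only: right_minus_eq)
      then show "four_raise n \<psi> m = 0 \<and> four_lower n \<psi> m = 0"
        unfolding kernel_of_raise[OF ac] m by simp
    qed
  qed
  then show ?thesis unfolding H_inv_iff intertwiner_def weight using \<psi> by blast
qed


text \<open>The vector |J> with J = n - s. A projection of rank 2 J + 1 has squared Hilbert-Schmidt
  norm 2 J + 1, which is divided out.\<close>

definition invariant :: "nat \<Rightarrow> nat \<Rightarrow> midx vec" where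
  "invariant n s = (\<lambda>m. complex_of_real (1 / sqrt (spin_dim n s)) * tensor_of n (cg_proj n s) m)"

lemma cg_proj_support: "s \<le> n \<Longrightarrow> cg_proj n s a c \<noteq> 0 \<Longrightarrow> a \<in> grid n \<and> c \<in> grid n"
  using cg_proj_intertwiner unfolding intertwiner_def by blast

lemma tensor_cg_proj_in_H_inv: "s \<le> n \<Longrightarrow> tensor_of n (cg_proj n s) \<in> H_inv n"
  using H_inv_iff_intertwiner[OF tensor_of_in_vecs] cg_proj_intertwiner[of s n]
    kernel_of_tensor_of[of "cg_proj n s" n] cg_proj_support by metis

lemma inner_prod_tensor_cg_proj:
  assumes "s \<le> n" "t \<le> n"
  shows "inner_prod (all_midxs n) (tensor_of n (cg_proj n s)) (tensor_of n (cg_proj n t))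
    = (if s = t then complex_of_real (spin_dim n s) else 0)"
proof -
  have "inner_prod (all_midxs n) (tensor_of n (cg_proj n s)) (tensor_of n (cg_proj n t))
      = (\<Sum>a\<in>grid n. \<Sum>c\<in>grid n. cg_proj n t a c * cnj (cg_proj n s a c))"
    unfolding inner_prod_tensor_of by (simp add: mult.commute)
  also have "\<dots> = (\<Sum>a\<in>grid n. if t = s then cg_proj n t a a else 0)"
    unfolding sum_cg_proj_mult[OF assms(2,1)] ..
  also have "\<dots> = (if s = t then complex_of_real (spin_dim n s) else 0)"
    using sum_cg_proj_diag[OF assms(1)] by (auto simp: spin_dim_def)
  finally show ?thesis .
qed

lemma H_inv_comb:
  assumes "\<And>s. s \<in> S \<Longrightarrow> v s \<in> H_inv n"
  shows "(\<lambda>m. \<Sum>s\<in>S. z s * v s m) \<in> H_inv n"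
proof -
  have "v s \<in> vecs (all_midxs n)" "\<And>g. g \<in> SU2 \<Longrightarrow> op_apply (all_midxs n) (tensor4_rep n g) (v s) = v s"
    if "s \<in> S" for s
    using assms[OF that] by (auto simp: H_inv_def)
  moreover have "op_apply I X (\<lambda>m. \<Sum>s\<in>S. z s * v s m) = (\<lambda>m. \<Sum>s\<in>S. z s * op_apply I X (v s) m)" for I X
    unfolding op_apply_def sum_distrib_left by (intro ext, subst sum.swap) (simp add: mult_ac)
  ultimately show ?thesis by (auto simp: H_inv_def vecs_def intro!: sum.neutral sum.cong)
qed

lemma H_inv_expand:
  assumes "\<psi> \<in> H_inv n"
  obtains x where "\<psi> = tensor_of n (\<lambda>a c. \<Sum>s\<le>n. x s * cg_proj n s a c)"
    "\<psi> = (\<lambda>m. \<Sum>s\<le>n. x s * tensor_of n (cg_proj n s) m)"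
proof -
  have v: "\<psi> \<in> vecs (all_midxs n)" using assms by (simp add: H_inv_def)
  then obtain x where x: "\<And>a c. kernel_of n \<psi> a c = (\<Sum>s\<le>n. x s * cg_proj n s a c)"
    using intertwiner_expand assms unfolding H_inv_iff_intertwiner[OF v] by metis
  have "\<psi> = tensor_of n (kernel_of n \<psi>)" by (simp add: tensor_of_kernel_of[OF v])
  also have "kernel_of n \<psi> = (\<lambda>a c. \<Sum>s\<le>n. x s * cg_proj n s a c)"
    using x by (intro ext)
  finally have 1: "\<psi> = tensor_of n (\<lambda>a c. \<Sum>s\<le>n. x s * cg_proj n s a c)" .
  moreover have "\<dots> = (\<lambda>m. \<Sum>s\<le>n. x s * tensor_of n (cg_proj n s) m)"
    by (auto simp: tensor_of_def sum_distrib_left mult_ac)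
  ultimately show thesis by (intro that[of x]) simp_all
qed

text \<open>Converts the coefficients \<open>x\<close> on unnormalised projections into the
  amplitudes c_J on the orthonormal basis.\<close>

lemma inner_prod_invariant:
  assumes "s \<le> n"
  shows "inner_prod (all_midxs n) (invariant n s) (\<lambda>m. \<Sum>t\<le>n. x t * tensor_of n (cg_proj n t) m)
    = complex_of_real (sqrt (spin_dim n s)) * x s"
proof -
  have "inner_prod (all_midxs n) (invariant n s) (\<lambda>m. \<Sum>t\<le>n. x t * tensor_of n (cg_proj n t) m)
      = complex_of_real (1 / sqrt (spin_dim n s)) * (\<Sum>t\<le>n. if t = s then x t * complex_of_real (spin_dim n s) else 0)"
    unfolding invariant_def inner_prod_scale_left inner_prod_sum_right complex_cnj_complex_of_real
    using assms by (intro arg_cong2[where f = "(*)"] sum.cong refl) (auto simp: inner_prod_tensor_cg_proj)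
  also have "\<dots> = complex_of_real (1 / sqrt (spin_dim n s) * spin_dim n s) * x s"
    using assms by simp
  also have "1 / sqrt (spin_dim n s) * spin_dim n s = sqrt (spin_dim n s)"
    using spin_dim_pos[of n s] by (simp add: real_div_sqrt)
  finally show ?thesis .
qed

text \<open>Spanning is Schur's lemma through \<open>H_inv_expand\<close>. In particular the space
  of invariants has dimension n + 1 = D.\<close>

lemma invariant_basis: "subspace_basis (all_midxs n) (H_inv n) {..n} (invariant n)"
  unfolding subspace_basis_def orthonormal_family_def
proof (intro conjI ballI allI)
  show "finite (all_midxs n)" "finite {..n}" by (simp_all add: finite_midxs)
  have mem: "invariant n s \<in> H_inv n" if s: "s \<in> {..n}" for s
    using H_inv_comb[of "{s}" "\<lambda>s. tensor_of n (cg_proj n s)" n "\<lambda>_. complex_of_real (1 / sqrt (spin_dim n s))"]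
      tensor_cg_proj_in_H_inv[of s n] s by (simp add: invariant_def)
  show "invariant n s \<in> vecs (all_midxs n)" if "s \<in> {..n}" for s
    using mem[OF that] by (simp add: H_inv_def)
  show "(\<lambda>m. \<Sum>s\<in>{..n}. z s * invariant n s m) \<in> H_inv n" for z
    by (rule H_inv_comb[OF mem])
  show "inner_prod (all_midxs n) (invariant n s) (invariant n t) = (if s = t then 1 else 0)"
    if "s \<in> {..n}" "t \<in> {..n}" for s t
  proof -
    define x where "x = (\<lambda>u. if u = t then complex_of_real (1 / sqrt (spin_dim n t)) else 0)"
    have "invariant n t = (\<lambda>m. \<Sum>u\<le>n. x u * tensor_of n (cg_proj n u) m)"
      using that by (simp add: x_def invariant_def if_distribR if_distrib cong: if_cong)
    then have "inner_prod (all_midxs n) (invariant n s) (invariant n t) = complex_of_real (sqrt (spin_dim n s)) * x s"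
      using inner_prod_invariant that by simp
    then show ?thesis using spin_dim_pos[of n s] by (cases "s = t") (simp_all add: x_def)
  qed
  fix \<psi> assume "\<psi> \<in> H_inv n"
  then obtain x where x: "\<psi> = (\<lambda>m. \<Sum>s\<le>n. x s * tensor_of n (cg_proj n s) m)"
    by (rule H_inv_expand)
  have "inner_prod (all_midxs n) (invariant n s) \<psi> * invariant n s m = x s * tensor_of n (cg_proj n s) m"
    if "s \<in> {..n}" for s m
  proof -
    have "inner_prod (all_midxs n) (invariant n s) \<psi> = complex_of_real (sqrt (spin_dim n s)) * x s"
      unfolding x using that by (intro inner_prod_invariant) simp
    then show ?thesis using spin_dim_pos[of n s] by (simp add: invariant_def)
  qed
  then have "(\<Sum>s\<le>n. inner_prod (all_midxs n) (invariant n s) \<psi> * invariant n s m) = \<psi> m" for m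
    by (subst x) (intro sum.cong refl, simp)
  then show "\<psi> = (\<lambda>m. \<Sum>s\<in>{..n}. inner_prod (all_midxs n) (invariant n s) \<psi> * invariant n s m)"
    by simp
qed

text \<open>Each spin-\<open>J\<close> component of an invariant tensor is maximally entangled.\<close>

lemma entanglement_entropy_H_inv:
  assumes \<psi>: "\<psi> \<in> H_inv n"
  defines "p \<equiv> \<lambda>s. (cmod (inner_prod (all_midxs n) (invariant n s) \<psi>))\<^sup>2"
  shows "entanglement_entropy n {i, j} \<psi> = - (\<Sum>s\<le>n. p s * ln (p s / spin_dim n s))"
proof -
  obtain x where x1: "\<psi> = tensor_of n (\<lambda>a c. \<Sum>s\<le>n. x s * cg_proj n s a c)"
    and x2: "\<psi> = (\<lambda>m. \<Sum>s\<le>n. x s * tensor_of n (cg_proj n s) m)"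
    by (rule H_inv_expand[OF \<psi>])
  let ?I = "midxs n {i, j}"
  \<comment> \<open>The coupled basis of the pair {i, j}, transported to multi-indices; it
    diagonalises the reduced density matrix whatever the coefficients are.\<close>
  define u where "u = (\<lambda>q m. if m \<in> ?I then cg n q (m i, m j) else 0)"
  have uh: "u q (half i j a) = cg n q a" if "a \<in> grid n" for q a
  proof -
    have "half i j a \<in> ?I" using bij_betw_half[OF neq(1), of n] that by (auto simp: bij_betw_def)
    then show ?thesis using neq by (simp add: u_def half_def)
  qed
  have on: "orthonormal_family ?I (cg_index n) u"
    unfolding orthonormal_family_def
  proof (intro conjI ballI)
    fix q r assume q: "q \<in> cg_index n" "r \<in> cg_index n"
    have "inner_prod ?I (u q) (u r) = inner_prod (grid n) (cg n q) (cg n r)"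
      unfolding inner_prod_def sum.reindex_bij_betw[OF bij_betw_half[OF neq(1)], symmetric]
      by (intro sum.cong refl) (simp add: uh)
    then show "inner_prod ?I (u q) (u r) = (if q = r then 1 else 0)"
      using cg_orthonormal[of n] q unfolding orthonormal_family_def by simp
  qed (simp add: u_def vecs_def)
  define d where "d = (\<lambda>q :: nat \<times> nat. (cmod (x (fst q)))\<^sup>2)"
  have \<rho>: "reduced_density n {i, j} \<psi> m m' = (\<Sum>q\<in>cg_index n. complex_of_real (d q) * (u q m * cnj (u q m')))" for m m'
  proof (cases "m \<in> ?I \<and> m' \<in> ?I")
    case True
    then obtain a a' where a: "a \<in> grid n" "a' \<in> grid n" "m = half i j a" "m' = half i j a'"
      using bij_betw_half[OF neq(1), of n] unfolding bij_betw_def by blast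
    let ?N = "\<lambda>a c. \<Sum>s\<le>n. x s * cg_proj n s a c"
    have "reduced_density n {i, j} \<psi> m m'
        = (\<Sum>c\<in>grid n. \<psi> (join i j k a (flip n c)) * cnj (\<psi> (join i j k a' (flip n c))))"
      unfolding a(3,4) reduced_density_half[OF a(1,2)] by (rule sum_grid_flip[symmetric])
    also have "\<dots> = (\<Sum>c\<in>grid n. ?N a c * cnj (?N a' c))"
      unfolding x1 using a(1,2) by (intro sum.cong refl) (simp add: tensor_of_join mult_ac sign_square)
    also have "\<dots> = (\<Sum>c\<in>grid n. \<Sum>s\<le>n. \<Sum>t\<le>n. x s * cnj (x t) * (cg_proj n s a c * cnj (cg_proj n t a' c)))"
      unfolding cnj_sum sum_product by (intro sum.cong refl) (simp add: mult_ac)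
    also have "\<dots> = (\<Sum>s\<le>n. \<Sum>t\<le>n. \<Sum>c\<in>grid n. x s * cnj (x t) * (cg_proj n s a c * cnj (cg_proj n t a' c)))"
      by (subst sum.swap, intro sum.cong refl, rule sum.swap)
    \<comment> \<open>Products of projections with different spin vanish, which removes all
      interference between the components.\<close>
    also have "\<dots> = (\<Sum>s\<le>n. \<Sum>t\<le>n. if s = t then x s * cnj (x t) * cg_proj n s a a' else 0)"
      unfolding sum_distrib_left[symmetric] by (intro sum.cong refl) (simp add: sum_cg_proj_mult)
    also have "\<dots> = (\<Sum>s\<le>n. x s * cnj (x s) * cg_proj n s a a')" by simp
    also have "\<dots> = (\<Sum>s\<le>n. \<Sum>r\<le>2 * (n - s). complex_of_real ((cmod (x s))\<^sup>2) * (cg n (s, r) a * cnj (cg n (s, r) a')))"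
      unfolding complex_norm_square cg_proj_def sum_distrib_left ..
    also have "\<dots> = (\<Sum>q\<in>cg_index n. complex_of_real (d q) * (cg n q a * cnj (cg n q a')))"
      unfolding cg_index_def by (subst sum.Sigma) (auto simp: d_def intro!: sum.cong)
    finally show ?thesis unfolding a(3,4) uh[OF a(1)] uh[OF a(2)] .
  next
    case False
    then have "u q m * cnj (u q m') = 0" for q by (auto simp: u_def)
    then have "(\<Sum>q\<in>cg_index n. complex_of_real (d q) * (u q m * cnj (u q m'))) = 0"
      by (intro sum.neutral ballI) simp
    then show ?thesis using reduced_density_outside[of m n "{i, j}" m' \<psi>] False by simp
  qed
  have "entanglement_entropy n {i, j} \<psi> = - (\<Sum>q\<in>cg_index n. d q * ln (d q))"
    unfolding entanglement_entropy_def
    by (rule von_neumann_entropy_eqI[OF finite_midxs on finite_cg_index _ \<rho>])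
       (simp add: card_cg_index card_midxs neq)
  also have "(\<Sum>q\<in>cg_index n. d q * ln (d q)) = (\<Sum>s\<le>n. \<Sum>r\<le>2 * (n - s). d (s, r) * ln (d (s, r)))"
    unfolding cg_index_def by (subst sum.Sigma) auto
  \<comment> \<open>The eigenvalue does not depend on \<open>r\<close> and so counts 2 J + 1
    times.\<close>
  also have "\<dots> = (\<Sum>s\<le>n. spin_dim n s * ((cmod (x s))\<^sup>2 * ln ((cmod (x s))\<^sup>2)))"
    by (simp add: d_def spin_dim_def algebra_simps)
  also have "\<dots> = (\<Sum>s\<le>n. p s * ln (p s / spin_dim n s))"
  proof (intro sum.cong refl)
    fix s assume "s \<in> {..n}"
    then have "inner_prod (all_midxs n) (invariant n s) \<psi> = complex_of_real (sqrt (spin_dim n s)) * x s"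
      unfolding x2 by (intro inner_prod_invariant) simp
    then have "p s = spin_dim n s * (cmod (x s))\<^sup>2"
      using spin_dim_pos[of n s] by (simp add: p_def norm_mult power_mult_distrib)
    then show "spin_dim n s * ((cmod (x s))\<^sup>2 * ln ((cmod (x s))\<^sup>2)) = p s * ln (p s / spin_dim n s)"
      using spin_dim_pos[of n s] by simp
  qed
  finally show ?thesis .
qed

end


section \<open>Concentration of the entropy\<close>

text \<open>Jensen's inequality for ln in tangent form: ln lies below its tangent at
  \<open>t\<close>. Any upper bound \<open>t\<close> of the purity may serve as the point of
  contact.\<close>

lemma entropy_ge_neg_ln_purity:
  fixes p d :: "nat \<Rightarrow> real"
  assumes p: "\<And>s. s \<in> S \<Longrightarrow> p s \<ge> 0" and d: "\<And>s. s \<in> S \<Longrightarrow> d s > 0"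
    and sum1: "(\<Sum>s\<in>S. p s) = 1" and t: "t > 0" and purity: "(\<Sum>s\<in>S. (p s)\<^sup>2 / d s) \<le> t"
  shows "- (\<Sum>s\<in>S. p s * ln (p s / d s)) \<ge> - ln t"
proof -
  have "p s * ln (p s / d s) \<le> p s * ln t + (p s)\<^sup>2 / d s / t - p s" if s: "s \<in> S" for s
  proof (cases "p s = 0")
    case False
    then have pos: "p s > 0" using p[OF s] by simp
    have "ln (p s / d s / t) \<le> p s / d s / t - 1"
      using pos d[OF s] t by (intro ln_le_minus_one) simp
    then have "ln (p s / d s) - ln t \<le> p s / d s / t - 1"
      using pos d[OF s] t by (simp add: ln_div ln_mult)
    then have "p s * (ln (p s / d s) - ln t) \<le> p s * (p s / d s / t - 1)"
      using pos by simp
    then show ?thesis by (simp add: algebra_simps power2_eq_square)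
  qed simp
  then have "(\<Sum>s\<in>S. p s * ln (p s / d s)) \<le> (\<Sum>s\<in>S. p s * ln t + (p s)\<^sup>2 / d s / t - p s)"
    by (rule sum_mono)
  also have "\<dots> = ln t + (\<Sum>s\<in>S. (p s)\<^sup>2 / d s) / t - 1"
    unfolding sum.distrib sum_subtractf sum_distrib_right[symmetric] sum_divide_distrib[symmetric] sum1
    by simp
  also have "\<dots> \<le> ln t" using purity t by simp
  finally show ?thesis by simp
qed

text \<open>The step from n to n + 1 adds 1/(2 n + 3), which is at most 1/(n + 2) and so at most ln
  (n + 2) - ln (n + 1).\<close>

lemma sum_inverse_spin_dim: "(\<Sum>s\<le>n. 1 / spin_dim n s) \<le> 1 + ln (real n + 1)"
proof -
  have "(\<Sum>s\<le>n. 1 / spin_dim n s) = (\<Sum>s\<le>n. 1 / real (2 * s + 1))"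
    unfolding spin_dim_def
    by (rule sum.reindex_bij_witness[where i = "\<lambda>s. n - s" and j = "\<lambda>s. n - s"]) auto
  also have "\<dots> \<le> 1 + ln (real n + 1)"
  proof (induction n)
    case (Suc n)
    have "ln ((real n + 1) / (real n + 2)) \<le> (real n + 1) / (real n + 2) - 1"
      by (intro ln_le_minus_one) simp
    then have "ln (real n + 1) - ln (real n + 2) \<le> (real n + 1) / (real n + 2) - 1"
      by (simp add: ln_div)
    also have "\<dots> = - (1 / (real n + 2))" by (simp add: field_simps)
    also have "\<dots> \<le> - (1 / real (2 * Suc n + 1))" by (simp add: frac_le)
    finally show ?case using Suc by (simp add: add.commute)
  qed simp
  finally show ?thesis .
qed

text \<open>Markov's inequality for the purity at a free threshold \<open>t\<close>: outside an
  event of small probability the purity is below \<open>t\<close>, and then the entropy is at least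
  \<open>- ln t\<close>.\<close>

lemma entropy_concentration:
  assumes distinct: "distinct [i, j, k, l :: 4]"
    and haar: "haar_prob (unitary_group (all_midxs n) (H_inv n)) (op_mult (all_midxs n)) M"
    and unit: "\<psi>0 \<in> unit_vecs (all_midxs n) (H_inv n)" and t: "t > 0"
  defines "S \<equiv> \<lambda>U. entanglement_entropy n {i, j} (op_apply (all_midxs n) U \<psi>0)"
  shows "{U \<in> space M. S U \<ge> c} \<in> sets M"
    and "measure M {U \<in> space M. S U \<ge> - ln t} \<ge> 1 - 2 * (1 + ln (real n + 1)) / (real n + 1)\<^sup>2 / t"
proof -
  interpret prob_space M by (rule haar_prob_space[OF haar unit])
  note basis = invariant_basis[OF distinct, of n]
  define z where "z = (\<lambda>s U. inner_prod (all_midxs n) (invariant i j k l n s) (op_apply (all_midxs n) U \<psi>0))"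
  have [measurable]: "z s \<in> borel_measurable M" for s
    unfolding z_def by (rule haar_coeff_measurable[OF haar unit])
  have entropy: "S U = - (\<Sum>s\<le>n. (cmod (z s U))\<^sup>2 * ln ((cmod (z s U))\<^sup>2 / spin_dim n s))"
    if "U \<in> space M" for U
    using haar_unit_vec[OF haar unit that] unfolding S_def z_def
    by (intro entanglement_entropy_H_inv[OF distinct]) (simp add: unit_vecs_def)
  \<comment> \<open>Measurability is read off from the closed formula in the coefficients, because
    the entropy itself is defined through a definite description.\<close>
  have "(\<lambda>U. - (\<Sum>s\<le>n. (cmod (z s U))\<^sup>2 * ln ((cmod (z s U))\<^sup>2 / spin_dim n s))) \<in> borel_measurable M"
    by measurable
  then have S_meas: "S \<in> borel_measurable M"
    using entropy by (subst measurable_cong) auto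
  then show sets: "{U \<in> space M. S U \<ge> c} \<in> sets M" for c
    by measurable
  \<comment> \<open>The purity of the reduced state: the eigenvalue p_s / (2 J + 1) has multiplicity
    2 J + 1.\<close>
  define X where "X = (\<lambda>U. \<Sum>s\<le>n. ((cmod (z s U))\<^sup>2)\<^sup>2 / spin_dim n s)"
  have int4: "integrable M (\<lambda>U. ((cmod (z s U))\<^sup>2)\<^sup>2)" if "s \<le> n" for s
    using haar_integrable_coeff_products[OF haar unit basis, of s s] that
    by (simp add: z_def power2_eq_square)
  then have int: "integrable M X" unfolding X_def by (intro Bochner_Integration.integrable_sum) auto
  have m4: "expectation (\<lambda>U. ((cmod (z s U))\<^sup>2)\<^sup>2) = 2 / ((real n + 1) * (real n + 2))" if "s \<le> n" for s
    using haar_fourth_moment[OF haar unit basis, of s] that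
    by (simp add: z_def power_mult[symmetric] add.commute)
  have "expectation X = (\<Sum>s\<le>n. 2 / ((real n + 1) * (real n + 2)) / spin_dim n s)"
    unfolding X_def using int4 m4 by (subst Bochner_Integration.integral_sum) auto
  also have "\<dots> = 2 / ((real n + 1) * (real n + 2)) * (\<Sum>s\<le>n. 1 / spin_dim n s)"
    by (simp add: sum_distrib_left)
  also have "\<dots> \<le> 2 / (real n + 1)\<^sup>2 * (1 + ln (real n + 1))"
    using sum_inverse_spin_dim[of n] spin_dim_pos
    by (intro mult_mono frac_le sum_nonneg) (auto simp: power2_eq_square less_imp_le)
  finally have EX: "expectation X \<le> 2 * (1 + ln (real n + 1)) / (real n + 1)\<^sup>2" by simp
  have nonneg: "X U \<ge> 0" for U
    unfolding X_def using spin_dim_pos by (intro sum_nonneg) (simp add: less_imp_le)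
  have X_meas: "X \<in> borel_measurable M" using int by blast
  have "prob {U \<in> space M. X U \<ge> t} \<le> expectation X / t"
    using int nonneg t by (intro integral_Markov_inequality_measure[where A = "{}"]) auto
  also have "\<dots> \<le> 2 * (1 + ln (real n + 1)) / (real n + 1)\<^sup>2 / t"
    using EX t by (intro divide_right_mono) auto
  finally have bad: "prob {U \<in> space M. X U \<ge> t} \<le> 2 * (1 + ln (real n + 1)) / (real n + 1)\<^sup>2 / t" .
  have "{U \<in> space M. X U \<ge> t} \<in> sets M" using X_meas by measurable
  then have "1 - prob {U \<in> space M. X U \<ge> t} = prob (space M - {U \<in> space M. X U \<ge> t})"
    by (simp add: prob_compl)
  also have "\<dots> \<le> prob {U \<in> space M. S U \<ge> - ln t}"
  proof (rule finite_measure_mono[OF _ sets])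
    show "space M - {U \<in> space M. X U \<ge> t} \<subseteq> {U \<in> space M. S U \<ge> - ln t}"
    proof
      fix U assume U: "U \<in> space M - {U \<in> space M. X U \<ge> t}"
      then have "U \<in> space M" "X U \<le> t" by auto
      moreover have "(\<Sum>s\<le>n. (cmod (z s U))\<^sup>2) = 1"
        using basis_sum_norm[OF basis haar_unit_vec[OF haar unit]] U by (simp add: z_def)
      ultimately have "S U \<ge> - ln t"
        unfolding entropy[OF \<open>U \<in> space M\<close>] using t spin_dim_pos unfolding X_def
        by (intro entropy_ge_neg_ln_purity) auto
      then show "U \<in> {U \<in> space M. S U \<ge> - ln t}" using U by simp
    qed
  qed
  finally show "measure M {U \<in> space M. S U \<ge> - ln t} \<ge> 1 - 2 * (1 + ln (real n + 1)) / (real n + 1)\<^sup>2 / t"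
    using bad by simp
qed

lemma pairs_of_factors:
  fixes A :: "4 set"
  assumes "card A = 2"
  obtains i j k l where "distinct [i, j, k, l]" "A = {i, j}"
proof -
  have "card (- A) = 2" using assms by (simp add: Compl_eq_Diff_UNIV card_Diff_subset)
  then obtain k l where kl: "- A = {k, l}" "k \<noteq> l" by (auto simp: card_2_iff)
  obtain i j where ij: "A = {i, j}" "i \<noteq> j" using assms by (auto simp: card_2_iff)
  have "distinct [i, j, k, l]" using ij kl by auto
  then show thesis using ij(1) by (rule that)
qed

theorem mainTheorem5:
  fixes \<mu> :: "nat \<Rightarrow> midx op measure"
    and \<psi>0 :: "nat \<Rightarrow> midx vec"
  assumes haar: "\<And>n. n \<ge> 1 \<Longrightarrow>
      haar_prob (unitary_group (all_midxs n) (H_inv n)) (op_mult (all_midxs n)) (\<mu> n)"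
    and unit: "\<And>n. n \<ge> 1 \<Longrightarrow> \<psi>0 n \<in> unit_vecs (all_midxs n) (H_inv n)"
  shows "\<forall>A :: 4 set. card A = 2 \<longrightarrow>
    (\<forall>n\<ge>1.
       (\<forall>\<psi> \<in> unit_vecs (all_midxs n) (vecs (all_midxs n)).
          entanglement_entropy n A \<psi> \<le> ln ((real n + 1)\<^sup>2)) \<and>
       (\<exists>\<psi> \<in> unit_vecs (all_midxs n) (vecs (all_midxs n)).
          entanglement_entropy n A \<psi> = ln ((real n + 1)\<^sup>2))) \<and>
    (\<forall>\<epsilon>>0. (\<lambda>n. \<P>(U in \<mu> n.
         entanglement_entropy n A (op_apply (all_midxs n) U (\<psi>0 n)) / ln ((real n + 1)\<^sup>2) \<ge> 1 - \<epsilon>))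
       \<longlonglongrightarrow> 1)"
proof (intro allI impI conjI ballI)
  fix A :: "4 set" assume "card A = 2"
  then obtain i j k l where d: "distinct [i, j, k, l]" and A: "A = {i, j}" by (rule pairs_of_factors)
  show "entanglement_entropy n A \<psi> \<le> ln ((real n + 1)\<^sup>2)"
    if "\<psi> \<in> unit_vecs (all_midxs n) (vecs (all_midxs n))" for n \<psi>
    unfolding A by (rule entanglement_entropy_le[OF d that])
  show "\<exists>\<psi> \<in> unit_vecs (all_midxs n) (vecs (all_midxs n)). entanglement_entropy n A \<psi> = ln ((real n + 1)\<^sup>2)" for n
    unfolding A using entanglement_entropy_maximal[OF d] by metis
  fix \<epsilon> :: real assume \<epsilon>: "\<epsilon> > 0"
  let ?S = "\<lambda>n U. entanglement_entropy n A (op_apply (all_midxs n) U (\<psi>0 n))"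
  let ?P = "\<lambda>n. \<P>(U in \<mu> n. ?S n U / ln ((real n + 1)\<^sup>2) \<ge> 1 - \<epsilon>)"
  \<comment> \<open>The purity threshold whose negative logarithm is 1 - \<epsilon> times the
    maximal entropy.\<close>
  define t where "t = (\<lambda>n. ((real n + 1)\<^sup>2) powr (- (1 - \<epsilon>)))"
  \<comment> \<open>With D = n + 1 this is 1 - 2 (1 + ln D) / D^(2 \<epsilon>), which tends to 1 for
    every \<epsilon> > 0.\<close>
  define b where "b = (\<lambda>n. 1 - 2 * (1 + ln (real n + 1)) / (real n + 1)\<^sup>2 / t n)"
  have "b n \<le> ?P n \<and> ?P n \<le> 1" if n: "n \<ge> 1" for n
  proof -
    interpret prob_space "\<mu> n" by (rule haar_prob_space[OF haar[OF n] unit[OF n]])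
    \<comment> \<open>At n = 0 the maximal entropy is ln 1 = 0; from n = 1 on the quotient can be
      cleared.\<close>
    have D: "ln ((real n + 1)\<^sup>2) > 0" using n by (intro ln_gt_zero one_less_power) auto
    have t: "t n > 0" "- ln (t n) = (1 - \<epsilon>) * ln ((real n + 1)\<^sup>2)"
      by (auto simp: t_def ln_powr algebra_simps)
    have "?S n U / ln ((real n + 1)\<^sup>2) \<ge> 1 - \<epsilon> \<longleftrightarrow> ?S n U \<ge> - ln (t n)" for U
      unfolding t(2) using D by (simp add: pos_le_divide_eq)
    then have "?P n = prob {U \<in> space (\<mu> n). ?S n U \<ge> - ln (t n)}" by simp
    then show ?thesis
      using entropy_concentration(2)[OF d haar[OF n] unit[OF n] t(1)] by (simp add: b_def A)
  qed
  then have lower: "\<forall>\<^sub>F n in sequentially. b n \<le> ?P n" and upper: "\<forall>\<^sub>F n in sequentially. ?P n \<le> 1"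
    by (auto intro: eventually_sequentiallyI[of 1])
  have "b \<longlonglongrightarrow> 1"
    unfolding b_def t_def using \<epsilon> by real_asymp
  then show "?P \<longlonglongrightarrow> 1"
    by (rule tendsto_sandwich[OF lower upper _ tendsto_const])
qed

end
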